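(* Let $(P,\le,+,0)$ be a preordered set with a compatible abelian group structure, let $R$ be a unital ring, and let $*$ denote either $\mathbf{sh}$ or $\mathbf{gr}$. Let $A$ be a left persistence module, and let $(K,d)$ be a complex of projective left persistence modules whose subcomplex $B$ of boundaries has all terms projective. \begin{itemize} \item[1)] For all $n\in \mathbb{N}$ there is a natural short exact sequence $$0\to \mathbf{Ext}_*^1(H_{n-1}(K),A)\to H^n(\mathbf{Hom}^*(K,A))\to \mathrm{Hom}^*(H_n(K),A)\to 0.$$ \item[2)] If $R[U_0]$ is left hereditary, then for all $n\in\mathbb{N}$ the natural short exact sequence $$0\to \mathbf{Ext}_*^1(H_{n-1}(K),A)\to H^n(\mathbf{Hom}^*(K,A))\to \mathrm{Hom}^*(H_n(K),A)\to 0$$ splits (it need not be a natural splitting). \end{itemize}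
   Context: Compatible means: $a\le b$ implies $a+c\le b+c$ for all $a,b,c\in P$. Let $\mathbf{P}$ be the category associated to $(P,\le)$. A left persistence module is a functor from $\mathbf{P}$ to left $R$-modules; morphisms are natural transformations and $\mathrm{Hom}(M,N)$ is the abelian group of natural transformations. Let $U_a=\{x\in P: a\le x\}$, and let $R[U_0]$ be the monoid ring, $P$-graded with $x^s$ ($s\in U_0$) in degree $s$; a left persistence module $M$ is identified with the $P$-graded left $R[U_0]$-module $\bigoplus_{a\in P}M_a$ where $x^s$ acts as $M_{a\le a+s}$. "Projective" is meant in this category; $R[U_0]$ is left hereditary if graded submodules of projective graded left modules are projective. $\mathrm{Hom}^{\mathbf{gr}}=\underline{\mathrm{Hom}}$: $\underline{\mathrm{Hom}}(M,N)_s=\mathrm{Hom}(M,N(s))$, where $N(s)_x=N_{s+x}$, with map for $s\le t$ obtained by composing components $M_x\to N_{x+s}$ with $N_{x+s\le x+t}$. $\mathrm{Hom}^{\mathbf{sh}}=\mathcal{H}om$ (sheaf hom): viewing persistence modules as sheaves on $P$ with the Alexandrov topology (open sets are up-sets), $\mathcal{H}om(M,N)(U)=\mathrm{Hom}(M|_U,N|_U)$; as a functor on $\mathbf{P}$, $\mathcal{H}om(M,N)_a=\mathrm{Hom}(M|_{U_a},N|_{U_a})$ with restriction maps. $\mathbf{Ext}^i_*$ denotes the $i$-th right derived functor of $\mathrm{Hom}^*$, computed by applying $\mathrm{Hom}^*(-,N)$ to a projective resolution of the first argument. $\mathbf{Hom}^*(K,A)$ is the cochain complex with $n$-th term $\mathrm{Hom}^*(K_n,A)$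 and differential induced (up to sign) by $d$. The subcomplex of boundaries of $K$ has terms $d_n(K_n)$. *)

theory Defs
  imports "HOL-Algebra.Module" "HOL-Algebra.AbelCoset"
begin

class preordered_ab_group_add = ab_group_add + preorder +
  assumes add_right_compat: "a \<le> b \<Longrightarrow> a + c \<le> b + c"

text \<open>
  The library locale \<^locale>\<open>module\<close> insists on a commutative base ring.  The
  \<open>mult\<close> and \<open>one\<close> fields of the module record are not used.
\<close>

locale left_module = R?: ring R + M?: abelian_group M
  for R :: "('r, 'k) ring_scheme" (structure) and M :: "('r, 'm, 'l) module_scheme" (structure) +
  assumes smult_closed:
      "\<lbrakk>a \<in> carrier R; x \<in> carrier M\<rbrakk> \<Longrightarrow> a \<odot>\<^bsub>M\<^esub> x \<in> carrier M"
    and smult_l_distr: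
      "\<lbrakk>a \<in> carrier R; b \<in> carrier R; x \<in> carrier M\<rbrakk> \<Longrightarrow>
        (a \<oplus>\<^bsub>R\<^esub> b) \<odot>\<^bsub>M\<^esub> x = a \<odot>\<^bsub>M\<^esub> x \<oplus>\<^bsub>M\<^esub> b \<odot>\<^bsub>M\<^esub> x"
    and smult_r_distr:
      "\<lbrakk>a \<in> carrier R; x \<in> carrier M; y \<in> carrier M\<rbrakk> \<Longrightarrow>
        a \<odot>\<^bsub>M\<^esub> (x \<oplus>\<^bsub>M\<^esub> y) = a \<odot>\<^bsub>M\<^esub> x \<oplus>\<^bsub>M\<^esub> a \<odot>\<^bsub>M\<^esub> y"
    and smult_assoc:
      "\<lbrakk>a \<in> carrier R; b \<in> carrier R; x \<in> carrier M\<rbrakk> \<Longrightarrow>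
        (a \<otimes>\<^bsub>R\<^esub> b) \<odot>\<^bsub>M\<^esub> x = a \<odot>\<^bsub>M\<^esub> (b \<odot>\<^bsub>M\<^esub> x)"
    and smult_one:
      "x \<in> carrier M \<Longrightarrow> \<one>\<^bsub>R\<^esub> \<odot>\<^bsub>M\<^esub> x = x"

definition linear_maps ::
  "'r ring \<Rightarrow> ('r, 'm) module \<Rightarrow> ('r, 'n) module \<Rightarrow> ('m \<Rightarrow> 'n) set" where
  "linear_maps R M N =
     {f \<in> carrier M \<rightarrow>\<^sub>E carrier N.
        (\<forall>x\<in>carrier M. \<forall>y\<in>carrier M. f (x \<oplus>\<^bsub>M\<^esub> y) = f x \<oplus>\<^bsub>N\<^esub> f y) \<and>
        (\<forall>r\<in>carrier R. \<forall>x\<in>carrier M. f (r \<odot>\<^bsub>M\<^esub> x) = r \<odot>\<^bsub>N\<^esub> f x)}"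


section \<open>Diagrams over the category of the preorder\<close>

text \<open>
  A diagram consists of objects \<open>ob M a\<close> and transition maps \<open>tr M a b\<close>.  The transition maps
  matter only for \<open>a \<le> b\<close> and on the carrier of \<open>ob M a\<close>.  The objects are left modules
  (persistence modules) or abelian groups, written multiplicatively (persistence groups).
\<close>

record ('p, 'e, 'o) diagram =
  ob :: "'p \<Rightarrow> 'o"
  tr :: "'p \<Rightarrow> 'p \<Rightarrow> 'e \<Rightarrow> 'e"

type_synonym ('p, 'r, 'm) pmod = "('p, 'm, ('r, 'm) module) diagram"
type_synonym ('p, 'g) pgroup = "('p, 'g, 'g monoid) diagram"

definition persistence_module :: "'r ring \<Rightarrow> ('p::preorder, 'r, 'm) pmod \<Rightarrow> bool" where
  "persistence_module R M \<longleftrightarrow>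
     (\<forall>a. left_module R (ob M a)) \<and>
     (\<forall>a b. a \<le> b \<longrightarrow> restrict (tr M a b) (carrier (ob M a)) \<in> linear_maps R (ob M a) (ob M b)) \<and>
     (\<forall>a. \<forall>m\<in>carrier (ob M a). tr M a a m = m) \<and>
     (\<forall>a b c. a \<le> b \<longrightarrow> b \<le> c \<longrightarrow>
        (\<forall>m\<in>carrier (ob M a). tr M b c (tr M a b m) = tr M a c m))"

definition persistence_group :: "('p::preorder, 'g) pgroup \<Rightarrow> bool" where
  "persistence_group G \<longleftrightarrow>
     (\<forall>a. comm_group (ob G a)) \<and>
     (\<forall>a b. a \<le> b \<longrightarrow> tr G a b \<in> hom (ob G a) (ob G b)) \<and>
     (\<forall>a. \<forall>x\<in>carrier (ob G a). tr G a a x = x) \<and>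
     (\<forall>a b c. a \<le> b \<longrightarrow> b \<le> c \<longrightarrow>
        (\<forall>x\<in>carrier (ob G a). tr G b c (tr G a b x) = tr G a c x))"

text \<open>
  \<open>nat_trans R U M N\<close> is the set of natural transformations between the restrictions of \<open>M\<close> and
  \<open>N\<close> to the full subcategory on \<open>U\<close>; they are made extensional, so that equality is equality of
  natural transformations.
\<close>

definition nat_trans ::
  "'r ring \<Rightarrow> 'p set \<Rightarrow> ('p::preorder, 'r, 'm) pmod \<Rightarrow> ('p, 'r, 'n) pmod \<Rightarrow> ('p \<Rightarrow> 'm \<Rightarrow> 'n) set" where
  "nat_trans R U M N =
     {f \<in> (\<Pi>\<^sub>E x\<in>U. linear_maps R (ob M x) (ob N x)).
        \<forall>x\<in>U. \<forall>y\<in>U. x \<le> y \<longrightarrow>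
          (\<forall>m\<in>carrier (ob M x). f y (tr M x y m) = tr N x y (f x m))}"

abbreviation pmod_hom ::
  "'r ring \<Rightarrow> ('p::preorder, 'r, 'm) pmod \<Rightarrow> ('p, 'r, 'n) pmod \<Rightarrow> ('p \<Rightarrow> 'm \<Rightarrow> 'n) set" where
  "pmod_hom R M N \<equiv> nat_trans R UNIV M N"

definition pgroup_hom ::
  "('p::preorder, 'g) pgroup \<Rightarrow> ('p, 'h) pgroup \<Rightarrow> ('p \<Rightarrow> 'g \<Rightarrow> 'h) \<Rightarrow> bool" where
  "pgroup_hom G H f \<longleftrightarrow>
     (\<forall>a. f a \<in> hom (ob G a) (ob H a)) \<and>
     (\<forall>a b. a \<le> b \<longrightarrow> (\<forall>x\<in>carrier (ob G a). f b (tr G a b x) = tr H a b (f a x)))"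

definition short_exact ::
  "('p::preorder, 'g) pgroup \<Rightarrow> ('p, 'h) pgroup \<Rightarrow> ('p, 'k) pgroup \<Rightarrow>
    ('p \<Rightarrow> 'g \<Rightarrow> 'h) \<Rightarrow> ('p \<Rightarrow> 'h \<Rightarrow> 'k) \<Rightarrow> bool" where
  "short_exact G H K i q \<longleftrightarrow>
     persistence_group G \<and> persistence_group H \<and> persistence_group K \<and>
     pgroup_hom G H i \<and> pgroup_hom H K q \<and>
     (\<forall>a. inj_on (i a) (carrier (ob G a)) \<and>
          i a ` carrier (ob G a) = kernel (ob H a) (ob K a) (q a) \<and>
          q a ` carrier (ob H a) = carrier (ob K a))"

definition split_short_exact ::
  "('p::preorder, 'g) pgroup \<Rightarrow> ('p, 'h) pgroup \<Rightarrow> ('p, 'k) pgroup \<Rightarrow>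
    ('p \<Rightarrow> 'g \<Rightarrow> 'h) \<Rightarrow> ('p \<Rightarrow> 'h \<Rightarrow> 'k) \<Rightarrow> bool" where
  "split_short_exact G H K i q \<longleftrightarrow>
     short_exact G H K i q \<and>
     (\<exists>s. pgroup_hom K H s \<and> (\<forall>a. \<forall>x\<in>carrier (ob K a). q a (s a x) = x))"


section \<open>Submodules and quotients\<close>

definition sub_pmod :: "('p, 'r, 'm) pmod \<Rightarrow> ('p \<Rightarrow> 'm set) \<Rightarrow> ('p, 'r, 'm) pmod" where
  "sub_pmod M N = \<lparr>ob = \<lambda>a. (ob M a)\<lparr>carrier := N a\<rparr>, tr = tr M\<rparr>"

text \<open>The map induced on cosets by \<open>f\<close>; its values are cosets of \<open>N\<close> in \<open>H\<close>.\<close>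

definition coset_map :: "('b, 'z) monoid_scheme \<Rightarrow> 'b set \<Rightarrow> ('a \<Rightarrow> 'b) \<Rightarrow> 'a set \<Rightarrow> 'b set" where
  "coset_map H N f X = (\<Union>x\<in>X. N #>\<^bsub>H\<^esub> f x)"

definition quot_module :: "('r, 'm) module \<Rightarrow> 'm set \<Rightarrow> ('r, 'm set) module" where
  "quot_module M N =
     \<lparr>carrier = a_rcosets\<^bsub>M\<^esub> N, mult = undefined, one = undefined,
      zero = N, add = (<+>\<^bsub>M\<^esub>), smult = \<lambda>r X. (\<Union>x\<in>X. N +>\<^bsub>M\<^esub> (r \<odot>\<^bsub>M\<^esub> x))\<rparr>"

definition quot_pmod :: "('p, 'r, 'm) pmod \<Rightarrow> ('p \<Rightarrow> 'm set) \<Rightarrow> ('p, 'r, 'm set) pmod" where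
  "quot_pmod M N =
     \<lparr>ob = \<lambda>a. quot_module (ob M a) (N a),
      tr = \<lambda>a b. coset_map (add_monoid (ob M b)) (N b) (tr M a b)\<rparr>"

definition ker_set ::
  "('p, 'r, 'm) pmod \<Rightarrow> ('p, 'r, 'n) pmod \<Rightarrow> ('p \<Rightarrow> 'm \<Rightarrow> 'n) \<Rightarrow> 'p \<Rightarrow> 'm set" where
  "ker_set M N f a = a_kernel (ob M a) (ob N a) (f a)"

definition im_set :: "('p, 'r, 'm) pmod \<Rightarrow> ('p \<Rightarrow> 'm \<Rightarrow> 'n) \<Rightarrow> 'p \<Rightarrow> 'n set" where
  "im_set M f a = f a ` carrier (ob M a)"


section \<open>Projective persistence modules\<close>

text \<open>
  Quantification over all persistence modules being impossible inside a definition, the test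
  modules \<open>X\<close> and \<open>Y\<close> have their elements in the type \<open>'p \<times> 'm \<Rightarrow> 'r\<close>.  This is no restriction: the
  type holds an isomorphic copy of \<open>M\<close> itself and the free persistence module on all elements of
  \<open>M\<close> (its value at \<open>x\<close> being the finitely supported functions on the pairs \<open>(a, m)\<close> with
  \<open>a \<le> x\<close> and \<open>m\<close> in \<open>M\<^sub>a\<close>).  So \<open>M\<close> is a retract of a free persistence module and lifts against
  epimorphisms of persistence modules over arbitrary types.
\<close>

definition projective :: "'r ring \<Rightarrow> ('p::preorder, 'r, 'm) pmod \<Rightarrow> bool" where
  "projective R M \<longleftrightarrow> persistence_module R M \<and>
     (\<forall>(X :: ('p, 'r, 'p \<times> 'm \<Rightarrow> 'r) pmod) (Y :: ('p, 'r, 'p \<times> 'm \<Rightarrow> 'r) pmod) e f.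
        persistence_module R X \<and> persistence_module R Y \<and>
        e \<in> pmod_hom R X Y \<and> (\<forall>a. e a ` carrier (ob X a) = carrier (ob Y a)) \<and>
        f \<in> pmod_hom R M Y \<longrightarrow>
        (\<exists>g\<in>pmod_hom R M X. \<forall>a. \<forall>m\<in>carrier (ob M a). e a (g a m) = f a m))"


section \<open>The graded ring \<open>R[U\<^sub>0]\<close> and heredity\<close>

text \<open>An element \<open>f\<close> stands for the sum of the \<open>f s \<cdot> x\<^sup>s\<close>.\<close>

definition monoid_ring :: "'r ring \<Rightarrow> ('p::preordered_ab_group_add \<Rightarrow> 'r) ring" where
  "monoid_ring R =
     \<lparr>carrier = {f. (\<forall>s. f s \<in> carrier R) \<and> finite {s. f s \<noteq> \<zero>\<^bsub>R\<^esub>} \<and> (\<forall>s. f s \<noteq> \<zero>\<^bsub>R\<^esub> \<longrightarrow> 0 \<le> s)},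
      mult = \<lambda>f g u. \<Oplus>\<^bsub>R\<^esub>s\<in>{s. f s \<noteq> \<zero>\<^bsub>R\<^esub>}. f s \<otimes>\<^bsub>R\<^esub> g (u - s),
      one = \<lambda>s. if s = 0 then \<one>\<^bsub>R\<^esub> else \<zero>\<^bsub>R\<^esub>,
      zero = \<lambda>s. \<zero>\<^bsub>R\<^esub>,
      add = \<lambda>f g s. f s \<oplus>\<^bsub>R\<^esub> g s\<rparr>"

text \<open>
  The graded left \<open>R[U\<^sub>0]\<close>-module \<open>\<Oplus>\<^sub>a M\<^sub>a\<close> of a persistence module, where \<open>x\<^sup>s\<close> maps \<open>M\<^sub>a\<close> to
  \<open>M\<^sub>a\<^sub>+\<^sub>s\<close> by the transition map.
\<close>

definition graded_module ::
  "'r ring \<Rightarrow> ('p::preordered_ab_group_add, 'r, 'm) pmod \<Rightarrow> ('p \<Rightarrow> 'r, 'p \<Rightarrow> 'm) module" where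
  "graded_module R M =
     \<lparr>carrier = {v. (\<forall>a. v a \<in> carrier (ob M a)) \<and> finite {a. v a \<noteq> \<zero>\<^bsub>ob M a\<^esub>}},
      mult = undefined, one = undefined,
      zero = \<lambda>a. \<zero>\<^bsub>ob M a\<^esub>,
      add = \<lambda>v w a. v a \<oplus>\<^bsub>ob M a\<^esub> w a,
      smult = \<lambda>f v b. \<Oplus>\<^bsub>ob M b\<^esub>s\<in>{s. f s \<noteq> \<zero>\<^bsub>R\<^esub>}. f s \<odot>\<^bsub>ob M b\<^esub> tr M (b - s) b (v (b - s))\<rparr>"

definition graded_submodule ::
  "'r ring \<Rightarrow> ('p::preordered_ab_group_add, 'r, 'm) pmod \<Rightarrow> ('p \<Rightarrow> 'm) set \<Rightarrow> bool" where
  "graded_submodule R M N \<longleftrightarrow>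
     submodule N (monoid_ring R) (graded_module R M) \<and>
     (\<forall>v\<in>N. \<forall>a. (\<lambda>b. if b = a then v a else \<zero>\<^bsub>ob M b\<^esub>) \<in> N)"

text \<open>
  Graded modules are identified with persistence modules throughout, and so are their submodules:
  the graded submodule \<open>N\<close> has the components \<open>N\<^sub>a = {v a | v \<in> N}\<close>.  The type argument is the type
  of the elements of the projective modules considered; heredity in the usual sense implies this
  predicate for every such type.
\<close>

definition left_hereditary :: "('p::preordered_ab_group_add \<times> 'm) itself \<Rightarrow> 'r ring \<Rightarrow> bool" where
  "left_hereditary T R \<longleftrightarrow>
     (\<forall>(M :: ('p, 'r, 'm) pmod) N. projective R M \<and> graded_submodule R M N \<longrightarrow>
        projective R (sub_pmod M (\<lambda>a. (\<lambda>v. v a) ` N)))"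


section \<open>The two internal homs\<close>

datatype hom_kind = Sh | Gr

definition shift :: "'p::plus \<Rightarrow> ('p, 'r, 'm) pmod \<Rightarrow> ('p, 'r, 'm) pmod" where
  "shift s N = \<lparr>ob = \<lambda>x. ob N (s + x), tr = \<lambda>x y. tr N (s + x) (s + y)\<rparr>"

definition hom_group ::
  "'r ring \<Rightarrow> 'p set \<Rightarrow> ('p::preorder, 'r, 'm) pmod \<Rightarrow> ('p, 'r, 'n) pmod \<Rightarrow> ('p \<Rightarrow> 'm \<Rightarrow> 'n) monoid" where
  "hom_group R U M N =
     \<lparr>carrier = nat_trans R U M N,
      mult = \<lambda>f g. \<lambda>x\<in>U. \<lambda>m\<in>carrier (ob M x). f x m \<oplus>\<^bsub>ob N x\<^esub> g x m,
      one = \<lambda>x\<in>U. \<lambda>m\<in>carrier (ob M x). \<zero>\<^bsub>ob N x\<^esub>\<rparr>"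

text \<open>
  Sheaf hom: \<open>Hom(M|U\<^sub>a, N|U\<^sub>a)\<close> with restriction maps.  Graded hom: \<open>Hom(M, N(s))\<close> with
  postcomposition by the transition maps of \<open>N\<close>.
\<close>

fun hom_dom :: "hom_kind \<Rightarrow> 'p::preorder \<Rightarrow> 'p set" where
  "hom_dom Sh a = {x. a \<le> x}"
| "hom_dom Gr s = UNIV"

fun Hom ::
  "hom_kind \<Rightarrow> 'r ring \<Rightarrow> ('p::preordered_ab_group_add, 'r, 'm) pmod \<Rightarrow> ('p, 'r, 'n) pmod \<Rightarrow>
    ('p, 'p \<Rightarrow> 'm \<Rightarrow> 'n) pgroup" where
  "Hom Sh R M N =
     \<lparr>ob = \<lambda>a. hom_group R (hom_dom Sh a) M N,
      tr = \<lambda>a b f. restrict f (hom_dom Sh b)\<rparr>"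
| "Hom Gr R M N =
     \<lparr>ob = \<lambda>s. hom_group R (hom_dom Gr s) M (shift s N),
      tr = \<lambda>s t f. \<lambda>x\<in>hom_dom Gr t. \<lambda>m\<in>carrier (ob M x). tr N (s + x) (t + x) (f x m)\<rparr>"

text \<open>
  The map \<open>Hom(M, N) \<rightarrow> Hom(M', N')\<close> induced by \<open>\<phi> : M' \<rightarrow> M\<close> and \<open>\<alpha> : N \<rightarrow> N'\<close>.
\<close>

definition Hom_map ::
  "hom_kind \<Rightarrow> ('p::preordered_ab_group_add, 'r, 'm2) pmod \<Rightarrow> ('p \<Rightarrow> 'm2 \<Rightarrow> 'm) \<Rightarrow> ('p \<Rightarrow> 'n \<Rightarrow> 'n2) \<Rightarrow>
    'p \<Rightarrow> ('p \<Rightarrow> 'm \<Rightarrow> 'n) \<Rightarrow> 'p \<Rightarrow> 'm2 \<Rightarrow> 'n2" where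
  "Hom_map h M' \<phi> \<alpha> s f =
     (\<lambda>x\<in>hom_dom h s. \<lambda>m\<in>carrier (ob M' x).
        (case h of Sh \<Rightarrow> \<alpha> x | Gr \<Rightarrow> \<alpha> (s + x)) (f x (\<phi> x m)))"


section \<open>Complexes, homology, cohomology\<close>

text \<open>The differential \<open>diff K n\<close> goes from \<open>trm K n\<close> to \<open>trm K (n - 1)\<close>.\<close>

record ('p, 'r, 'm) pcomplex =
  trm :: "int \<Rightarrow> ('p, 'r, 'm) pmod"
  diff :: "int \<Rightarrow> 'p \<Rightarrow> 'm \<Rightarrow> 'm"

definition is_complex :: "'r ring \<Rightarrow> ('p::preorder, 'r, 'm) pcomplex \<Rightarrow> bool" where
  "is_complex R K \<longleftrightarrow>
     (\<forall>n. persistence_module R (trm K n)) \<and>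
     (\<forall>n. diff K n \<in> pmod_hom R (trm K n) (trm K (n - 1))) \<and>
     (\<forall>n a. \<forall>m\<in>carrier (ob (trm K n) a).
        diff K (n - 1) a (diff K n a m) = \<zero>\<^bsub>ob (trm K (n - 2)) a\<^esub>)"

definition chain_map ::
  "'r ring \<Rightarrow> ('p::preorder, 'r, 'm) pcomplex \<Rightarrow> ('p, 'r, 'n) pcomplex \<Rightarrow> (int \<Rightarrow> 'p \<Rightarrow> 'm \<Rightarrow> 'n) \<Rightarrow> bool" where
  "chain_map R K L \<phi> \<longleftrightarrow>
     (\<forall>n. \<phi> n \<in> pmod_hom R (trm K n) (trm L n)) \<and>
     (\<forall>n a. \<forall>m\<in>carrier (ob (trm K n) a). \<phi> (n - 1) a (diff K n a m) = diff L n a (\<phi> n a m))"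

definition cycles :: "('p, 'r, 'm) pcomplex \<Rightarrow> int \<Rightarrow> ('p, 'r, 'm) pmod" where
  "cycles K n = sub_pmod (trm K n) (ker_set (trm K n) (trm K (n - 1)) (diff K n))"

definition boundaries :: "('p, 'r, 'm) pcomplex \<Rightarrow> int \<Rightarrow> ('p, 'r, 'm) pmod" where
  "boundaries K n = sub_pmod (trm K n) (im_set (trm K (n + 1)) (diff K (n + 1)))"

definition homology :: "('p, 'r, 'm) pcomplex \<Rightarrow> int \<Rightarrow> ('p, 'r, 'm set) pmod" where
  "homology K n = quot_pmod (cycles K n) (im_set (trm K (n + 1)) (diff K (n + 1)))"

definition homology_map ::
  "('p, 'r, 'm) pcomplex \<Rightarrow> ('p, 'r, 'n) pcomplex \<Rightarrow> (int \<Rightarrow> 'p \<Rightarrow> 'm \<Rightarrow> 'n) \<Rightarrow>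
    int \<Rightarrow> 'p \<Rightarrow> 'm set \<Rightarrow> 'n set" where
  "homology_map K L \<phi> n a =
     (\<lambda>X\<in>carrier (ob (homology K n) a).
        coset_map (add_monoid (ob (cycles L n) a)) (im_set (trm L (n + 1)) (diff L (n + 1)) a) (\<phi> n a) X)"

text \<open>
  Cohomology at \<open>C n\<close> of a sequence of persistence groups \<open>C n\<close> with maps \<open>\<delta> n : C n \<rightarrow> C (n + 1)\<close>.
\<close>

definition cobound :: "(int \<Rightarrow> ('p, 'g) pgroup) \<Rightarrow> (int \<Rightarrow> 'p \<Rightarrow> 'g \<Rightarrow> 'g) \<Rightarrow> int \<Rightarrow> 'p \<Rightarrow> 'g set" where
  "cobound C \<delta> n a = \<delta> (n - 1) a ` carrier (ob (C (n - 1)) a)"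

definition cohomology ::
  "(int \<Rightarrow> ('p, 'g) pgroup) \<Rightarrow> (int \<Rightarrow> 'p \<Rightarrow> 'g \<Rightarrow> 'g) \<Rightarrow> int \<Rightarrow> ('p, 'g set) pgroup" where
  "cohomology C \<delta> n =
     \<lparr>ob = \<lambda>a. (ob (C n) a)\<lparr>carrier := kernel (ob (C n) a) (ob (C (n + 1)) a) (\<delta> n a)\<rparr>
                 Mod cobound C \<delta> n a,
      tr = \<lambda>a b. coset_map (ob (C n) b) (cobound C \<delta> n b) (tr (C n) a b)\<rparr>"

text \<open>
  The cochain complex of homs from \<open>K\<close> to \<open>A\<close>.  No sign is put on the differential, as a sign does
  not change kernels and images.
\<close>

definition Hom_cochains ::
  "hom_kind \<Rightarrow> 'r ring \<Rightarrow> ('p::preordered_ab_group_add, 'r, 'm) pcomplex \<Rightarrow> ('p, 'r, 'n) pmod \<Rightarrow>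
    int \<Rightarrow> ('p, 'p \<Rightarrow> 'm \<Rightarrow> 'n) pgroup" where
  "Hom_cochains h R K A n = Hom h R (trm K n) A"

definition Hom_diff ::
  "hom_kind \<Rightarrow> ('p::preordered_ab_group_add, 'r, 'm) pcomplex \<Rightarrow>
    int \<Rightarrow> 'p \<Rightarrow> ('p \<Rightarrow> 'm \<Rightarrow> 'n) \<Rightarrow> 'p \<Rightarrow> 'm \<Rightarrow> 'n" where
  "Hom_diff h K n = Hom_map h (trm K (n + 1)) (diff K (n + 1)) (\<lambda>x u. u)"

definition Hom_cohomology ::
  "hom_kind \<Rightarrow> 'r ring \<Rightarrow> ('p::preordered_ab_group_add, 'r, 'm) pcomplex \<Rightarrow> ('p, 'r, 'n) pmod \<Rightarrow>
    int \<Rightarrow> ('p, ('p \<Rightarrow> 'm \<Rightarrow> 'n) set) pgroup" where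
  "Hom_cohomology h R K A n = cohomology (Hom_cochains h R K A) (Hom_diff h K) n"

text \<open>
  The map \<open>H\<^sup>n(Hom(L, A)) \<rightarrow> H\<^sup>n(Hom(K, A'))\<close> induced by a chain map \<open>\<phi> : K \<rightarrow> L\<close> and \<open>\<alpha> : A \<rightarrow> A'\<close>.
\<close>

definition Hom_cohomology_map ::
  "hom_kind \<Rightarrow> 'r ring \<Rightarrow> ('p::preordered_ab_group_add, 'r, 'k) pcomplex \<Rightarrow> ('p, 'r, 'n2) pmod \<Rightarrow>
    (int \<Rightarrow> 'p \<Rightarrow> 'k \<Rightarrow> 'l) \<Rightarrow> ('p \<Rightarrow> 'n \<Rightarrow> 'n2) \<Rightarrow> int \<Rightarrow>
    'p \<Rightarrow> ('p \<Rightarrow> 'l \<Rightarrow> 'n) set \<Rightarrow> ('p \<Rightarrow> 'k \<Rightarrow> 'n2) set" where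
  "Hom_cohomology_map h R K A' \<phi> \<alpha> n a =
     coset_map (ob (Hom_cochains h R K A' n) a) (cobound (Hom_cochains h R K A') (Hom_diff h K) n a)
       (Hom_map h (trm K n) (\<phi> n) \<alpha> a)"


section \<open>Ext\<close>

definition projective_resolution ::
  "'r ring \<Rightarrow> ('p::preorder, 'r, 'f) pcomplex \<Rightarrow> ('p \<Rightarrow> 'f \<Rightarrow> 'm) \<Rightarrow> ('p, 'r, 'm) pmod \<Rightarrow> bool" where
  "projective_resolution R F \<epsilon> M \<longleftrightarrow>
     is_complex R F \<and> (\<forall>i. projective R (trm F i)) \<and>
     (\<forall>i<0. \<forall>a. carrier (ob (trm F i) a) = {\<zero>\<^bsub>ob (trm F i) a\<^esub>}) \<and>
     (\<forall>i\<ge>1. ker_set (trm F i) (trm F (i - 1)) (diff F i) = im_set (trm F (i + 1)) (diff F (i + 1))) \<and>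
     \<epsilon> \<in> pmod_hom R (trm F 0) M \<and>
     (\<forall>a. \<epsilon> a ` carrier (ob (trm F 0) a) = carrier (ob M a)) \<and>
     ker_set (trm F 0) M \<epsilon> = im_set (trm F 1) (diff F 1)"

text \<open>
  \<open>Ext h R i F A\<close> is the \<open>i\<close>-th right derived functor of the chosen internal hom at \<open>(M, A)\<close>, computed
  from the projective resolution \<open>F\<close> of \<open>M\<close>.  No resolution is singled out: statements about Ext are
  to be made for every projective resolution.  On a morphism \<open>f : M \<rightarrow> M'\<close>, Ext is given by \<open>Ext_map\<close>
  for any lift \<open>\<Phi>\<close> of \<open>f\<close> to the resolutions (\<open>resolution_lift\<close> below).
\<close>

definition Ext ::
  "hom_kind \<Rightarrow> 'r ring \<Rightarrow> int \<Rightarrow> ('p::preordered_ab_group_add, 'r, 'f) pcomplex \<Rightarrow> ('p, 'r, 'n) pmod \<Rightarrow>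
    ('p, ('p \<Rightarrow> 'f \<Rightarrow> 'n) set) pgroup" where
  "Ext h R i F A = Hom_cohomology h R F A i"

definition Ext_map ::
  "hom_kind \<Rightarrow> 'r ring \<Rightarrow> int \<Rightarrow> ('p::preordered_ab_group_add, 'r, 'f) pcomplex \<Rightarrow> ('p, 'r, 'n2) pmod \<Rightarrow>
    (int \<Rightarrow> 'p \<Rightarrow> 'f \<Rightarrow> 'g) \<Rightarrow> ('p \<Rightarrow> 'n \<Rightarrow> 'n2) \<Rightarrow>
    'p \<Rightarrow> ('p \<Rightarrow> 'g \<Rightarrow> 'n) set \<Rightarrow> ('p \<Rightarrow> 'f \<Rightarrow> 'n2) set" where
  "Ext_map h R i F A' \<Phi> \<alpha> = Hom_cohomology_map h R F A' \<Phi> \<alpha> i"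

definition resolution_lift ::
  "'r ring \<Rightarrow> ('p::preorder, 'r, 'f) pcomplex \<Rightarrow> ('p \<Rightarrow> 'f \<Rightarrow> 'm) \<Rightarrow> ('p, 'r, 'g) pcomplex \<Rightarrow>
    ('p \<Rightarrow> 'g \<Rightarrow> 'n) \<Rightarrow> ('p \<Rightarrow> 'm \<Rightarrow> 'n) \<Rightarrow> (int \<Rightarrow> 'p \<Rightarrow> 'f \<Rightarrow> 'g) \<Rightarrow> bool" where
  "resolution_lift R F \<epsilon> F' \<epsilon>' f \<Phi> \<longleftrightarrow>
     chain_map R F F' \<Phi> \<and>
     (\<forall>a. \<forall>m\<in>carrier (ob (trm F 0) a). \<epsilon>' a (\<Phi> 0 a m) = f a (\<epsilon> a m))"


section \<open>The hypotheses on \<open>K\<close>\<close>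

definition admissible_complex :: "'r ring \<Rightarrow> ('p::preorder, 'r, 'm) pcomplex \<Rightarrow> bool" where
  "admissible_complex R K \<longleftrightarrow>
     is_complex R K \<and> (\<forall>n. projective R (trm K n)) \<and> (\<forall>n. projective R (boundaries K n))"

end

theory Submission
  imports Defs
begin

text \<open>
  Since the boundaries are projective, \<open>d : K\<^sub>n \<rightarrow> B\<^sub>n\<^sub>-\<^sub>1\<close> has a section \<open>j\<close>, and \<open>r = 1 - j \<circ> d\<close> is a
  retraction of \<open>K\<^sub>n\<close> onto the cycles \<open>Z\<^sub>n\<close>.  A cocycle \<open>c : K\<^sub>n \<rightarrow> A\<close> kills the boundaries, and \<open>\<pi>\<close> sends
  it to the map it induces on \<open>H\<^sub>n\<close>; a section of \<open>\<pi>\<close> is \<open>g \<mapsto> g \<circ> [r]\<close>, where \<open>[r] : K\<^sub>n \<rightarrow> H\<^sub>n\<close>; it is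
  natural in the degree because \<open>r\<close> is defined on all of \<open>P\<close>.

  Lifting \<open>[r] : K\<^sub>n\<^sub>-\<^sub>1 \<rightarrow> H\<^sub>n\<^sub>-\<^sub>1\<close> to \<open>\<Theta> : K\<^sub>n\<^sub>-\<^sub>1 \<rightarrow> F\<^sub>0\<close> and then \<open>\<Theta> \<circ> d\<close> to \<open>\<Psi> : K\<^sub>n \<rightarrow> F\<^sub>1\<close> defines
  \<open>\<iota> [f] = [f \<circ> \<Psi>]\<close>.  As in the comparison theorem for resolutions, a lift \<open>\<Gamma> : F\<^sub>0 \<rightarrow> Z\<^sub>n\<^sub>-\<^sub>1\<close> and a
  homotopy \<open>\<eta>\<close> from \<open>\<Theta> \<circ> \<Gamma>\<close> to the identity show that \<open>\<iota>\<close> is injective with image the classes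
  that vanish on cycles, and a homotopy between two choices of \<open>\<Psi>\<close> gives naturality.  All lifts are
  maps on all of \<open>P\<close>, hence compatible with restriction to up-sets and with shifts of \<open>A\<close>: this is
  why both internal homs can be treated alike.
\<close>

section \<open>Persistence modules and natural maps\<close>

text \<open>Everything about \<open>F\<close> takes place in cochain degree 1. An equation between
  maps into F_1 is only ever checked after applying d_1; the error then lies in the kernel of d_1,
  which is the image of d_2, and every 1-cocycle annihilates it. Hence each homotopy is needed only
  in its lowest component, F_0 -> F_1 or K_{n-1} -> F_1, and no map into F_2 is constructed.

  A coboundary in Hom(K, A) has the form k o d with k on all of K_{n-1}, while homology classes
  exist only on cycles. So maps built from classes are first extended from cycles to K_{n-1} by
  inserting r.

  The choices of j and r are not respected by chain maps. Therefore \<pi> is defined through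
  representatives and only its section uses r, whereas \<iota> depends on a chosen \<Psi> and its
  naturality is a genuine homotopy statement.

  Projectivity is given as lifting against modules with one fixed type of elements, but the lifts go
  into terms of \<open>F\<close>, of \<open>K\<close> and into cycles, over other types. The bridge
  is that a projective module is a retract of a free one, out of which maps are prescribed by values
  on generators.\<close>

context left_module begin

lemma smult_l_null: "x \<in> carrier M \<Longrightarrow> \<zero>\<^bsub>R\<^esub> \<odot>\<^bsub>M\<^esub> x = \<zero>\<^bsub>M\<^esub>"
  by (metis M.add.l_cancel_one R.add.l_one R.zero_closed smult_closed smult_l_distr)

lemma smult_r_null: "a \<in> carrier R \<Longrightarrow> a \<odot>\<^bsub>M\<^esub> \<zero>\<^bsub>M\<^esub> = \<zero>\<^bsub>M\<^esub>"
  by (metis M.add.l_cancel_one M.l_zero M.zero_closed smult_closed smult_r_distr)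

lemma smult_r_minus:
  assumes "a \<in> carrier R" "x \<in> carrier M"
  shows "a \<odot>\<^bsub>M\<^esub> (\<ominus>\<^bsub>M\<^esub> x) = \<ominus>\<^bsub>M\<^esub> (a \<odot>\<^bsub>M\<^esub> x)"
proof -
  have "a \<odot>\<^bsub>M\<^esub> (\<ominus>\<^bsub>M\<^esub> x) \<oplus>\<^bsub>M\<^esub> a \<odot>\<^bsub>M\<^esub> x = \<zero>\<^bsub>M\<^esub>"
    using assms by (metis M.add.inv_closed M.l_neg smult_r_distr smult_r_null)
  then show ?thesis
    using assms by (simp add: M.minus_equality smult_closed)
qed

end

lemma left_module_is_abelian_group: "left_module R M \<Longrightarrow> abelian_group M"
  by (simp add: left_module_def)

lemma pm_left_module: "persistence_module R M \<Longrightarrow> left_module R (ob M a)"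
  by (simp add: persistence_module_def)

lemma pm_abelian_group: "persistence_module R M \<Longrightarrow> abelian_group (ob M a)"
  by (meson left_module_is_abelian_group pm_left_module)

lemma pm_smult_closed:
  "persistence_module R M \<Longrightarrow> r \<in> carrier R \<Longrightarrow> m \<in> carrier (ob M a) \<Longrightarrow> r \<odot>\<^bsub>ob M a\<^esub> m \<in> carrier (ob M a)"
  by (meson left_module.smult_closed pm_left_module)

text \<open>Closure of \<open>carrier M\<close> under sums and scalar multiples is what allows
  \<open>restrict\<close> to be dropped on the left of each equation; this is where the module
  hypothesis enters.\<close>

lemma linear_maps_restrict_iff:
  assumes "left_module R M"
  shows "restrict f (carrier M) \<in> linear_maps R M N \<longleftrightarrow>
    (\<forall>x\<in>carrier M. f x \<in> carrier N) \<and>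
    (\<forall>x\<in>carrier M. \<forall>y\<in>carrier M. f (x \<oplus>\<^bsub>M\<^esub> y) = f x \<oplus>\<^bsub>N\<^esub> f y) \<and>
    (\<forall>r\<in>carrier R. \<forall>x\<in>carrier M. f (r \<odot>\<^bsub>M\<^esub> x) = r \<odot>\<^bsub>N\<^esub> f x)"
proof -
  interpret left_module R M by fact
  show ?thesis
    by (auto simp: linear_maps_def smult_closed)
qed

text \<open>The working form of the definition: pointwise laws without \<open>restrict\<close>,
  suited to the simplifier both for building and for using persistence modules.\<close>

lemma persistence_module_iff:
  "persistence_module R M \<longleftrightarrow>
     (\<forall>a. left_module R (ob M a)) \<and>
     (\<forall>a b. a \<le> b \<longrightarrow>
        (\<forall>x\<in>carrier (ob M a). tr M a b x \<in> carrier (ob M b)) \<and>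
        (\<forall>x\<in>carrier (ob M a). \<forall>y\<in>carrier (ob M a).
           tr M a b (x \<oplus>\<^bsub>ob M a\<^esub> y) = tr M a b x \<oplus>\<^bsub>ob M b\<^esub> tr M a b y) \<and>
        (\<forall>r\<in>carrier R. \<forall>x\<in>carrier (ob M a).
           tr M a b (r \<odot>\<^bsub>ob M a\<^esub> x) = r \<odot>\<^bsub>ob M b\<^esub> tr M a b x)) \<and>
     (\<forall>a. \<forall>m\<in>carrier (ob M a). tr M a a m = m) \<and>
     (\<forall>a b c. a \<le> b \<longrightarrow> b \<le> c \<longrightarrow>
        (\<forall>m\<in>carrier (ob M a). tr M b c (tr M a b m) = tr M a c m))"
proof (cases "\<forall>a. left_module R (ob M a)")
  case True
  then show ?thesis
    unfolding persistence_module_def by (simp add: linear_maps_restrict_iff)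
next
  case False
  then show ?thesis
    unfolding persistence_module_def by blast
qed

lemma pm_tr_closed:
  "persistence_module R M \<Longrightarrow> a \<le> b \<Longrightarrow> m \<in> carrier (ob M a) \<Longrightarrow> tr M a b m \<in> carrier (ob M b)"
  by (simp add: persistence_module_iff)

lemma pm_tr_add:
  "persistence_module R M \<Longrightarrow> a \<le> b \<Longrightarrow> m \<in> carrier (ob M a) \<Longrightarrow> m' \<in> carrier (ob M a) \<Longrightarrow>
    tr M a b (m \<oplus>\<^bsub>ob M a\<^esub> m') = tr M a b m \<oplus>\<^bsub>ob M b\<^esub> tr M a b m'"
  by (simp add: persistence_module_iff)

lemma pm_tr_smult:
  "persistence_module R M \<Longrightarrow> a \<le> b \<Longrightarrow> r \<in> carrier R \<Longrightarrow> m \<in> carrier (ob M a) \<Longrightarrow>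
    tr M a b (r \<odot>\<^bsub>ob M a\<^esub> m) = r \<odot>\<^bsub>ob M b\<^esub> tr M a b m"
  by (simp add: persistence_module_iff)

lemma pm_tr_id: "persistence_module R M \<Longrightarrow> m \<in> carrier (ob M a) \<Longrightarrow> tr M a a m = m"
  by (simp add: persistence_module_iff)

lemma pm_tr_tr:
  "persistence_module R M \<Longrightarrow> a \<le> b \<Longrightarrow> b \<le> c \<Longrightarrow> m \<in> carrier (ob M a) \<Longrightarrow>
    tr M b c (tr M a b m) = tr M a c m"
  by (simp add: persistence_module_iff)

text \<open>Natural transformations without the extensionality convention: these compose and add pointwise.\<close>

definition natural_on ::
  "'r ring \<Rightarrow> 'p set \<Rightarrow> ('p::preorder, 'r, 'm) pmod \<Rightarrow> ('p, 'r, 'n) pmod \<Rightarrow> ('p \<Rightarrow> 'm \<Rightarrow> 'n) \<Rightarrow> bool" where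
  "natural_on R U M N f \<longleftrightarrow>
     (\<forall>x\<in>U. \<forall>m\<in>carrier (ob M x). f x m \<in> carrier (ob N x)) \<and>
     (\<forall>x\<in>U. \<forall>m\<in>carrier (ob M x). \<forall>m'\<in>carrier (ob M x).
        f x (m \<oplus>\<^bsub>ob M x\<^esub> m') = f x m \<oplus>\<^bsub>ob N x\<^esub> f x m') \<and>
     (\<forall>x\<in>U. \<forall>r\<in>carrier R. \<forall>m\<in>carrier (ob M x). f x (r \<odot>\<^bsub>ob M x\<^esub> m) = r \<odot>\<^bsub>ob N x\<^esub> f x m) \<and>
     (\<forall>x\<in>U. \<forall>y\<in>U. x \<le> y \<longrightarrow> (\<forall>m\<in>carrier (ob M x). f y (tr M x y m) = tr N x y (f x m)))"

text \<open>The way back from \<open>natural_on\<close> to \<open>nat_trans\<close>: composites and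
  sums are formed pointwise and made extensional only at the end. Members of
  \<open>nat_trans\<close> are fixed points of this operation.\<close>

definition extend :: "'p set \<Rightarrow> ('p, 'r, 'm) pmod \<Rightarrow> ('p \<Rightarrow> 'm \<Rightarrow> 'n) \<Rightarrow> 'p \<Rightarrow> 'm \<Rightarrow> 'n" where
  "extend U M f = (\<lambda>x\<in>U. \<lambda>m\<in>carrier (ob M x). f x m)"

lemma extend_apply [simp]: "x \<in> U \<Longrightarrow> m \<in> carrier (ob M x) \<Longrightarrow> extend U M f x m = f x m"
  by (simp add: extend_def)

lemma natural_onI [intro?]:
  assumes "\<And>x m. x \<in> U \<Longrightarrow> m \<in> carrier (ob M x) \<Longrightarrow> f x m \<in> carrier (ob N x)"
    and "\<And>x m m'. x \<in> U \<Longrightarrow> m \<in> carrier (ob M x) \<Longrightarrow> m' \<in> carrier (ob M x) \<Longrightarrow>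
      f x (m \<oplus>\<^bsub>ob M x\<^esub> m') = f x m \<oplus>\<^bsub>ob N x\<^esub> f x m'"
    and "\<And>x r m. x \<in> U \<Longrightarrow> r \<in> carrier R \<Longrightarrow> m \<in> carrier (ob M x) \<Longrightarrow>
      f x (r \<odot>\<^bsub>ob M x\<^esub> m) = r \<odot>\<^bsub>ob N x\<^esub> f x m"
    and "\<And>x y m. x \<in> U \<Longrightarrow> y \<in> U \<Longrightarrow> x \<le> y \<Longrightarrow> m \<in> carrier (ob M x) \<Longrightarrow>
      f y (tr M x y m) = tr N x y (f x m)"
  shows "natural_on R U M N f"
  using assms unfolding natural_on_def by blast

lemma natural_on_closed:
  "natural_on R U M N f \<Longrightarrow> x \<in> U \<Longrightarrow> m \<in> carrier (ob M x) \<Longrightarrow> f x m \<in> carrier (ob N x)"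
  by (simp add: natural_on_def)

lemma natural_on_add:
  "natural_on R U M N f \<Longrightarrow> x \<in> U \<Longrightarrow> m \<in> carrier (ob M x) \<Longrightarrow> m' \<in> carrier (ob M x) \<Longrightarrow>
    f x (m \<oplus>\<^bsub>ob M x\<^esub> m') = f x m \<oplus>\<^bsub>ob N x\<^esub> f x m'"
  by (simp add: natural_on_def)

lemma natural_on_smult:
  "natural_on R U M N f \<Longrightarrow> x \<in> U \<Longrightarrow> r \<in> carrier R \<Longrightarrow> m \<in> carrier (ob M x) \<Longrightarrow>
    f x (r \<odot>\<^bsub>ob M x\<^esub> m) = r \<odot>\<^bsub>ob N x\<^esub> f x m"
  by (simp add: natural_on_def)

lemma natural_on_tr:
  "natural_on R U M N f \<Longrightarrow> x \<in> U \<Longrightarrow> y \<in> U \<Longrightarrow> x \<le> y \<Longrightarrow> m \<in> carrier (ob M x) \<Longrightarrow>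
    f y (tr M x y m) = tr N x y (f x m)"
  by (simp add: natural_on_def)

lemma natural_on_hom:
  assumes "persistence_module R M" "persistence_module R N" "natural_on R U M N f" "x \<in> U"
  shows "abelian_group_hom (ob M x) (ob N x) (f x)"
proof -
  interpret A: abelian_group "ob M x" using assms(1) by (rule pm_abelian_group)
  interpret B: abelian_group "ob N x" using assms(2) by (rule pm_abelian_group)
  show ?thesis
    using assms by unfold_locales (auto simp: hom_def natural_on_closed natural_on_add)
qed

lemma natural_on_zero:
  assumes "persistence_module R M" "persistence_module R N" "natural_on R U M N f" "x \<in> U"
  shows "f x \<zero>\<^bsub>ob M x\<^esub> = \<zero>\<^bsub>ob N x\<^esub>"
  using natural_on_hom[OF assms] by (rule abelian_group_hom.hom_zero)

lemma natural_on_uminus: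
  assumes "persistence_module R M" "persistence_module R N" "natural_on R U M N f" "x \<in> U"
    "m \<in> carrier (ob M x)"
  shows "f x (\<ominus>\<^bsub>ob M x\<^esub> m) = \<ominus>\<^bsub>ob N x\<^esub> f x m"
  using abelian_group_hom.hom_a_inv[OF natural_on_hom[OF assms(1-4)] assms(5)] .

lemma natural_on_minus:
  assumes "persistence_module R M" "persistence_module R N" "natural_on R U M N f" "x \<in> U"
    "m \<in> carrier (ob M x)" "m' \<in> carrier (ob M x)"
  shows "f x (m \<ominus>\<^bsub>ob M x\<^esub> m') = f x m \<ominus>\<^bsub>ob N x\<^esub> f x m'"
proof -
  interpret M: abelian_group "ob M x" using assms(1) by (rule pm_abelian_group)
  show ?thesis
    using assms by (simp add: a_minus_def natural_on_add natural_on_uminus)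
qed

lemma natural_on_comp:
  "natural_on R U M N f \<Longrightarrow> natural_on R U N L g \<Longrightarrow> natural_on R U M L (\<lambda>x m. g x (f x m))"
  by (rule natural_onI)
    (simp_all add: natural_on_closed[of R U M N f] natural_on_closed[of R U N L g]
      natural_on_add[of R U M N f] natural_on_add[of R U N L g]
      natural_on_smult[of R U M N f] natural_on_smult[of R U N L g]
      natural_on_tr[of R U M N f] natural_on_tr[of R U N L g])

lemma natural_on_mono: "natural_on R U M N f \<Longrightarrow> V \<subseteq> U \<Longrightarrow> natural_on R V M N f"
  by (rule natural_onI)
    (auto simp: subset_iff natural_on_closed natural_on_add natural_on_smult natural_on_tr)

lemma natural_on_ident: "natural_on R U M M (\<lambda>x m. m)"
  unfolding natural_on_def by simp

lemma natural_on_plus: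
  assumes M: "persistence_module R M" and N: "persistence_module R N"
    and f: "natural_on R U M N f" and g: "natural_on R U M N g"
  shows "natural_on R U M N (\<lambda>x m. f x m \<oplus>\<^bsub>ob N x\<^esub> g x m)"
proof
  fix x m assume x: "x \<in> U" and m: "m \<in> carrier (ob M x)"
  interpret N: left_module R "ob N x" using N by (rule pm_left_module)
  note cl = natural_on_closed[OF f x] natural_on_closed[OF g x]
  show "f x m \<oplus>\<^bsub>ob N x\<^esub> g x m \<in> carrier (ob N x)" using cl m by simp
  show "f x (m \<oplus>\<^bsub>ob M x\<^esub> m') \<oplus>\<^bsub>ob N x\<^esub> g x (m \<oplus>\<^bsub>ob M x\<^esub> m') =
      f x m \<oplus>\<^bsub>ob N x\<^esub> g x m \<oplus>\<^bsub>ob N x\<^esub> (f x m' \<oplus>\<^bsub>ob N x\<^esub> g x m')"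
    if "m' \<in> carrier (ob M x)" for m'
    using cl m that x f g by (simp add: natural_on_add N.a_ac)
  show "f x (r \<odot>\<^bsub>ob M x\<^esub> m) \<oplus>\<^bsub>ob N x\<^esub> g x (r \<odot>\<^bsub>ob M x\<^esub> m) = r \<odot>\<^bsub>ob N x\<^esub> (f x m \<oplus>\<^bsub>ob N x\<^esub> g x m)"
    if "r \<in> carrier R" for r
    using cl m that x f g by (simp add: natural_on_smult N.smult_r_distr)
  show "f y (tr M x y m) \<oplus>\<^bsub>ob N y\<^esub> g y (tr M x y m) = tr N x y (f x m \<oplus>\<^bsub>ob N x\<^esub> g x m)"
    if "y \<in> U" "x \<le> y" for y
    using cl m that x f g N by (simp add: natural_on_tr pm_tr_add)
qed

lemma pm_tr_hom:
  assumes "persistence_module R M" "a \<le> b"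
  shows "abelian_group_hom (ob M a) (ob M b) (tr M a b)"
proof -
  interpret A: abelian_group "ob M a" using assms(1) by (rule pm_abelian_group)
  interpret B: abelian_group "ob M b" using assms(1) by (rule pm_abelian_group)
  show ?thesis
    using assms by unfold_locales (auto simp: hom_def pm_tr_closed pm_tr_add)
qed

lemma natural_on_neg:
  assumes M: "persistence_module R M" and N: "persistence_module R N"
    and f: "natural_on R U M N f"
  shows "natural_on R U M N (\<lambda>x m. \<ominus>\<^bsub>ob N x\<^esub> f x m)"
proof
  fix x m assume x: "x \<in> U" and m: "m \<in> carrier (ob M x)"
  interpret N: left_module R "ob N x" using N by (rule pm_left_module)
  note cl = natural_on_closed[OF f x]
  show "\<ominus>\<^bsub>ob N x\<^esub> f x m \<in> carrier (ob N x)" using cl m by simp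
  show "\<ominus>\<^bsub>ob N x\<^esub> f x (m \<oplus>\<^bsub>ob M x\<^esub> m') = \<ominus>\<^bsub>ob N x\<^esub> f x m \<oplus>\<^bsub>ob N x\<^esub> \<ominus>\<^bsub>ob N x\<^esub> f x m'"
    if "m' \<in> carrier (ob M x)" for m'
    using cl m that x f by (simp add: natural_on_add N.minus_add)
  show "\<ominus>\<^bsub>ob N x\<^esub> f x (r \<odot>\<^bsub>ob M x\<^esub> m) = r \<odot>\<^bsub>ob N x\<^esub> (\<ominus>\<^bsub>ob N x\<^esub> f x m)"
    if "r \<in> carrier R" for r
    using cl m that x f by (simp add: natural_on_smult N.smult_r_minus)
  show "\<ominus>\<^bsub>ob N y\<^esub> f y (tr M x y m) = tr N x y (\<ominus>\<^bsub>ob N x\<^esub> f x m)"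
    if "y \<in> U" "x \<le> y" for y
    using cl[OF m] m that x f abelian_group_hom.hom_a_inv[OF pm_tr_hom[OF N]] 
    by (simp add: natural_on_tr)
qed

lemma natural_on_diff:
  assumes "persistence_module R M" "persistence_module R N"
    "natural_on R U M N f" "natural_on R U M N g"
  shows "natural_on R U M N (\<lambda>x m. f x m \<ominus>\<^bsub>ob N x\<^esub> g x m)"
  unfolding a_minus_def using assms by (intro natural_on_plus natural_on_neg)

lemma natural_on_null:
  assumes N: "persistence_module R N"
  shows "natural_on R U M N (\<lambda>x m. \<zero>\<^bsub>ob N x\<^esub>)"
proof
  fix x m 
  interpret N: left_module R "ob N x" using N by (rule pm_left_module)
  show "\<zero>\<^bsub>ob N x\<^esub> \<in> carrier (ob N x)" "\<zero>\<^bsub>ob N x\<^esub> = \<zero>\<^bsub>ob N x\<^esub> \<oplus>\<^bsub>ob N x\<^esub> \<zero>\<^bsub>ob N x\<^esub>"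
    by auto
  show "\<zero>\<^bsub>ob N x\<^esub> = r \<odot>\<^bsub>ob N x\<^esub> \<zero>\<^bsub>ob N x\<^esub>" if "r \<in> carrier R" for r
    using that by (simp add: N.smult_r_null)
  show "\<zero>\<^bsub>ob N y\<^esub> = tr N x y \<zero>\<^bsub>ob N x\<^esub>" if "x \<le> y" for y
    using abelian_group_hom.hom_zero[OF pm_tr_hom[OF N that]] by simp
qed

lemma nat_trans_natural_on:
  assumes "f \<in> nat_trans R U M N"
  shows "natural_on R U M N f"
  using assms unfolding nat_trans_def natural_on_def linear_maps_def
  by (simp add: PiE_iff)

lemma natural_on_nat_trans:
  assumes M: "persistence_module R M" and f: "natural_on R U M N f"
  shows "extend U M f \<in> nat_trans R U M N"
proof -
  have "(\<lambda>m\<in>carrier (ob M x). f x m) \<in> linear_maps R (ob M x) (ob N x)" if "x \<in> U" for x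
    using f that by (auto simp: linear_maps_restrict_iff[OF pm_left_module[OF M]] natural_on_def)
  then show ?thesis
    unfolding nat_trans_def extend_def using f M
    by (auto simp: natural_on_tr pm_tr_closed)
qed

lemma extend_nat_trans:
  assumes "f \<in> nat_trans R U M N"
  shows "extend U M f = f"
proof -
  have "(\<lambda>m\<in>carrier (ob M x). f x m) = f x" if "x \<in> U" for x
    using assms that by (simp add: nat_trans_def linear_maps_def PiE_iff extensional_restrict)
  moreover have "f \<in> extensional U"
    using assms by (simp add: nat_trans_def PiE_iff)
  ultimately show ?thesis
    unfolding extend_def by (auto simp: fun_eq_iff extensional_def)
qed

lemma extend_cong:
  "(\<And>x m. x \<in> U \<Longrightarrow> m \<in> carrier (ob M x) \<Longrightarrow> f x m = g x m) \<Longrightarrow> extend U M f = extend U M g"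
  by (auto simp: extend_def fun_eq_iff)

text \<open>The targets may differ, since equality of extensional families depends only on
  \<open>U\<close> and the carriers of \<open>M\<close>.\<close>

lemma nat_trans_eqI:
  assumes "f \<in> nat_trans R U M N" "g \<in> nat_trans R U M N'"
    and "\<And>x m. x \<in> U \<Longrightarrow> m \<in> carrier (ob M x) \<Longrightarrow> f x m = g x m"
  shows "f = g"
  using assms by (metis extend_cong extend_nat_trans)

section \<open>Submodules and quotients\<close>

lemma left_moduleI:
  assumes "abelian_group G" "ring R"
    and "\<And>a x. a \<in> carrier R \<Longrightarrow> x \<in> carrier G \<Longrightarrow> a \<odot>\<^bsub>G\<^esub> x \<in> carrier G"
    and "\<And>a b x. a \<in> carrier R \<Longrightarrow> b \<in> carrier R \<Longrightarrow> x \<in> carrier G \<Longrightarrow>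
      (a \<oplus>\<^bsub>R\<^esub> b) \<odot>\<^bsub>G\<^esub> x = a \<odot>\<^bsub>G\<^esub> x \<oplus>\<^bsub>G\<^esub> b \<odot>\<^bsub>G\<^esub> x"
    and "\<And>a x y. a \<in> carrier R \<Longrightarrow> x \<in> carrier G \<Longrightarrow> y \<in> carrier G \<Longrightarrow>
      a \<odot>\<^bsub>G\<^esub> (x \<oplus>\<^bsub>G\<^esub> y) = a \<odot>\<^bsub>G\<^esub> x \<oplus>\<^bsub>G\<^esub> a \<odot>\<^bsub>G\<^esub> y"
    and "\<And>a b x. a \<in> carrier R \<Longrightarrow> b \<in> carrier R \<Longrightarrow> x \<in> carrier G \<Longrightarrow>
      (a \<otimes>\<^bsub>R\<^esub> b) \<odot>\<^bsub>G\<^esub> x = a \<odot>\<^bsub>G\<^esub> (b \<odot>\<^bsub>G\<^esub> x)"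
    and "\<And>x. x \<in> carrier G \<Longrightarrow> \<one>\<^bsub>R\<^esub> \<odot>\<^bsub>G\<^esub> x = x"
  shows "left_module R G"
  by (intro left_module.intro left_module_axioms.intro assms)

text \<open>Closure under negation is not listed, being a consequence of closure under scalars; see
  \<open>subfunctor_uminus\<close>.\<close>

definition subfunctor :: "'r ring \<Rightarrow> ('p::preorder, 'r, 'm) pmod \<Rightarrow> ('p \<Rightarrow> 'm set) \<Rightarrow> bool" where
  "subfunctor R M S \<longleftrightarrow>
     (\<forall>a. S a \<subseteq> carrier (ob M a) \<and> \<zero>\<^bsub>ob M a\<^esub> \<in> S a) \<and>
     (\<forall>a. \<forall>x\<in>S a. \<forall>y\<in>S a. x \<oplus>\<^bsub>ob M a\<^esub> y \<in> S a) \<and>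
     (\<forall>a. \<forall>r\<in>carrier R. \<forall>x\<in>S a. r \<odot>\<^bsub>ob M a\<^esub> x \<in> S a) \<and>
     (\<forall>a b. a \<le> b \<longrightarrow> (\<forall>x\<in>S a. tr M a b x \<in> S b))"

lemma carrier_sub_pmod [simp]: "carrier (ob (sub_pmod M S) a) = S a"
  and zero_sub_pmod [simp]: "\<zero>\<^bsub>ob (sub_pmod M S) a\<^esub> = \<zero>\<^bsub>ob M a\<^esub>"
  and add_sub_pmod [simp]: "x \<oplus>\<^bsub>ob (sub_pmod M S) a\<^esub> y = x \<oplus>\<^bsub>ob M a\<^esub> y"
  and smult_sub_pmod [simp]: "r \<odot>\<^bsub>ob (sub_pmod M S) a\<^esub> x = r \<odot>\<^bsub>ob M a\<^esub> x"
  and tr_sub_pmod [simp]: "tr (sub_pmod M S) = tr M"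
  by (simp_all add: sub_pmod_def)

lemma subfunctor_closed: "subfunctor R M S \<Longrightarrow> x \<in> S a \<Longrightarrow> x \<in> carrier (ob M a)"
  by (auto simp: subfunctor_def)

text \<open>Negation is multiplication by the scalar -1.\<close>

lemma subfunctor_uminus:
  assumes M: "persistence_module R M" and S: "subfunctor R M S" and x: "x \<in> S a"
  shows "\<ominus>\<^bsub>ob M a\<^esub> x \<in> S a"
proof -
  interpret left_module R "ob M a" using M by (rule pm_left_module)
  have xc: "x \<in> carrier (ob M a)" using S x by (rule subfunctor_closed)
  have "(\<ominus>\<^bsub>R\<^esub> \<one>\<^bsub>R\<^esub>) \<odot>\<^bsub>ob M a\<^esub> x \<oplus>\<^bsub>ob M a\<^esub> x = (\<ominus>\<^bsub>R\<^esub> \<one>\<^bsub>R\<^esub> \<oplus>\<^bsub>R\<^esub> \<one>\<^bsub>R\<^esub>) \<odot>\<^bsub>ob M a\<^esub> x"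
    using xc by (simp add: smult_l_distr smult_one)
  then have "(\<ominus>\<^bsub>R\<^esub> \<one>\<^bsub>R\<^esub>) \<odot>\<^bsub>ob M a\<^esub> x = \<ominus>\<^bsub>ob M a\<^esub> x"
    using xc by (simp add: R.l_neg smult_l_null M.minus_equality smult_closed)
  then show ?thesis
    using S x by (metis R.add.inv_closed R.one_closed subfunctor_def)
qed

lemma persistence_module_sub:
  assumes M: "persistence_module R M" and S: "subfunctor R M S"
  shows "persistence_module R (sub_pmod M S)"
proof -
  have "left_module R (ob (sub_pmod M S) a)" for a
  proof -
    interpret A: left_module R "ob M a" using M by (rule pm_left_module)
    note [simp] = subfunctor_closed[OF S, of _ a]
    interpret B: abelian_group "ob (sub_pmod M S) a"
    proof (rule abelian_groupI)
      fix x assume x: "x \<in> carrier (ob (sub_pmod M S) a)"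
      then have "\<ominus>\<^bsub>ob M a\<^esub> x \<in> S a" "\<ominus>\<^bsub>ob M a\<^esub> x \<oplus>\<^bsub>ob M a\<^esub> x = \<zero>\<^bsub>ob M a\<^esub>"
        using subfunctor_uminus[OF M S] by (auto simp: A.l_neg)
      then show "\<exists>y\<in>carrier (ob (sub_pmod M S) a). y \<oplus>\<^bsub>ob (sub_pmod M S) a\<^esub> x = \<zero>\<^bsub>ob (sub_pmod M S) a\<^esub>"
        by auto
    qed (use S in \<open>auto simp: subfunctor_def A.a_ac subset_iff\<close>)
    show ?thesis
      by (rule left_moduleI[OF B.abelian_group_axioms])
        (use S in \<open>auto simp: A.smult_l_distr A.smult_r_distr A.smult_assoc A.smult_one A.R.ring_axioms subfunctor_def\<close>)
  qed
  then show ?thesis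
    unfolding persistence_module_iff
    using S M by (auto simp: subfunctor_closed[OF S] pm_tr_add pm_tr_smult pm_tr_id pm_tr_tr)
      (auto simp: subfunctor_def)
qed

lemma natural_on_sub_target:
  "natural_on R U M (sub_pmod N S) f \<longleftrightarrow>
    natural_on R U M N f \<and> (\<forall>x\<in>U. \<forall>m\<in>carrier (ob M x). f x m \<in> S x)"
  if "subfunctor R N S"
  using subfunctor_closed[OF that] unfolding natural_on_def by (simp add: Ball_def) blast

lemma natural_on_sub_source:
  assumes S: "subfunctor R M S" and f: "natural_on R U M N f"
  shows "natural_on R U (sub_pmod M S) N f"
  by (rule natural_onI)
    (use f in \<open>auto simp: subfunctor_closed[OF S] natural_on_closed natural_on_add natural_on_smult natural_on_tr\<close>)

lemma mem_ker_set: "m \<in> ker_set M N f a \<longleftrightarrow> m \<in> carrier (ob M a) \<and> f a m = \<zero>\<^bsub>ob N a\<^esub>"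
  by (simp add: ker_set_def a_kernel_def kernel_def)

lemma subfunctor_ker:
  assumes M: "persistence_module R M" and N: "persistence_module R N" and f: "natural_on R UNIV M N f"
  shows "subfunctor R M (ker_set M N f)"
proof -
  {
    fix a
    interpret A: left_module R "ob M a" using M by (rule pm_left_module)
    interpret B: left_module R "ob N a" using N by (rule pm_left_module)
    have "\<zero>\<^bsub>ob M a\<^esub> \<in> ker_set M N f a"
      using natural_on_zero[OF M N f] by (simp add: mem_ker_set)
    moreover have "x \<oplus>\<^bsub>ob M a\<^esub> y \<in> ker_set M N f a" if "x \<in> ker_set M N f a" "y \<in> ker_set M N f a" for x y
      using that f by (simp add: mem_ker_set natural_on_add)
    moreover have "r \<odot>\<^bsub>ob M a\<^esub> x \<in> ker_set M N f a" if "r \<in> carrier R" "x \<in> ker_set M N f a" for x r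
      using that f by (simp add: mem_ker_set natural_on_smult A.smult_closed B.smult_r_null)
    moreover have "tr M a b x \<in> ker_set M N f b" if "a \<le> b" "x \<in> ker_set M N f a" for x b
      using that f M abelian_group_hom.hom_zero[OF pm_tr_hom[OF N \<open>a \<le> b\<close>]]
      by (simp add: mem_ker_set natural_on_tr pm_tr_closed)
    ultimately have "\<zero>\<^bsub>ob M a\<^esub> \<in> ker_set M N f a \<and>
       (\<forall>x\<in>ker_set M N f a. \<forall>y\<in>ker_set M N f a. x \<oplus>\<^bsub>ob M a\<^esub> y \<in> ker_set M N f a) \<and>
       (\<forall>r\<in>carrier R. \<forall>x\<in>ker_set M N f a. r \<odot>\<^bsub>ob M a\<^esub> x \<in> ker_set M N f a) \<and>
       (\<forall>b. a \<le> b \<longrightarrow> (\<forall>x\<in>ker_set M N f a. tr M a b x \<in> ker_set M N f b))"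
      by blast
  }
  then show ?thesis
    unfolding subfunctor_def by (auto simp: mem_ker_set)
qed

lemma subfunctor_im:
  assumes M: "persistence_module R M" and N: "persistence_module R N" and f: "natural_on R UNIV M N f"
  shows "subfunctor R N (im_set M f)"
proof -
  {
    fix a
    interpret A: left_module R "ob M a" using M by (rule pm_left_module)
    have "\<zero>\<^bsub>ob N a\<^esub> \<in> im_set M f a"
      unfolding im_set_def using natural_on_zero[OF M N f] A.zero_closed by (metis UNIV_I imageI)
    moreover have "f a x \<oplus>\<^bsub>ob N a\<^esub> f a y \<in> im_set M f a"
      if "x \<in> carrier (ob M a)" "y \<in> carrier (ob M a)" for x y
      unfolding im_set_def
      using that natural_on_add[OF f, of a x y] by (metis UNIV_I imageI A.a_closed)
    moreover have "r \<odot>\<^bsub>ob N a\<^esub> f a x \<in> im_set M f a"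
      if "r \<in> carrier R" "x \<in> carrier (ob M a)" for x r
      unfolding im_set_def
      using that natural_on_smult[OF f, of a r x] by (metis UNIV_I imageI A.smult_closed)
    moreover have "tr N a b (f a x) \<in> im_set M f b" if "a \<le> b" "x \<in> carrier (ob M a)" for x b
      unfolding im_set_def
      using that natural_on_tr[OF f, of a b x] by (metis UNIV_I imageI pm_tr_closed[OF M])
    moreover have "im_set M f a \<subseteq> carrier (ob N a)"
      unfolding im_set_def using f by (auto simp: natural_on_closed)
    ultimately have "im_set M f a \<subseteq> carrier (ob N a) \<and> \<zero>\<^bsub>ob N a\<^esub> \<in> im_set M f a \<and>
       (\<forall>x\<in>im_set M f a. \<forall>y\<in>im_set M f a. x \<oplus>\<^bsub>ob N a\<^esub> y \<in> im_set M f a) \<and>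
       (\<forall>r\<in>carrier R. \<forall>x\<in>im_set M f a. r \<odot>\<^bsub>ob N a\<^esub> x \<in> im_set M f a) \<and>
       (\<forall>b. a \<le> b \<longrightarrow> (\<forall>x\<in>im_set M f a. tr N a b x \<in> im_set M f b))"
      unfolding im_set_def by (simp add: ball_simps)
  }
  then show ?thesis
    unfolding subfunctor_def by blast
qed

text \<open>Every law is an equation between elements of the form \<open>q a m\<close>, and
  \<open>q\<close> moves it back to the same law in \<open>M\<close>. Nothing is known of
  \<open>N\<close> beforehand: \<open>natural_on\<close> mentions only its raw operations. Serves
  for quotients and for the copy of a projective module on indicator functions.\<close>

lemma persistence_module_surj_image:
  assumes M: "persistence_module R M"
    and carr: "\<And>a. carrier (ob N a) = q a ` carrier (ob M a)"
    and zero: "\<And>a. \<zero>\<^bsub>ob N a\<^esub> = q a \<zero>\<^bsub>ob M a\<^esub>"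
    and q: "natural_on R UNIV M N q"
  shows "persistence_module R N"
proof -
  note add = natural_on_add[OF q UNIV_I, symmetric] and smult = natural_on_smult[OF q UNIV_I, symmetric]
    and tr = natural_on_tr[OF q UNIV_I UNIV_I, symmetric]
  have "left_module R (ob N a)" for a
  proof -
    interpret A: left_module R "ob M a" using M by (rule pm_left_module)
    interpret B: abelian_group "ob N a"
    proof (rule abelian_groupI)
      fix x assume "x \<in> carrier (ob N a)"
      then obtain m where m: "m \<in> carrier (ob M a)" "x = q a m" by (auto simp: carr)
      then show "\<exists>y\<in>carrier (ob N a). y \<oplus>\<^bsub>ob N a\<^esub> x = \<zero>\<^bsub>ob N a\<^esub>"
        by (intro bexI[of _ "q a (\<ominus>\<^bsub>ob M a\<^esub> m)"]) (auto simp: carr zero add A.l_neg)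
    qed (auto simp: carr zero add A.a_ac)
    show ?thesis
      by (rule left_moduleI[OF B.abelian_group_axioms])
        (auto simp: carr add smult A.smult_closed A.smult_l_distr A.smult_r_distr A.smult_assoc A.smult_one A.R.ring_axioms)
  qed
  moreover have closed: "\<And>m r a. m \<in> carrier (ob M a) \<Longrightarrow> r \<in> carrier R \<Longrightarrow> r \<odot>\<^bsub>ob M a\<^esub> m \<in> carrier (ob M a)"
    "\<And>m m' a. m \<in> carrier (ob M a) \<Longrightarrow> m' \<in> carrier (ob M a) \<Longrightarrow> m \<oplus>\<^bsub>ob M a\<^esub> m' \<in> carrier (ob M a)"
    using M by (auto simp: pm_smult_closed intro: abelian_groupE(1)[OF pm_abelian_group])
  moreover have "tr N a c (q a m) = q c (tr M a c m)"
    if "a \<le> b" "b \<le> c" "m \<in> carrier (ob M a)" for a b c m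
    using tr order_trans[OF that(1,2)] that(3) by simp
  ultimately show ?thesis
    unfolding persistence_module_iff carr
    using M by (auto simp: tr add smult pm_tr_closed pm_tr_id pm_tr_tr pm_tr_add pm_tr_smult)
qed

text \<open>\<open>coset_map\<close> is a union over all elements of the coset, and it collapses
  because every member contributes the same coset of \<open>N\<close>. Additivity is asked only for
  products \<open>n \<otimes> x\<close> with n in \<open>N'\<close>, so the lemma covers scalar
  multiplication, transition maps, chain maps and pullback of cochains alike.\<close>

lemma coset_map_r_coset:
  assumes "group H" "subgroup N H" "N' \<noteq> {}" "f x \<in> carrier H"
    and f: "\<And>n. n \<in> N' \<Longrightarrow> f (n \<otimes>\<^bsub>G\<^esub> x) = f n \<otimes>\<^bsub>H\<^esub> f x" "\<And>n. n \<in> N' \<Longrightarrow> f n \<in> N"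
  shows "coset_map H N f (N' #>\<^bsub>G\<^esub> x) = N #>\<^bsub>H\<^esub> f x"
proof -
  interpret H: group H by fact
  have "N #>\<^bsub>H\<^esub> f (n \<otimes>\<^bsub>G\<^esub> x) = N #>\<^bsub>H\<^esub> f x" if "n \<in> N'" for n
  proof -
    have "f n \<otimes>\<^bsub>H\<^esub> f x \<in> N #>\<^bsub>H\<^esub> f x"
      unfolding r_coset_def using f(2)[OF that] by blast
    then show ?thesis
      using H.repr_independence assms(2,4) f(1)[OF that] by metis
  qed
  moreover have "coset_map H N f (N' #>\<^bsub>G\<^esub> x) = (\<Union>n\<in>N'. N #>\<^bsub>H\<^esub> f (n \<otimes>\<^bsub>G\<^esub> x))"
    unfolding coset_map_def r_coset_def[of G] by blast
  ultimately show ?thesis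
    using assms(3) by auto
qed

definition quot_proj :: "('p, 'r, 'm) pmod \<Rightarrow> ('p \<Rightarrow> 'm set) \<Rightarrow> 'p \<Rightarrow> 'm \<Rightarrow> 'm set" where
  "quot_proj M S a m = S a +>\<^bsub>ob M a\<^esub> m"

lemma subfunctor_subgroup:
  assumes "persistence_module R M" "subfunctor R M S"
  shows "subgroup (S a) (add_monoid (ob M a))"
proof -
  interpret A: abelian_group "ob M a" using assms(1) by (rule pm_abelian_group)
  show ?thesis
  proof
    show "S a \<subseteq> carrier (add_monoid (ob M a))"
      using assms(2) by (auto simp: subfunctor_def)
    show "inv\<^bsub>add_monoid (ob M a)\<^esub> x \<in> S a" if "x \<in> S a" for x
      using subfunctor_uminus[OF assms that] by (simp add: a_inv_def)
  qed (use assms(2) in \<open>auto simp: subfunctor_def\<close>)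
qed

lemma
  assumes M: "persistence_module R M" and S: "subfunctor R M S"
  shows persistence_module_quot: "persistence_module R (quot_pmod M S)"
    and natural_on_quot_proj: "natural_on R U M (quot_pmod M S) (quot_proj M S)"
    and carrier_quot_pmod: "carrier (ob (quot_pmod M S) a) = quot_proj M S a ` carrier (ob M a)"
    and quot_proj_eq_iff: "x \<in> carrier (ob M a) \<Longrightarrow> y \<in> carrier (ob M a) \<Longrightarrow>
      quot_proj M S a x = quot_proj M S a y \<longleftrightarrow> x \<ominus>\<^bsub>ob M a\<^esub> y \<in> S a"
    and quot_proj_zero_iff: "x \<in> carrier (ob M a) \<Longrightarrow>
      quot_proj M S a x = \<zero>\<^bsub>ob (quot_pmod M S) a\<^esub> \<longleftrightarrow> x \<in> S a"
proof -
  note S' = S[unfolded subfunctor_def]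
  have carr: "carrier (ob (quot_pmod M S) a) = quot_proj M S a ` carrier (ob M a)" for a
    by (auto simp: quot_pmod_def quot_module_def A_RCOSETS_def' quot_proj_def)
  have zero: "\<zero>\<^bsub>ob (quot_pmod M S) a\<^esub> = quot_proj M S a \<zero>\<^bsub>ob M a\<^esub>" for a
  proof -
    interpret A: abelian_group "ob M a" using M by (rule pm_abelian_group)
    show ?thesis
      using subfunctor_closed[OF S, of _ a] by (simp add: quot_pmod_def quot_module_def quot_proj_def subset_iff)
  qed
  \<comment> \<open>This precedes the proof that the quotient is a persistence module, which is then
    deduced from it by surjectivity of the projection.\<close>
  have nat: "natural_on R UNIV M (quot_pmod M S) (quot_proj M S)"
  proof
    fix x m assume m: "m \<in> carrier (ob M x)"
    interpret A: left_module R "ob M x" using M by (rule pm_left_module)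
    interpret N: normal "S x" "add_monoid (ob M x)"
      using subfunctor_subgroup[OF M S] A.a_comm_group by (simp add: comm_group.subgroup_imp_normal)
    show "quot_proj M S x m \<in> carrier (ob (quot_pmod M S) x)"
      using m by (simp add: carr)
    show "quot_proj M S x (m \<oplus>\<^bsub>ob M x\<^esub> m') = quot_proj M S x m \<oplus>\<^bsub>ob (quot_pmod M S) x\<^esub> quot_proj M S x m'"
      if "m' \<in> carrier (ob M x)" for m'
      using N.rcos_sum[of m m'] m that
      by (simp add: quot_proj_def quot_pmod_def quot_module_def a_r_coset_def set_add_def)
    show "quot_proj M S x (r \<odot>\<^bsub>ob M x\<^esub> m) = r \<odot>\<^bsub>ob (quot_pmod M S) x\<^esub> quot_proj M S x m"
      if r: "r \<in> carrier R" for r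
    proof -
      have "coset_map (add_monoid (ob M x)) (S x) (\<lambda>m. r \<odot>\<^bsub>ob M x\<^esub> m) (S x #>\<^bsub>add_monoid (ob M x)\<^esub> m)
          = S x #>\<^bsub>add_monoid (ob M x)\<^esub> (r \<odot>\<^bsub>ob M x\<^esub> m)"
        using S' m r subfunctor_subgroup[OF M S]
        by (intro coset_map_r_coset) (auto simp: A.smult_closed A.smult_r_distr subset_iff A.a_group)
      then show ?thesis
        by (simp add: quot_proj_def quot_pmod_def quot_module_def a_r_coset_def coset_map_def)
    qed
    show "quot_proj M S y (tr M x y m) = tr (quot_pmod M S) x y (quot_proj M S x m)" if xy: "x \<le> y" for y
    proof -
      interpret B: left_module R "ob M y" using M by (rule pm_left_module)
      have "coset_map (add_monoid (ob M y)) (S y) (tr M x y) (S x #>\<^bsub>add_monoid (ob M x)\<^esub> m)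
          = S y #>\<^bsub>add_monoid (ob M y)\<^esub> (tr M x y m)"
        using S' m xy M subfunctor_subgroup[OF M S]
        by (intro coset_map_r_coset) (auto simp: pm_tr_closed pm_tr_add subset_iff B.a_group)
      then show ?thesis
        by (simp add: quot_proj_def quot_pmod_def a_r_coset_def)
    qed
  qed
  show "carrier (ob (quot_pmod M S) a) = quot_proj M S a ` carrier (ob M a)" by (rule carr)
  show "natural_on R U M (quot_pmod M S) (quot_proj M S)" using nat by (rule natural_on_mono) simp
  show "persistence_module R (quot_pmod M S)"
    using M carr zero nat by (rule persistence_module_surj_image)
  interpret A: abelian_group "ob M a" using M by (rule pm_abelian_group)
  interpret N: subgroup "S a" "add_monoid (ob M a)" using subfunctor_subgroup[OF M S] .
  show iff: "quot_proj M S a x = quot_proj M S a y \<longleftrightarrow> x \<ominus>\<^bsub>ob M a\<^esub> y \<in> S a"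
    if x: "x \<in> carrier (ob M a)" and y: "y \<in> carrier (ob M a)" for x y
  proof -
    have "quot_proj M S a x = quot_proj M S a y \<longleftrightarrow> x \<in> S a #>\<^bsub>add_monoid (ob M a)\<^esub> y"
      using A.a_group x y subfunctor_subgroup[OF M S] unfolding quot_proj_def a_r_coset_def
      by (metis group.rcos_self group.repr_independence partial_object.select_convs(1))
    also have "\<dots> \<longleftrightarrow> x \<ominus>\<^bsub>ob M a\<^esub> y \<in> S a"
      using N.rcos_module[OF A.a_group, of y x] x y by (simp add: a_minus_def a_inv_def)
    finally show ?thesis .
  qed
  show "quot_proj M S a x = \<zero>\<^bsub>ob (quot_pmod M S) a\<^esub> \<longleftrightarrow> x \<in> S a"
    if "x \<in> carrier (ob M a)" for x
    using iff[OF that A.zero_closed] that A.minus_equality[of "\<zero>\<^bsub>ob M a\<^esub>" "\<zero>\<^bsub>ob M a\<^esub>"]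
    by (simp add: zero a_minus_def)
qed

section \<open>Free persistence modules and lifting\<close>

text \<open>The direct sum of the representable modules R[P(a, -)], one for each m in the underlying
  set of M_a. All values are sets of functions on one common index type, and the admissible support
  grows with x, so the transition maps are literally the identity.\<close>

definition free_pmod :: "'r ring \<Rightarrow> ('p::preorder, 'r, 'm) pmod \<Rightarrow> ('p, 'r, 'p \<times> 'm \<Rightarrow> 'r) pmod" where
  "free_pmod R M = \<lparr>ob = \<lambda>x.
     \<lparr>carrier = {\<phi>. (\<forall>i. \<phi> i \<in> carrier R) \<and> finite {i. \<phi> i \<noteq> \<zero>\<^bsub>R\<^esub>} \<and>
        (\<forall>i. \<phi> i \<noteq> \<zero>\<^bsub>R\<^esub> \<longrightarrow> fst i \<le> x \<and> snd i \<in> carrier (ob M (fst i)))},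
      mult = undefined, one = undefined, zero = \<lambda>i. \<zero>\<^bsub>R\<^esub>, add = \<lambda>\<phi> \<psi> i. \<phi> i \<oplus>\<^bsub>R\<^esub> \<psi> i,
      smult = \<lambda>r \<phi> i. r \<otimes>\<^bsub>R\<^esub> \<phi> i\<rparr>,
     tr = \<lambda>x y \<phi>. \<phi>\<rparr>"

lemma persistence_module_free:
  fixes R :: "'r ring" (structure) and M :: "('p::preorder, 'r, 'm) pmod"
  assumes "ring R"
  shows "persistence_module R (free_pmod R M)"
proof -
  interpret ring R by fact
  have fin: "finite {i. \<phi> i \<oplus> \<psi> i \<noteq> \<zero>}" if "finite {i. \<phi> i \<noteq> \<zero>}" "finite {i. \<psi> i \<noteq> \<zero>}"
    for \<phi> \<psi> :: "'p \<times> 'm \<Rightarrow> 'r"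
    using finite_UnI[OF that] by (rule finite_subset[rotated]) auto
  have fin': "finite {i. r \<otimes> \<phi> i \<noteq> \<zero>}" if "finite {i. \<phi> i \<noteq> \<zero>}" "r \<in> carrier R"
    for r and \<phi> :: "'p \<times> 'm \<Rightarrow> 'r"
    using that by (auto intro: finite_subset[OF _ that(1)])
  have "left_module R (ob (free_pmod R M) x)" for x
  proof (rule left_moduleI)
    show "abelian_group (ob (free_pmod R M) x)"
    proof (rule abelian_groupI)
      fix \<phi> assume \<phi>: "\<phi> \<in> carrier (ob (free_pmod R M) x)"
      then have "{i. \<ominus> \<phi> i \<noteq> \<zero>} = {i. \<phi> i \<noteq> \<zero>}"
        by (auto simp: free_pmod_def)
      then show "\<exists>\<psi>\<in>carrier (ob (free_pmod R M) x). \<psi> \<oplus>\<^bsub>ob (free_pmod R M) x\<^esub> \<phi> = \<zero>\<^bsub>ob (free_pmod R M) x\<^esub>"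
        using \<phi> by (intro bexI[of _ "\<lambda>i. \<ominus> \<phi> i"]) (auto simp: free_pmod_def l_neg)
    next
      fix \<phi> \<psi> assume "\<phi> \<in> carrier (ob (free_pmod R M) x)" "\<psi> \<in> carrier (ob (free_pmod R M) x)"
      then show "\<phi> \<oplus>\<^bsub>ob (free_pmod R M) x\<^esub> \<psi> \<in> carrier (ob (free_pmod R M) x)"
        by (simp add: free_pmod_def fin) (metis r_zero zero_closed)
    qed (auto simp: free_pmod_def a_ac)
  next
    fix r \<phi> assume "r \<in> carrier R" "\<phi> \<in> carrier (ob (free_pmod R M) x)"
    then show "r \<odot>\<^bsub>ob (free_pmod R M) x\<^esub> \<phi> \<in> carrier (ob (free_pmod R M) x)"
      by (simp add: free_pmod_def fin') (metis r_null)
  qed (auto simp: free_pmod_def l_distr r_distr m_assoc assms)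
  then show ?thesis
    unfolding persistence_module_iff
    by (auto simp: free_pmod_def) (blast intro: order_trans)
qed

lemma (in abelian_group_hom) hom_finsum:
  "finite A \<Longrightarrow> f \<in> A \<rightarrow> carrier G \<Longrightarrow> h (finsum G f A) = finsum H (\<lambda>x. h (f x)) A"
proof (induction A rule: finite_induct)
  case (insert a A)
  then have "f a \<in> carrier G" "f \<in> A \<rightarrow> carrier G" "h (f a) \<in> carrier H" "(\<lambda>x. h (f x)) \<in> A \<rightarrow> carrier H"
    by (auto simp: Pi_iff)
  with insert show ?case
    by (simp add: G.finsum_insert H.finsum_insert G.finsum_closed)
qed auto

text \<open>The universal map out of the free module: the generator with index (a, m) goes to
  \<open>c (a, m)\<close>.\<close>

definition free_ext ::
  "'r ring \<Rightarrow> ('p::preorder, 'r, 'x) pmod \<Rightarrow> ('p \<times> 'm \<Rightarrow> 'x) \<Rightarrow> 'p \<Rightarrow> ('p \<times> 'm \<Rightarrow> 'r) \<Rightarrow> 'x" where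
  "free_ext R X c x \<phi> =
     (\<Oplus>\<^bsub>ob X x\<^esub>i\<in>{i. \<phi> i \<noteq> \<zero>\<^bsub>R\<^esub>}. \<phi> i \<odot>\<^bsub>ob X x\<^esub> tr X (fst i) x (c i))"

locale free_extension =
  fixes R :: "'r ring" and M :: "('p::preorder, 'r, 'm) pmod" and X :: "('p, 'r, 'x) pmod"
    and c :: "'p \<times> 'm \<Rightarrow> 'x"
  assumes X: "persistence_module R X"
    and c: "\<And>a m. m \<in> carrier (ob M a) \<Longrightarrow> c (a, m) \<in> carrier (ob X a)"
begin

definition index :: "'p \<Rightarrow> ('p \<times> 'm) set" where
  "index x = {i. fst i \<le> x \<and> snd i \<in> carrier (ob M (fst i))}"

lemma free_carrier_iff:
  "\<phi> \<in> carrier (ob (free_pmod R M) x) \<longleftrightarrow>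
    (\<forall>i. \<phi> i \<in> carrier R) \<and> finite {i. \<phi> i \<noteq> \<zero>\<^bsub>R\<^esub>} \<and> {i. \<phi> i \<noteq> \<zero>\<^bsub>R\<^esub>} \<subseteq> index x"
  by (auto simp: free_pmod_def index_def)

lemma term_closed:
  "r \<in> carrier R \<Longrightarrow> i \<in> index x \<Longrightarrow> r \<odot>\<^bsub>ob X x\<^esub> tr X (fst i) x (c i) \<in> carrier (ob X x)"
  using X c[of "snd i" "fst i"] by (auto simp: index_def pm_smult_closed pm_tr_closed)

text \<open>The defining sum runs over the support of \<phi>, which does not behave additively.
  Enlarging the index set by vanishing terms lets two elements be summed over a common set.\<close>

lemma free_ext_sum:
  assumes "\<phi> \<in> carrier (ob (free_pmod R M) x)" "finite A" "{i. \<phi> i \<noteq> \<zero>\<^bsub>R\<^esub>} \<subseteq> A" "A \<subseteq> index x"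
  shows "free_ext R X c x \<phi> = (\<Oplus>\<^bsub>ob X x\<^esub>i\<in>A. \<phi> i \<odot>\<^bsub>ob X x\<^esub> tr X (fst i) x (c i))"
proof -
  interpret X: left_module R "ob X x" using X by (rule pm_left_module)
  have "\<phi> i \<odot>\<^bsub>ob X x\<^esub> tr X (fst i) x (c i) = \<zero>\<^bsub>ob X x\<^esub>" if "i \<in> A" "\<phi> i = \<zero>\<^bsub>R\<^esub>" for i
  proof -
    have "tr X (fst i) x (c i) \<in> carrier (ob X x)"
      using that assms(4) X c[of "snd i" "fst i"] by (auto simp: index_def intro!: pm_tr_closed)
    then show ?thesis by (simp add: that X.smult_l_null)
  qed
  then show ?thesis
    unfolding free_ext_def using assms
    by (intro X.add.finprod_mono_neutral_cong_left) (auto simp: free_carrier_iff intro!: term_closed)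
qed

lemma natural_on_free_ext: "natural_on R UNIV (free_pmod R M) X (free_ext R X c)"
proof
  fix x \<phi> assume \<phi>: "\<phi> \<in> carrier (ob (free_pmod R M) x)"
  interpret X: left_module R "ob X x" using X by (rule pm_left_module)
  let ?S = "{i. \<phi> i \<noteq> \<zero>\<^bsub>R\<^esub>}"
  have S: "finite ?S" "?S \<subseteq> index x" "\<And>i. \<phi> i \<in> carrier R"
    using \<phi> by (auto simp: free_carrier_iff)
  have terms: "(\<lambda>i. \<phi> i \<odot>\<^bsub>ob X x\<^esub> tr X (fst i) x (c i)) \<in> A \<rightarrow> carrier (ob X x)"
    if "A \<subseteq> index x" "\<And>i. \<phi> i \<in> carrier R" for A and \<phi> :: "'p \<times> 'm \<Rightarrow> 'r"
    using that by (auto intro!: term_closed)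
  show "free_ext R X c x \<phi> \<in> carrier (ob X x)"
    unfolding free_ext_def using S by (intro X.finsum_closed terms)
  have tr_c: "tr X (fst i) x (c i) \<in> carrier (ob X x)" if "i \<in> index x" for i
    using that X c[of "snd i" "fst i"] by (auto simp: index_def intro!: pm_tr_closed)
  show "free_ext R X c x (\<phi> \<oplus>\<^bsub>ob (free_pmod R M) x\<^esub> \<psi>) = free_ext R X c x \<phi> \<oplus>\<^bsub>ob X x\<^esub> free_ext R X c x \<psi>"
    if \<psi>: "\<psi> \<in> carrier (ob (free_pmod R M) x)" for \<psi>
  proof -
    let ?A = "?S \<union> {i. \<psi> i \<noteq> \<zero>\<^bsub>R\<^esub>}"
    have T: "\<And>i. \<psi> i \<in> carrier R" "finite ?A" "?A \<subseteq> index x"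
      using \<phi> \<psi> by (auto simp: free_carrier_iff)
    have sum: "\<phi> \<oplus>\<^bsub>ob (free_pmod R M) x\<^esub> \<psi> \<in> carrier (ob (free_pmod R M) x)"
      using \<phi> \<psi> abelian_groupE(1)[OF pm_abelian_group[OF persistence_module_free[OF X.R.ring_axioms]]] by blast
    have "free_ext R X c x (\<phi> \<oplus>\<^bsub>ob (free_pmod R M) x\<^esub> \<psi>) =
        (\<Oplus>\<^bsub>ob X x\<^esub>i\<in>?A. (\<phi> i \<oplus>\<^bsub>R\<^esub> \<psi> i) \<odot>\<^bsub>ob X x\<^esub> tr X (fst i) x (c i))"
      using T S by (subst free_ext_sum[OF sum, of ?A]) (auto simp: free_pmod_def)
    also have "\<dots> = (\<Oplus>\<^bsub>ob X x\<^esub>i\<in>?A. \<phi> i \<odot>\<^bsub>ob X x\<^esub> tr X (fst i) x (c i) \<oplus>\<^bsub>ob X x\<^esub>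
        \<psi> i \<odot>\<^bsub>ob X x\<^esub> tr X (fst i) x (c i))"
      using T S tr_c
      by (intro X.add.finprod_cong') (auto simp: X.smult_l_distr subset_iff intro!: X.a_closed X.smult_closed)
    also have "\<dots> = free_ext R X c x \<phi> \<oplus>\<^bsub>ob X x\<^esub> free_ext R X c x \<psi>"
      using T S terms[of ?A \<phi>] terms[of ?A \<psi>] free_ext_sum[OF \<phi>, of ?A] free_ext_sum[OF \<psi>, of ?A]
      by (simp add: X.finsum_addf)
    finally show ?thesis .
  qed
  show "free_ext R X c x (r \<odot>\<^bsub>ob (free_pmod R M) x\<^esub> \<phi>) = r \<odot>\<^bsub>ob X x\<^esub> free_ext R X c x \<phi>"
    if r: "r \<in> carrier R" for r
  proof -
    interpret scale: abelian_group_hom "ob X x" "ob X x" "\<lambda>m. r \<odot>\<^bsub>ob X x\<^esub> m"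
      using r by unfold_locales (auto simp: hom_def X.smult_closed X.smult_r_distr)
    have mem: "r \<odot>\<^bsub>ob (free_pmod R M) x\<^esub> \<phi> \<in> carrier (ob (free_pmod R M) x)"
      using \<phi> r pm_smult_closed[OF persistence_module_free[OF X.R.ring_axioms]] by blast
    \<comment> \<open>The support of the multiple can be smaller than that of \<phi>, as r may
      annihilate coefficients; the sum is therefore kept over \<open>?S\<close>.\<close>
    have "free_ext R X c x (r \<odot>\<^bsub>ob (free_pmod R M) x\<^esub> \<phi>) =
        (\<Oplus>\<^bsub>ob X x\<^esub>i\<in>?S. (r \<otimes>\<^bsub>R\<^esub> \<phi> i) \<odot>\<^bsub>ob X x\<^esub> tr X (fst i) x (c i))"
      using S r by (subst free_ext_sum[OF mem, of ?S]) (auto simp: free_pmod_def)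
    also have "\<dots> = (\<Oplus>\<^bsub>ob X x\<^esub>i\<in>?S. r \<odot>\<^bsub>ob X x\<^esub> (\<phi> i \<odot>\<^bsub>ob X x\<^esub> tr X (fst i) x (c i)))"
      using S r tr_c by (intro X.add.finprod_cong') (auto simp: X.smult_assoc intro!: X.smult_closed)
    also have "\<dots> = r \<odot>\<^bsub>ob X x\<^esub> free_ext R X c x \<phi>"
      unfolding free_ext_def using S r by (intro scale.hom_finsum[symmetric] terms)
    finally show ?thesis .
  qed
  show "free_ext R X c y (tr (free_pmod R M) x y \<phi>) = tr X x y (free_ext R X c x \<phi>)" if xy: "x \<le> y" for y
  proof -
    interpret Y: left_module R "ob X y" using X by (rule pm_left_module)
    interpret tr: abelian_group_hom "ob X x" "ob X y" "tr X x y" using X xy by (rule pm_tr_hom)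
    have "tr X x y (free_ext R X c x \<phi>) = 
      (\<Oplus>\<^bsub>ob X y\<^esub>i\<in>?S. tr X x y (\<phi> i \<odot>\<^bsub>ob X x\<^esub> tr X (fst i) x (c i)))"
      unfolding free_ext_def using S by (intro tr.hom_finsum terms)
    also have "\<dots> = (\<Oplus>\<^bsub>ob X y\<^esub>i\<in>?S. \<phi> i \<odot>\<^bsub>ob X y\<^esub> tr X (fst i) y (c i))"
    proof (rule Y.add.finprod_cong')
      fix i assume "i \<in> ?S"
      then have i: "i \<in> index x" using S by blast
      moreover have "c i \<in> carrier (ob X (fst i))" using i c[of "snd i" "fst i"] by (simp add: index_def)
      ultimately show "tr X x y (\<phi> i \<odot>\<^bsub>ob X x\<^esub> tr X (fst i) x (c i)) = \<phi> i \<odot>\<^bsub>ob X y\<^esub> tr X (fst i) y (c i)"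
        using X xy S tr_c[OF i] by (simp add: pm_tr_smult pm_tr_tr index_def)
    next
      have "?S \<subseteq> index y"
        using S(2) order_trans[OF _ xy] by (auto simp: index_def)
      then show "(\<lambda>i. \<phi> i \<odot>\<^bsub>ob X y\<^esub> tr X (fst i) y (c i)) \<in> ?S \<rightarrow> carrier (ob X y)"
        using S(3) by (auto intro!: term_closed)
    qed simp
    finally show ?thesis
      by (simp add: free_ext_def free_pmod_def)
  qed
qed

lemma free_ext_generator:
  assumes m: "m \<in> carrier (ob M x)"
  defines "\<delta> \<equiv> \<lambda>i. if i = (x, m) then \<one>\<^bsub>R\<^esub> else \<zero>\<^bsub>R\<^esub>"
  shows "\<delta> \<in> carrier (ob (free_pmod R M) x)" "free_ext R X c x \<delta> = c (x, m)"
proof -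
  interpret X: left_module R "ob X x" using X by (rule pm_left_module)
  \<comment> \<open>Only an inclusion: over the zero ring the support is empty.\<close>
  have "{i. \<delta> i \<noteq> \<zero>\<^bsub>R\<^esub>} \<subseteq> {(x, m)}" "(x, m) \<in> index x"
    using m by (auto simp: \<delta>_def index_def)
  moreover from this show "\<delta> \<in> carrier (ob (free_pmod R M) x)"
    by (auto simp: free_carrier_iff \<delta>_def intro: finite_subset)
  ultimately have "free_ext R X c x \<delta> = (\<Oplus>\<^bsub>ob X x\<^esub>i\<in>{(x, m)}. \<delta> i \<odot>\<^bsub>ob X x\<^esub> tr X (fst i) x (c i))"
    by (intro free_ext_sum) auto
  also have "\<dots> = c (x, m)"
    using m c[OF m] X by (simp add: \<delta>_def pm_tr_id X.smult_one)
  finally show "free_ext R X c x \<delta> = c (x, m)" .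
qed

text \<open>Uniqueness in the universal property: composing with \<open>e\<close> only changes the
  values on generators. Agreement of \<open>c'\<close> is required on elements of \<open>M\<close>
  alone, since the support of \<phi> contains no other indices.\<close>

lemma free_ext_comp:
  assumes Y: "persistence_module R Y" and e: "natural_on R UNIV X Y e"
    and \<phi>: "\<phi> \<in> carrier (ob (free_pmod R M) x)"
    and c': "\<And>a m. m \<in> carrier (ob M a) \<Longrightarrow> c' (a, m) = e a (c (a, m))"
  shows "e x (free_ext R X c x \<phi>) = free_ext R Y c' x \<phi>"
proof -
  interpret X: left_module R "ob X x" using X by (rule pm_left_module)
  interpret Y: left_module R "ob Y x" using Y by (rule pm_left_module)
  interpret e: abelian_group_hom "ob X x" "ob Y x" "e x"
    using natural_on_hom[OF X Y e] by simp
  let ?S = "{i. \<phi> i \<noteq> \<zero>\<^bsub>R\<^esub>}"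
  have S: "finite ?S" "?S \<subseteq> index x" "\<And>i. \<phi> i \<in> carrier R"
    using \<phi> by (auto simp: free_carrier_iff)
  have "e x (free_ext R X c x \<phi>) = (\<Oplus>\<^bsub>ob Y x\<^esub>i\<in>?S. e x (\<phi> i \<odot>\<^bsub>ob X x\<^esub> tr X (fst i) x (c i)))"
    unfolding free_ext_def using S by (intro e.hom_finsum) (auto intro!: term_closed)
  also have "\<dots> = (\<Oplus>\<^bsub>ob Y x\<^esub>i\<in>?S. \<phi> i \<odot>\<^bsub>ob Y x\<^esub> tr Y (fst i) x (c' i))"
  proof (rule Y.add.finprod_cong')
    fix i assume "i \<in> ?S"
    then have i: "fst i \<le> x" "snd i \<in> carrier (ob M (fst i))" using S by (auto simp: index_def)
    have "c i \<in> carrier (ob X (fst i))" "c' i = e (fst i) (c i)"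
      using i c[of "snd i" "fst i"] c'[of "snd i" "fst i"] by auto
    then show "e x (\<phi> i \<odot>\<^bsub>ob X x\<^esub> tr X (fst i) x (c i)) = \<phi> i \<odot>\<^bsub>ob Y x\<^esub> tr Y (fst i) x (c' i)"
      using X e i S by (simp add: natural_on_smult natural_on_tr pm_tr_closed)
  next
    show "(\<lambda>i. \<phi> i \<odot>\<^bsub>ob Y x\<^esub> tr Y (fst i) x (c' i)) \<in> {i. \<phi> i \<noteq> \<zero>\<^bsub>R\<^esub>} \<rightarrow> carrier (ob Y x)"
    proof
      fix i assume "i \<in> ?S"
      then have i: "fst i \<le> x" "snd i \<in> carrier (ob M (fst i))" using S by (auto simp: index_def)
      then show "\<phi> i \<odot>\<^bsub>ob Y x\<^esub> tr Y (fst i) x (c' i) \<in> carrier (ob Y x)"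
        using S(3)[of i] Y natural_on_closed[OF e] c[of "snd i" "fst i"] c'[of "snd i" "fst i"]
        by (intro Y.smult_closed pm_tr_closed) auto
    qed
  qed simp
  finally show ?thesis
    by (simp add: free_ext_def)
qed

end

section \<open>Lifting from projective modules over arbitrary element types\<close>

lemma projective_persistence_module: "projective R M \<Longrightarrow> persistence_module R M"
  by (simp add: projective_def)

text \<open>The test modules of \<^const>\<open>projective\<close> are the free module and a copy of \<open>M\<close> on indicator functions.\<close>

lemma projective_retract_of_free:
  assumes "projective R M"
  shows "\<exists>g. natural_on R UNIV M (free_pmod R M) g \<and>
    (\<forall>a. \<forall>m\<in>carrier (ob M a). free_ext R M snd a (g a m) = m)"
proof -
  have M: "persistence_module R M" using assms by (rule projective_persistence_module)
  interpret R: ring R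
    using pm_left_module[OF M] by (auto simp: left_module_def)
  define j where "j a m = (\<lambda>i. if i = (a, m) then \<one>\<^bsub>R\<^esub> else \<zero>\<^bsub>R\<^esub>)" for a :: 'b and m :: 'c
  have inj: "inj_on (j a) (carrier (ob M a))" for a
  proof (rule inj_onI)
    interpret A: left_module R "ob M a" using M by (rule pm_left_module)
    fix m m' assume m: "m \<in> carrier (ob M a)" "m' \<in> carrier (ob M a)" and eq: "j a m = j a m'"
    show "m = m'"
    \<comment> \<open>Over the zero ring all indicator functions coincide, but then every module is
      zero and injectivity is trivial.\<close>
    proof (cases "\<one>\<^bsub>R\<^esub> = \<zero>\<^bsub>R\<^esub>")
      case True
      then show ?thesis using m A.smult_one A.smult_l_null by metis
    next
      case False
      then show ?thesis using fun_cong[OF eq, of "(a, m)"] by (auto simp: j_def split: if_splits)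
    qed
  qed
  define k where "k a = inv_into (carrier (ob M a)) (j a)" for a
  have k: "k a (j a m) = m" if "m \<in> carrier (ob M a)" for a m
    using inj that by (simp add: k_def)
  define N :: "('b, 'a, 'b \<times> 'c \<Rightarrow> 'a) pmod" where
    "N = \<lparr>ob = \<lambda>a. \<lparr>carrier = j a ` carrier (ob M a), mult = undefined, one = undefined,
        zero = j a \<zero>\<^bsub>ob M a\<^esub>, add = \<lambda>u v. j a (k a u \<oplus>\<^bsub>ob M a\<^esub> k a v),
        smult = \<lambda>r u. j a (r \<odot>\<^bsub>ob M a\<^esub> k a u)\<rparr>,
      tr = \<lambda>a b u. j b (tr M a b (k a u))\<rparr>"
  have j: "natural_on R UNIV M N j"
    by (rule natural_onI) (auto simp: N_def k)
  have N: "persistence_module R N"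
    using M _ _ j by (rule persistence_module_surj_image) (simp_all add: N_def)
  interpret ev: free_extension R M M snd
    using M by unfold_locales auto
  let ?ev = "free_ext R M snd :: _ \<Rightarrow> ('b \<times> 'c \<Rightarrow> 'a) \<Rightarrow> _"
  let ?e = "\<lambda>x \<phi>. j x (?ev x \<phi>)"
  let ?F = "free_pmod R M"
  have F: "persistence_module R ?F" using R.ring_axioms by (rule persistence_module_free)
  have e: "natural_on R UNIV ?F N ?e"
    using ev.natural_on_free_ext j by (rule natural_on_comp)
  have surj: "?e a ` carrier (ob ?F a) = carrier (ob N a)" for a
  proof (intro equalityI subsetI)
    fix u assume "u \<in> carrier (ob N a)"
    then obtain m where m: "m \<in> carrier (ob M a)" "u = j a m" by (auto simp: N_def)
    then have "u = ?e a (j a m)" "j a m \<in> carrier (ob ?F a)"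
      using ev.free_ext_generator[OF m(1)] by (auto simp: j_def)
    then show "u \<in> ?e a ` carrier (ob ?F a)" by (rule image_eqI)
  qed (use natural_on_closed[OF e] in auto)
  have "\<exists>g\<in>pmod_hom R M ?F. \<forall>a. \<forall>m\<in>carrier (ob M a).
      extend UNIV ?F ?e a (g a m) = extend UNIV M j a m"
  proof -
    have "extend UNIV ?F ?e a ` carrier (ob ?F a) = carrier (ob N a)" for a
      unfolding surj[symmetric] by (rule image_cong) simp_all
    then show ?thesis
      using assms F N natural_on_nat_trans[OF F e] natural_on_nat_trans[OF M j]
      unfolding projective_def by blast
  qed
  then obtain g where g: "g \<in> pmod_hom R M ?F"
    "\<And>a m. m \<in> carrier (ob M a) \<Longrightarrow> extend UNIV ?F ?e a (g a m) = extend UNIV M j a m"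
    by blast
  have nat: "natural_on R UNIV M ?F g" using g(1) by (rule nat_trans_natural_on)
  show ?thesis
  proof (intro exI conjI allI ballI)
    fix a m assume m: "m \<in> carrier (ob M a)"
    then have "j a (?ev a (g a m)) = j a m" 
      using g(2)[OF m] natural_on_closed[OF nat _ m] by simp
    then show "?ev a (g a m) = m"
      using m inj natural_on_closed[OF ev.natural_on_free_ext UNIV_I natural_on_closed[OF nat UNIV_I m]]
      by (meson inj_onD)
  qed (rule nat)
qed

text \<open>A preimage of \<open>f a m\<close> is chosen for each generator (a, m) of the free
  module; the resulting map is precomposed with the section of the evaluation map. Surjectivity of
  \<open>e\<close> is weakened to a condition on the image of \<open>f\<close>, so that a
  differential can serve as \<open>e\<close> without cutting its target down to the
  boundaries.\<close>

lemma projective_lift: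
  assumes P: "projective R M" and X: "persistence_module R X" and Y: "persistence_module R Y"
    and e: "natural_on R UNIV X Y e" and f: "natural_on R UNIV M Y f"
    and im: "\<And>a m. m \<in> carrier (ob M a) \<Longrightarrow> f a m \<in> e a ` carrier (ob X a)"
  shows "\<exists>g. natural_on R UNIV M X g \<and> (\<forall>a. \<forall>m\<in>carrier (ob M a). e a (g a m) = f a m)"
proof -
  have M: "persistence_module R M" using P by (rule projective_persistence_module)
  obtain s where s: "natural_on R UNIV M (free_pmod R M) s"
    "\<And>a m. m \<in> carrier (ob M a) \<Longrightarrow> free_ext R M snd a (s a m) = m"
    using projective_retract_of_free[OF P] by blast
  define c where "c = (\<lambda>(a, m). SOME u. u \<in> carrier (ob X a) \<and> e a u = f a m)"
  have c: "c (a, m) \<in> carrier (ob X a) \<and> e a (c (a, m)) = f a m" if "m \<in> carrier (ob M a)" for a m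
  proof -
    have "\<exists>u. u \<in> carrier (ob X a) \<and> e a u = f a m"
      using im[OF that] unfolding image_iff by metis
    then show ?thesis
      unfolding c_def split by (rule someI_ex)
  qed
  interpret X: free_extension R M X c
    by (intro free_extension.intro X) (use c in blast)
  interpret ev: free_extension R M M snd
    using M by unfold_locales auto
  show ?thesis
  proof (intro exI conjI allI ballI)
    show "natural_on R UNIV M X (\<lambda>a m. free_ext R X c a (s a m))"
      using s(1) X.natural_on_free_ext by (rule natural_on_comp)
    fix a m assume m: "m \<in> carrier (ob M a)"
    have sm: "s a m \<in> carrier (ob (free_pmod R M) a)"
      using s(1) m by (simp add: natural_on_closed)
    \<comment> \<open>Both e o (extension of \<open>c\<close>) and f o (evaluation) take these
      values on generators, so they agree on the free module.\<close>
    let ?c' = "\<lambda>(a, m). f a m"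
    have "e a (free_ext R X c a (s a m)) = free_ext R Y ?c' a (s a m)"
      using c by (intro X.free_ext_comp Y e sm) auto
    also have "\<dots> = f a (free_ext R M snd a (s a m))"
      by (intro ev.free_ext_comp[symmetric] Y f sm) auto
    also have "\<dots> = f a m" using m by (simp add: s)
    finally show "e a (free_ext R X c a (s a m)) = f a m" .
  qed
qed

section \<open>Cohomology classes\<close>

locale cochain_complex =
  fixes C :: "int \<Rightarrow> ('p::preorder, 'g) pgroup" and \<delta> :: "int \<Rightarrow> 'p \<Rightarrow> 'g \<Rightarrow> 'g"
  assumes group_C: "persistence_group (C n)"
    and hom_\<delta>: "pgroup_hom (C n) (C (n + 1)) (\<delta> n)"
    and \<delta>_\<delta>: "x \<in> carrier (ob (C n) a) \<Longrightarrow> \<delta> (n + 1) a (\<delta> n a x) = \<one>\<^bsub>ob (C (n + 1 + 1)) a\<^esub>"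
begin

definition cocycles :: "int \<Rightarrow> 'p \<Rightarrow> 'g set" where
  "cocycles n a = {x \<in> carrier (ob (C n) a). \<delta> n a x = \<one>\<^bsub>ob (C (n + 1)) a\<^esub>}"

text \<open>The coset is formed in the whole cochain group and not in the subgroup of cocycles. For
  a cocycle the resulting set is the same, and no change of carrier is needed when classes are
  compared.\<close>

definition cls :: "int \<Rightarrow> 'p \<Rightarrow> 'g \<Rightarrow> 'g set" where
  "cls n a x = cobound C \<delta> n a #>\<^bsub>ob (C n) a\<^esub> x"

lemma comm_group_C: "comm_group (ob (C n) a)"
  using group_C by (simp add: persistence_group_def)

lemma group_hom_\<delta>: "group_hom (ob (C n) a) (ob (C (n + 1)) a) (\<delta> n a)"
  using comm_group_C hom_\<delta>
  by (simp add: group_hom_def group_hom_axioms_def pgroup_hom_def comm_group_def)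

lemma kernel_eq_cocycles: "kernel (ob (C n) a) (ob (C (n + 1)) a) (\<delta> n a) = cocycles n a"
  by (simp add: kernel_def cocycles_def)

lemma subgroup_cocycles: "subgroup (cocycles n a) (ob (C n) a)"
  using group_hom.subgroup_kernel[OF group_hom_\<delta>] by (simp add: kernel_eq_cocycles)

lemma subgroup_cobound: "subgroup (cobound C \<delta> n a) (ob (C n) a)"
  using group_hom.img_is_subgroup[OF group_hom_\<delta>, of "n - 1" a] by (simp add: cobound_def)

lemma cobound_subset_cocycles: "cobound C \<delta> n a \<subseteq> cocycles n a"
proof
  fix x assume "x \<in> cobound C \<delta> n a"
  then obtain y where y: "y \<in> carrier (ob (C (n - 1)) a)" "x = \<delta> (n - 1) a y"
    by (auto simp: cobound_def)
  then show "x \<in> cocycles n a"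
    using \<delta>_\<delta>[OF y(1)] group_hom.hom_closed[OF group_hom_\<delta> y(1)]
    by (simp add: cocycles_def)
qed

lemma comm_group_cocycles: "comm_group ((ob (C n) a)\<lparr>carrier := cocycles n a\<rparr>)"
proof -
  interpret comm_group "ob (C n) a" by (rule comm_group_C)
  show ?thesis
    using subgroup_imp_group[OF subgroup_cocycles]
    by (rule group.group_comm_groupI) (simp add: cocycles_def m_comm)
qed

lemma subgroup_cobound_cocycles: "subgroup (cobound C \<delta> n a) ((ob (C n) a)\<lparr>carrier := cocycles n a\<rparr>)"
  using comm_group.axioms(2)[OF comm_group_C] subgroup_cobound subgroup_cocycles cobound_subset_cocycles
  by (rule group.subgroup_incl)

lemma ob_cohomology:
  "ob (cohomology C \<delta> n) a = (ob (C n) a)\<lparr>carrier := cocycles n a\<rparr> Mod cobound C \<delta> n a"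
  by (simp add: cohomology_def kernel_eq_cocycles)

lemma comm_group_cohomology: "comm_group (ob (cohomology C \<delta> n) a)"
  unfolding ob_cohomology
  by (rule comm_group.abelian_FactGroup[OF comm_group_cocycles subgroup_cobound_cocycles])

lemma carrier_cohomology: "carrier (ob (cohomology C \<delta> n) a) = cls n a ` cocycles n a"
  by (simp add: ob_cohomology carrier_FactGroup cls_def image_def r_coset_def)

lemma cls_mult:
  assumes "x \<in> cocycles n a" "y \<in> cocycles n a"
  shows "cls n a x \<otimes>\<^bsub>ob (cohomology C \<delta> n) a\<^esub> cls n a y = cls n a (x \<otimes>\<^bsub>ob (C n) a\<^esub> y)"
proof -
  interpret normal "cobound C \<delta> n a" "(ob (C n) a)\<lparr>carrier := cocycles n a\<rparr>"
    using comm_group.subgroup_imp_normal[OF comm_group_cocycles subgroup_cobound_cocycles] .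
  show ?thesis
    using rcos_sum[of x y] assms by (simp add: ob_cohomology cls_def)
qed

lemma cls_eq_iff:
  assumes "x \<in> carrier (ob (C n) a)" "y \<in> carrier (ob (C n) a)"
  shows "cls n a x = cls n a y \<longleftrightarrow>
    (\<exists>k\<in>carrier (ob (C (n - 1)) a). x = \<delta> (n - 1) a k \<otimes>\<^bsub>ob (C n) a\<^esub> y)"
proof -
  interpret comm_group "ob (C n) a" by (rule comm_group_C)
  have "cls n a x = cls n a y \<longleftrightarrow> x \<in> cls n a y"
    unfolding cls_def using assms subgroup_cobound by (metis rcos_self repr_independence)
  then show ?thesis
    by (auto simp: cls_def r_coset_def cobound_def)
qed

lemma cls_one_iff:
  assumes "x \<in> carrier (ob (C n) a)"
  shows "cls n a x = \<one>\<^bsub>ob (cohomology C \<delta> n) a\<^esub> \<longleftrightarrow>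
    (\<exists>k\<in>carrier (ob (C (n - 1)) a). x = \<delta> (n - 1) a k)"
proof -
  interpret comm_group "ob (C n) a" by (rule comm_group_C)
  interpret D: group_hom "ob (C (n - 1)) a" "ob (C n) a" "\<delta> (n - 1) a"
    using group_hom_\<delta>[of "n - 1" a] by simp
  have "\<one>\<^bsub>ob (cohomology C \<delta> n) a\<^esub> = cls n a \<one>\<^bsub>ob (C n) a\<^esub>"
    using subgroup.subset[OF subgroup_cobound] by (simp add: ob_cohomology cls_def coset_mult_one)
  then show ?thesis
    using cls_eq_iff[OF assms one_closed] by auto
qed

lemma mem_cls_self: "x \<in> carrier (ob (C n) a) \<Longrightarrow> x \<in> cls n a x"
  unfolding cls_def using comm_group_C subgroup_cobound by (meson group.rcos_self comm_group_def)

lemma mem_cls_iff: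
  "x \<in> cls n a y \<longleftrightarrow> (\<exists>k\<in>carrier (ob (C (n - 1)) a). x = \<delta> (n - 1) a k \<otimes>\<^bsub>ob (C n) a\<^esub> y)"
  by (auto simp: cls_def r_coset_def cobound_def)

lemma tr_\<delta>:
  "a \<le> b \<Longrightarrow> x \<in> carrier (ob (C n) a) \<Longrightarrow> \<delta> n b (tr (C n) a b x) = tr (C (n + 1)) a b (\<delta> n a x)"
  using hom_\<delta> by (simp add: pgroup_hom_def)

lemma tr_group_hom: "a \<le> b \<Longrightarrow> group_hom (ob (C n) a) (ob (C n) b) (tr (C n) a b)"
  using group_C[of n] unfolding persistence_group_def group_hom_def group_hom_axioms_def comm_group_def
  by blast

lemma tr_cocycles:
  assumes "a \<le> b" "x \<in> cocycles n a"
  shows "tr (C n) a b x \<in> cocycles n b"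
  using assms group_hom.hom_closed[OF tr_group_hom] group_hom.hom_one[OF tr_group_hom]
  by (simp add: cocycles_def tr_\<delta>)

text \<open>Transition maps commute with the differentials and so preserve coboundaries, which is
  the condition for \<open>coset_map\<close> to act on representatives.\<close>

lemma tr_cls:
  assumes "a \<le> b" "x \<in> carrier (ob (C n) a)"
  shows "tr (cohomology C \<delta> n) a b (cls n a x) = cls n b (tr (C n) a b x)"
proof -
  interpret B: comm_group "ob (C n) b" by (rule comm_group_C)
  interpret t: group_hom "ob (C n) a" "ob (C n) b" "tr (C n) a b" using assms(1) by (rule tr_group_hom)
  have "coset_map (ob (C n) b) (cobound C \<delta> n b) (tr (C n) a b) (cls n a x) = cls n b (tr (C n) a b x)"
    unfolding cls_def
  proof (rule coset_map_r_coset)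
    fix c assume "c \<in> cobound C \<delta> n a"
    then obtain k where k: "k \<in> carrier (ob (C (n - 1)) a)" "c = \<delta> (n - 1) a k" by (auto simp: cobound_def)
    then have "c \<in> carrier (ob (C n) a)"
      using group_hom.hom_closed[OF group_hom_\<delta> k(1)] by simp
    then show "tr (C n) a b (c \<otimes>\<^bsub>ob (C n) a\<^esub> x) = tr (C n) a b c \<otimes>\<^bsub>ob (C n) b\<^esub> tr (C n) a b x"
      using assms by simp
    show "tr (C n) a b c \<in> cobound C \<delta> n b"
      using tr_\<delta>[OF assms(1) k(1)] group_hom.hom_closed[OF tr_group_hom[OF assms(1)] k(1)]
      by (auto simp: cobound_def k(2) intro!: image_eqI[OF sym])
  qed (use subgroup_cobound B.is_group assms subgroup.one_closed[OF subgroup_cobound[of n a]] in auto)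
  then show ?thesis
    by (simp add: cohomology_def)
qed

lemma persistence_group_cohomology: "persistence_group (cohomology C \<delta> n)"
proof -
  have closed: "\<And>x a. x \<in> cocycles n a \<Longrightarrow> x \<in> carrier (ob (C n) a)" by (simp add: cocycles_def)
  have tr_id: "tr (C n) a a x = x" if "x \<in> carrier (ob (C n) a)" for a x
    using group_C[of n] that by (simp add: persistence_group_def)
  have tr_tr: "tr (C n) b c (tr (C n) a b x) = tr (C n) a c x"
    if "a \<le> b" "b \<le> c" "x \<in> carrier (ob (C n) a)" for a b c x
    using group_C[of n] that by (simp add: persistence_group_def)
  have mult: "x \<otimes>\<^bsub>ob (C n) a\<^esub> y \<in> cocycles n a" if "x \<in> cocycles n a" "y \<in> cocycles n a" for x y a
    using subgroup.m_closed[OF subgroup_cocycles that] .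
  have "tr (cohomology C \<delta> n) a b \<in> hom (ob (cohomology C \<delta> n) a) (ob (cohomology C \<delta> n) b)"
    if "a \<le> b" for a b
  proof -
    interpret t: group_hom "ob (C n) a" "ob (C n) b" "tr (C n) a b" using that by (rule tr_group_hom)
    show ?thesis
      using that closed mult
      by (auto simp: hom_def carrier_cohomology tr_cls tr_cocycles cls_mult)
  qed
  moreover have "tr (cohomology C \<delta> n) b c (tr (cohomology C \<delta> n) a b (cls n a x))
      = tr (cohomology C \<delta> n) a c (cls n a x)"
    if "a \<le> b" "b \<le> c" "x \<in> cocycles n a" for a b c x
    using that closed tr_cocycles[OF that(1,3)] order_trans[OF that(1,2)] by (simp add: tr_cls tr_tr)
  ultimately show ?thesis
    unfolding persistence_group_def
    by (auto simp: comm_group_cohomology carrier_cohomology tr_cls tr_id closed)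
qed

end

section \<open>The groups of natural transformations\<close>

lemma one_hom_group: "\<one>\<^bsub>hom_group R U M N\<^esub> = extend U M (\<lambda>x m. \<zero>\<^bsub>ob N x\<^esub>)"
  and mult_hom_group: "f \<otimes>\<^bsub>hom_group R U M N\<^esub> g = extend U M (\<lambda>x m. f x m \<oplus>\<^bsub>ob N x\<^esub> g x m)"
  and carrier_hom_group: "carrier (hom_group R U M N) = nat_trans R U M N"
  by (simp_all add: hom_group_def extend_def)

lemma comm_group_hom_group:
  assumes M: "persistence_module R M" and N: "persistence_module R N"
  shows "comm_group (hom_group R U M N)"
proof (rule comm_groupI)
  note nt = nat_trans_natural_on[of _ R U M N]
  note ag = pm_abelian_group[OF N]
  have cl: "f x m \<in> carrier (ob N x)" if "f \<in> nat_trans R U M N" "x \<in> U" "m \<in> carrier (ob M x)" for f x m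
    using nt[OF that(1)] that by (simp add: natural_on_closed)
  show mult: "f \<otimes>\<^bsub>hom_group R U M N\<^esub> g \<in> carrier (hom_group R U M N)"
    if "f \<in> carrier (hom_group R U M N)" "g \<in> carrier (hom_group R U M N)" for f g
    using that by (simp add: carrier_hom_group mult_hom_group natural_on_nat_trans natural_on_plus M N nt)
  show one: "\<one>\<^bsub>hom_group R U M N\<^esub> \<in> carrier (hom_group R U M N)"
    by (simp add: carrier_hom_group one_hom_group natural_on_nat_trans natural_on_null M N)
  show "f \<otimes>\<^bsub>hom_group R U M N\<^esub> g \<otimes>\<^bsub>hom_group R U M N\<^esub> k =
      f \<otimes>\<^bsub>hom_group R U M N\<^esub> (g \<otimes>\<^bsub>hom_group R U M N\<^esub> k)"
    if "f \<in> carrier (hom_group R U M N)" "g \<in> carrier (hom_group R U M N)"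
      "k \<in> carrier (hom_group R U M N)" for f g k
    using that cl by (simp add: carrier_hom_group mult_hom_group abelian_groupE(4)[OF ag] cong: extend_cong)
      (auto intro!: extend_cong simp: abelian_groupE(3)[OF ag])
  show "f \<otimes>\<^bsub>hom_group R U M N\<^esub> g = g \<otimes>\<^bsub>hom_group R U M N\<^esub> f"
    if "f \<in> carrier (hom_group R U M N)" "g \<in> carrier (hom_group R U M N)" for f g
    using that cl by (auto simp: carrier_hom_group mult_hom_group abelian_groupE(4)[OF ag] intro!: extend_cong)
  show "\<one>\<^bsub>hom_group R U M N\<^esub> \<otimes>\<^bsub>hom_group R U M N\<^esub> f = f"
    if "f \<in> carrier (hom_group R U M N)" for f
  proof -
    have "\<one>\<^bsub>hom_group R U M N\<^esub> \<otimes>\<^bsub>hom_group R U M N\<^esub> f = extend U M f"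
      using that cl
      by (auto simp: carrier_hom_group mult_hom_group one_hom_group abelian_groupE(5)[OF ag] intro!: extend_cong)
    then show ?thesis using that by (simp add: carrier_hom_group extend_nat_trans)
  qed
  show "\<exists>g\<in>carrier (hom_group R U M N). g \<otimes>\<^bsub>hom_group R U M N\<^esub> f = \<one>\<^bsub>hom_group R U M N\<^esub>"
    if "f \<in> carrier (hom_group R U M N)" for f
  proof
    let ?g = "extend U M (\<lambda>x m. \<ominus>\<^bsub>ob N x\<^esub> f x m)"
    show "?g \<in> carrier (hom_group R U M N)"
      using that by (simp add: carrier_hom_group natural_on_nat_trans natural_on_neg M N nt)
    show "?g \<otimes>\<^bsub>hom_group R U M N\<^esub> f = \<one>\<^bsub>hom_group R U M N\<^esub>"
      using that cl
      by (auto simp: carrier_hom_group mult_hom_group one_hom_group intro!: extend_cong abelian_group.l_neg[OF ag])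
  qed
qed

text \<open>
  Both internal homs are, at \<open>s\<close>, the natural transformations over \<^term>\<open>hom_dom h s\<close> into the
  following module, and \<open>target_tr\<close> induces their transition maps.
\<close>

definition hom_target :: "hom_kind \<Rightarrow> 'p::preordered_ab_group_add \<Rightarrow> ('p, 'r, 'n) pmod \<Rightarrow> ('p, 'r, 'n) pmod" where
  "hom_target h s A = (case h of Sh \<Rightarrow> A | Gr \<Rightarrow> shift s A)"

definition target_map :: "hom_kind \<Rightarrow> 'p::preordered_ab_group_add \<Rightarrow> ('p \<Rightarrow> 'n \<Rightarrow> 'n2) \<Rightarrow> 'p \<Rightarrow> 'n \<Rightarrow> 'n2" where
  "target_map h s \<alpha> x = (case h of Sh \<Rightarrow> \<alpha> x | Gr \<Rightarrow> \<alpha> (s + x))"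

definition target_tr ::
  "hom_kind \<Rightarrow> ('p::preordered_ab_group_add, 'r, 'n) pmod \<Rightarrow> 'p \<Rightarrow> 'p \<Rightarrow> 'p \<Rightarrow> 'n \<Rightarrow> 'n" where
  "target_tr h A s t x u = (case h of Sh \<Rightarrow> u | Gr \<Rightarrow> tr A (s + x) (t + x) u)"

lemma add_left_compat: "a \<le> b \<Longrightarrow> c + a \<le> c + b" for a b c :: "'p::preordered_ab_group_add"
  using add_right_compat[of a b c] by (simp add: add.commute)

lemma target_map_id [simp]: "target_map h s (\<lambda>x u. u) = (\<lambda>x u. u)"
  by (cases h) (auto simp: target_map_def)

lemma persistence_module_hom_target:
  assumes "persistence_module R A"
  shows "persistence_module R (hom_target h s A)"
proof (cases h)
  case Gr
  have "persistence_module R (shift s A)"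
    using assms unfolding persistence_module_iff shift_def by (simp add: add_left_compat)
  then show ?thesis by (simp add: Gr hom_target_def)
qed (simp add: hom_target_def assms)

lemma natural_on_target_map:
  assumes "natural_on R UNIV A A' \<alpha>"
  shows "natural_on R U (hom_target h s A) (hom_target h s A') (target_map h s \<alpha>)"
proof (cases h)
  case Sh
  then show ?thesis
    using natural_on_mono[OF assms, of U] by (simp add: hom_target_def target_map_def[abs_def])
next
  case Gr
  show ?thesis
    by (rule natural_onI)
      (simp_all add: Gr hom_target_def target_map_def shift_def natural_on_closed[OF assms]
        natural_on_add[OF assms] natural_on_smult[OF assms] natural_on_tr[OF assms] add_left_compat)
qed

text \<open>In the graded case both ways around the naturality square are the transition map of
  \<open>A\<close> from s + x to t + y. Its two factorizations need monotonicity of addition in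
  either summand. In the sheaf case the map is the identity.\<close>

lemma natural_on_target_tr:
  assumes A: "persistence_module R A" and st: "s \<le> t"
  shows "natural_on R U (hom_target h s A) (hom_target h t A) (target_tr h A s t)"
proof (cases h)
  case Sh
  then show ?thesis
    using natural_on_ident[of R U A] by (simp add: hom_target_def target_tr_def[abs_def])
next
  case Gr
  show ?thesis
    by (rule natural_onI)
      (simp_all add: Gr hom_target_def target_tr_def shift_def pm_tr_closed[OF A] pm_tr_add[OF A]
        pm_tr_smult[OF A] pm_tr_tr[OF A] add_left_compat add_right_compat st)
qed

lemma hom_dom_mono: "s \<le> t \<Longrightarrow> hom_dom h t \<subseteq> hom_dom h s"
  by (cases h) (auto intro: order_trans)

lemma ob_Hom: "ob (Hom h R M A) s = hom_group R (hom_dom h s) M (hom_target h s A)"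
  by (cases h) (simp_all add: hom_target_def)

lemma carrier_Hom: "carrier (ob (Hom h R M A) s) = nat_trans R (hom_dom h s) M (hom_target h s A)"
  by (simp add: ob_Hom carrier_hom_group)

lemma Hom_map_eq:
  "Hom_map h M' \<phi> \<alpha> s f = extend (hom_dom h s) M' (\<lambda>x m. target_map h s \<alpha> x (f x (\<phi> x m)))"
  by (cases h) (simp_all add: Hom_map_def extend_def target_map_def)

text \<open>One formula for both kinds. In the sheaf case the library \<open>restrict\<close> only
  cuts down the set of points; that the components are already extensional follows from membership
  in \<open>nat_trans\<close>.\<close>

lemma tr_Hom:
  assumes st: "s \<le> t" and f: "f \<in> nat_trans R (hom_dom h s) M (hom_target h s A)"
  shows "tr (Hom h R M A) s t f = extend (hom_dom h t) M (\<lambda>x m. target_tr h A s t x (f x m))"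
proof (cases h)
  case Sh
  have "f x = (\<lambda>m\<in>carrier (ob M x). f x m)" if "x \<in> hom_dom h t" for x
    using fun_cong[OF extend_nat_trans[OF f], of x] that hom_dom_mono[OF st, of h]
    by (simp add: extend_def subset_iff)
  then have "restrict f (hom_dom h t) = extend (hom_dom h t) M f"
    unfolding extend_def by (rule restrict_ext)
  then show ?thesis
    by (simp add: Sh target_tr_def[abs_def])
qed (simp add: extend_def target_tr_def)

lemma natural_on_tr_Hom:
  assumes A: "persistence_module R A" and st: "s \<le> t"
    and f: "f \<in> nat_trans R (hom_dom h s) M (hom_target h s A)"
  shows "natural_on R (hom_dom h t) M (hom_target h t A) (\<lambda>x m. target_tr h A s t x (f x m))"
  using natural_on_mono[OF nat_trans_natural_on[OF f] hom_dom_mono[OF st]] natural_on_target_tr[OF A st]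
  by (rule natural_on_comp)

lemma target_tr_id:
  "persistence_module R A \<Longrightarrow> u \<in> carrier (ob (hom_target h s A) x) \<Longrightarrow> target_tr h A s s x u = u"
  by (cases h) (auto simp: target_tr_def hom_target_def shift_def pm_tr_id)

lemma target_tr_tr:
  "persistence_module R A \<Longrightarrow> s \<le> t \<Longrightarrow> t \<le> v \<Longrightarrow> u \<in> carrier (ob (hom_target h s A) x) \<Longrightarrow>
    target_tr h A t v x (target_tr h A s t x u) = target_tr h A s v x u"
  by (cases h) (auto simp: target_tr_def hom_target_def shift_def add_right_compat pm_tr_tr)

lemma target_map_tr:
  "natural_on R UNIV A A' \<alpha> \<Longrightarrow> s \<le> t \<Longrightarrow> u \<in> carrier (ob (hom_target h s A) x) \<Longrightarrow>
    target_map h t \<alpha> x (target_tr h A s t x u) = target_tr h A' s t x (target_map h s \<alpha> x u)"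
  by (cases h) (auto simp: target_tr_def hom_target_def target_map_def shift_def add_right_compat natural_on_tr)

lemma persistence_group_Hom:
  assumes M: "persistence_module R M" and A: "persistence_module R A"
  shows "persistence_group (Hom h R M A)"
  unfolding persistence_group_def
proof (intro conjI allI impI ballI)
  fix s t v f
  note T = persistence_module_hom_target[OF A]
  show "comm_group (ob (Hom h R M A) s)"
    unfolding ob_Hom by (rule comm_group_hom_group[OF M T])
  have cl: "f x m \<in> carrier (ob (hom_target h s A) x)"
    if "f \<in> carrier (ob (Hom h R M A) s)" "x \<in> hom_dom h s" "m \<in> carrier (ob M x)" for f x m s
    using that nat_trans_natural_on natural_on_closed by (metis carrier_Hom)
  show "tr (Hom h R M A) s s f = f" if f: "f \<in> carrier (ob (Hom h R M A) s)"
  proof -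
    have "tr (Hom h R M A) s s f = extend (hom_dom h s) M f"
      using f cl[OF f] by (auto simp: carrier_Hom tr_Hom target_tr_id[OF A] intro!: extend_cong)
    then show ?thesis using f by (simp add: carrier_Hom extend_nat_trans)
  qed
  have tr_closed: "tr (Hom h R M A) s t f \<in> carrier (ob (Hom h R M A) t)"
    if "s \<le> t" "f \<in> carrier (ob (Hom h R M A) s)" for s t f
    using that by (simp add: carrier_Hom tr_Hom natural_on_nat_trans[OF M] natural_on_tr_Hom[OF A])
  show "tr (Hom h R M A) s t \<in> hom (ob (Hom h R M A) s) (ob (Hom h R M A) t)" if st: "s \<le> t"
  proof (rule homI)
    fix f g assume f: "f \<in> carrier (ob (Hom h R M A) s)" and g: "g \<in> carrier (ob (Hom h R M A) s)"
    have "f \<otimes>\<^bsub>ob (Hom h R M A) s\<^esub> g \<in> carrier (ob (Hom h R M A) s)"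
      using f g comm_group_hom_group[OF M T] unfolding ob_Hom
      by (meson comm_group_def group.is_monoid monoid.m_closed)
    then have fg: "f \<otimes>\<^bsub>ob (Hom h R M A) s\<^esub> g \<in> nat_trans R (hom_dom h s) M (hom_target h s A)"
      by (simp add: carrier_Hom)
    show "tr (Hom h R M A) s t (f \<otimes>\<^bsub>ob (Hom h R M A) s\<^esub> g) =
        tr (Hom h R M A) s t f \<otimes>\<^bsub>ob (Hom h R M A) t\<^esub> tr (Hom h R M A) s t g"
      using f g hom_dom_mono[OF st, of h] natural_on_add[OF natural_on_target_tr[OF A st], of _ UNIV]
      unfolding tr_Hom[OF st fg] tr_Hom[OF st f[unfolded carrier_Hom]] tr_Hom[OF st g[unfolded carrier_Hom]]
      by (auto simp: ob_Hom mult_hom_group subset_iff cl[OF f] cl[OF g] intro!: extend_cong)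
  qed (use tr_closed st in blast)
  show "tr (Hom h R M A) t v (tr (Hom h R M A) s t f) = tr (Hom h R M A) s v f"
    if st: "s \<le> t" and tv: "t \<le> v" and f: "f \<in> carrier (ob (Hom h R M A) s)"
    using f tr_closed[OF st f] order_trans[OF st tv] hom_dom_mono[OF st, of h] hom_dom_mono[OF tv, of h] cl[OF f]
    by (auto simp: carrier_Hom tr_Hom st tv target_tr_tr[OF A st tv] subset_iff intro!: extend_cong)
qed

section \<open>Cochain complexes of homs\<close>

lemma extend_eq_extend_iff:
  "extend U M f = extend U M g \<longleftrightarrow> (\<forall>x\<in>U. \<forall>m\<in>carrier (ob M x). f x m = g x m)"
proof
  assume eq: "extend U M f = extend U M g"
  show "\<forall>x\<in>U. \<forall>m\<in>carrier (ob M x). f x m = g x m"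
  proof (intro ballI)
    fix x m assume "x \<in> U" "m \<in> carrier (ob M x)"
    then show "f x m = g x m" using fun_cong[OF fun_cong[OF eq], of x m] by simp
  qed
qed (rule extend_cong, blast)

lemma extend_eq_iff:
  assumes "c \<in> nat_trans R U M N"
  shows "c = extend U M g \<longleftrightarrow> (\<forall>x\<in>U. \<forall>m\<in>carrier (ob M x). c x m = g x m)"
  using extend_eq_extend_iff[of U M c g] by (simp add: extend_nat_trans[OF assms])

lemma
  assumes "is_complex R K"
  shows complex_pm: "persistence_module R (trm K n)"
    and complex_diff: "natural_on R UNIV (trm K n) (trm K (n - 1)) (diff K n)"
    and complex_dd: "m \<in> carrier (ob (trm K n) a) \<Longrightarrow>
      diff K (n - 1) a (diff K n a m) = \<zero>\<^bsub>ob (trm K (n - 1 - 1)) a\<^esub>"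
  using assms unfolding is_complex_def by (auto intro: nat_trans_natural_on)

lemma complex_diff_Suc:
  "is_complex R K \<Longrightarrow> natural_on R UNIV (trm K (n + 1)) (trm K n) (diff K (n + 1))"
  using complex_diff[of R K "n + 1"] by simp

lemma complex_dd_Suc:
  "is_complex R K \<Longrightarrow> m \<in> carrier (ob (trm K (n + 1)) a) \<Longrightarrow>
    diff K n a (diff K (n + 1) a m) = \<zero>\<^bsub>ob (trm K (n - 1)) a\<^esub>"
  using complex_dd[of R K m "n + 1" a] by simp

lemma natural_on_Hom_map:
  assumes f: "natural_on R (hom_dom h s) M (hom_target h s A) f"
    and \<phi>: "natural_on R UNIV M' M \<phi>" and \<alpha>: "natural_on R UNIV A A' \<alpha>"
  shows "natural_on R (hom_dom h s) M' (hom_target h s A') (\<lambda>x m. target_map h s \<alpha> x (f x (\<phi> x m)))"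
  by (rule natural_on_comp[OF natural_on_comp[OF natural_on_mono[OF \<phi> subset_UNIV] f] natural_on_target_map[OF \<alpha>]])

lemma pgroup_hom_Hom_map:
  assumes M': "persistence_module R M'" and A: "persistence_module R A"
    and \<phi>: "natural_on R UNIV M' M \<phi>" and \<alpha>: "natural_on R UNIV A A' \<alpha>"
  shows "pgroup_hom (Hom h R M A) (Hom h R M' A') (Hom_map h M' \<phi> \<alpha>)"
  unfolding pgroup_hom_def
proof (intro conjI allI impI ballI)
  fix s t f
  have closed: "Hom_map h M' \<phi> \<alpha> s f \<in> nat_trans R (hom_dom h s) M' (hom_target h s A')"
    if "f \<in> nat_trans R (hom_dom h s) M (hom_target h s A)" for f s
    unfolding Hom_map_eq
    using natural_on_Hom_map[OF nat_trans_natural_on[OF that] \<phi> \<alpha>] by (rule natural_on_nat_trans[OF M'])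
  have cl: "f x (\<phi> x m) \<in> carrier (ob (hom_target h s A) x)"
    if "f \<in> nat_trans R (hom_dom h s) M (hom_target h s A)" "x \<in> hom_dom h s" "m \<in> carrier (ob M' x)" for f x m s
    using natural_on_closed[OF nat_trans_natural_on[OF that(1)] that(2) natural_on_closed[OF \<phi> UNIV_I that(3)]] .
  show "Hom_map h M' \<phi> \<alpha> s \<in> hom (ob (Hom h R M A) s) (ob (Hom h R M' A') s)"
  proof (rule homI)
    fix f g assume "f \<in> carrier (ob (Hom h R M A) s)" "g \<in> carrier (ob (Hom h R M A) s)"
    then show "Hom_map h M' \<phi> \<alpha> s (f \<otimes>\<^bsub>ob (Hom h R M A) s\<^esub> g) =
        Hom_map h M' \<phi> \<alpha> s f \<otimes>\<^bsub>ob (Hom h R M' A') s\<^esub> Hom_map h M' \<phi> \<alpha> s g"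
      by (auto simp: carrier_hom_group ob_Hom Hom_map_eq mult_hom_group natural_on_closed[OF \<phi>] cl
          natural_on_add[OF natural_on_target_map[OF \<alpha>], of _ UNIV] intro!: extend_cong)
  qed (use closed in \<open>simp add: carrier_Hom\<close>)
  show "Hom_map h M' \<phi> \<alpha> t (tr (Hom h R M A) s t f) = tr (Hom h R M' A') s t (Hom_map h M' \<phi> \<alpha> s f)"
    if st: "s \<le> t" and f: "f \<in> carrier (ob (Hom h R M A) s)"
  proof -
    have f': "f \<in> nat_trans R (hom_dom h s) M (hom_target h s A)"
      using f by (simp add: carrier_Hom)
    show ?thesis
      unfolding tr_Hom[OF st f'] tr_Hom[OF st closed[OF f'], unfolded Hom_map_eq] Hom_map_eq
      using hom_dom_mono[OF st, of h] cl[OF f']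
      by (auto simp: natural_on_closed[OF \<phi>] target_map_tr[OF \<alpha> st] subset_iff intro!: extend_cong)
  qed
qed

abbreviation Hom_cls ::
  "hom_kind \<Rightarrow> 'r ring \<Rightarrow> ('p::preordered_ab_group_add, 'r, 'm) pcomplex \<Rightarrow> ('p, 'r, 'n) pmod \<Rightarrow>
    int \<Rightarrow> 'p \<Rightarrow> ('p \<Rightarrow> 'm \<Rightarrow> 'n) \<Rightarrow> ('p \<Rightarrow> 'm \<Rightarrow> 'n) set" where
  "Hom_cls h R K A \<equiv> cochain_complex.cls (Hom_cochains h R K A) (Hom_diff h K)"

locale hom_cochains =
  fixes h :: hom_kind and R :: "'r ring" and K :: "('p::preordered_ab_group_add, 'r, 'm) pcomplex"
    and A :: "('p, 'r, 'a) pmod"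
  assumes complex: "is_complex R K" and A: "persistence_module R A"
begin

lemma target: "persistence_module R (hom_target h s A)"
  using A by (rule persistence_module_hom_target)

lemma carrier_cochains:
  "carrier (ob (Hom_cochains h R K A n) s) = nat_trans R (hom_dom h s) (trm K n) (hom_target h s A)"
  by (simp add: Hom_cochains_def carrier_Hom)

lemma Hom_diff_eq: "Hom_diff h K n s f = extend (hom_dom h s) (trm K (n + 1)) (\<lambda>x m. f x (diff K (n + 1) x m))"
  by (simp add: Hom_diff_def Hom_map_eq)

lemma one_cochains: "\<one>\<^bsub>ob (Hom_cochains h R K A n) s\<^esub> =
    extend (hom_dom h s) (trm K n) (\<lambda>x m. \<zero>\<^bsub>ob (hom_target h s A) x\<^esub>)"
  by (simp add: Hom_cochains_def ob_Hom one_hom_group)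

lemma mult_cochains: "f \<otimes>\<^bsub>ob (Hom_cochains h R K A n) s\<^esub> g =
    extend (hom_dom h s) (trm K n) (\<lambda>x m. f x m \<oplus>\<^bsub>ob (hom_target h s A) x\<^esub> g x m)"
  by (simp add: Hom_cochains_def ob_Hom mult_hom_group)

sublocale cochain_complex "Hom_cochains h R K A" "Hom_diff h K"
proof
  fix n s f
  show "persistence_group (Hom_cochains h R K A n)"
    unfolding Hom_cochains_def by (rule persistence_group_Hom[OF complex_pm[OF complex] A])
  show "pgroup_hom (Hom_cochains h R K A n) (Hom_cochains h R K A (n + 1)) (Hom_diff h K n)"
    unfolding Hom_cochains_def Hom_diff_def
    by (rule pgroup_hom_Hom_map[OF complex_pm[OF complex] A complex_diff_Suc[OF complex] natural_on_ident])
  assume "f \<in> carrier (ob (Hom_cochains h R K A n) s)"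
  then have f: "natural_on R (hom_dom h s) (trm K n) (hom_target h s A) f"
    unfolding carrier_cochains by (rule nat_trans_natural_on)
  show "Hom_diff h K (n + 1) s (Hom_diff h K n s f) = \<one>\<^bsub>ob (Hom_cochains h R K A (n + 1 + 1)) s\<^esub>"
    unfolding Hom_diff_eq one_cochains
    using natural_on_closed[OF complex_diff_Suc[OF complex, of "n + 1"]] complex_dd_Suc[OF complex, of _ "n + 1"]
      natural_on_zero[OF complex_pm[OF complex] target f]
    by (auto intro!: extend_cong)
qed

lemma mem_cocycles_iff:
  "c \<in> cocycles n s \<longleftrightarrow> c \<in> nat_trans R (hom_dom h s) (trm K n) (hom_target h s A) \<and>
    (\<forall>x\<in>hom_dom h s. \<forall>m\<in>carrier (ob (trm K (n + 1)) x).
       c x (diff K (n + 1) x m) = \<zero>\<^bsub>ob (hom_target h s A) x\<^esub>)"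
  by (simp add: cocycles_def carrier_cochains Hom_diff_eq one_cochains extend_eq_extend_iff)

lemma coboundary_eq:
  "Hom_diff h K (n - 1) s k = extend (hom_dom h s) (trm K n) (\<lambda>x m. k x (diff K n x m))"
  by (simp add: Hom_diff_eq)

text \<open>Here the witness k is only \<open>natural_on\<close>, so that composites and differences
  of lifts can be supplied directly as cochains.\<close>

lemma cls_eq_iff_natural:
  assumes "c \<in> nat_trans R (hom_dom h s) (trm K n) (hom_target h s A)"
    "c' \<in> nat_trans R (hom_dom h s) (trm K n) (hom_target h s A)"
  shows "cls n s c = cls n s c' \<longleftrightarrow>
    (\<exists>k. natural_on R (hom_dom h s) (trm K (n - 1)) (hom_target h s A) k \<and>
       (\<forall>x\<in>hom_dom h s. \<forall>m\<in>carrier (ob (trm K n) x).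
          c x m = k x (diff K n x m) \<oplus>\<^bsub>ob (hom_target h s A) x\<^esub> c' x m))"
    (is "_ = ?R")
proof -
  let ?P = "\<lambda>k. \<forall>x\<in>hom_dom h s. \<forall>m\<in>carrier (ob (trm K n) x).
          c x m = k x (diff K n x m) \<oplus>\<^bsub>ob (hom_target h s A) x\<^esub> c' x m"
  have "cls n s c = cls n s c' \<longleftrightarrow>
    (\<exists>k\<in>nat_trans R (hom_dom h s) (trm K (n - 1)) (hom_target h s A). ?P k)"
    using assms by (subst cls_eq_iff) (simp_all add: carrier_cochains mult_cochains coboundary_eq extend_eq_iff)
  also have "\<dots> \<longleftrightarrow> ?R"
  proof
    assume ?R
    then obtain k where k: "natural_on R (hom_dom h s) (trm K (n - 1)) (hom_target h s A) k" "?P k" by blast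
    \<comment> \<open>Making k extensional does not change k o d, because d takes its values in the
      carriers.\<close>
    then have "?P (extend (hom_dom h s) (trm K (n - 1)) k)"
      using natural_on_closed[OF complex_diff[OF complex] UNIV_I] by simp
    then show "\<exists>k\<in>nat_trans R (hom_dom h s) (trm K (n - 1)) (hom_target h s A). ?P k"
      using natural_on_nat_trans[OF complex_pm[OF complex] k(1)] by blast
  qed (blast intro: nat_trans_natural_on)
  finally show ?thesis .
qed

lemma cls_one_iff_natural:
  assumes "c \<in> nat_trans R (hom_dom h s) (trm K n) (hom_target h s A)"
  shows "cls n s c = \<one>\<^bsub>ob (Hom_cohomology h R K A n) s\<^esub> \<longleftrightarrow>
    (\<exists>k. natural_on R (hom_dom h s) (trm K (n - 1)) (hom_target h s A) k \<and>
       (\<forall>x\<in>hom_dom h s. \<forall>m\<in>carrier (ob (trm K n) x). c x m = k x (diff K n x m)))"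
    (is "_ = ?R")
proof -
  let ?P = "\<lambda>k. \<forall>x\<in>hom_dom h s. \<forall>m\<in>carrier (ob (trm K n) x). c x m = k x (diff K n x m)"
  have "cls n s c = \<one>\<^bsub>ob (Hom_cohomology h R K A n) s\<^esub> \<longleftrightarrow>
    (\<exists>k\<in>nat_trans R (hom_dom h s) (trm K (n - 1)) (hom_target h s A). ?P k)"
    using assms unfolding Hom_cohomology_def
    by (subst cls_one_iff) (simp_all add: carrier_cochains coboundary_eq extend_eq_iff)
  also have "\<dots> \<longleftrightarrow> ?R"
  proof
    assume ?R
    then obtain k where k: "natural_on R (hom_dom h s) (trm K (n - 1)) (hom_target h s A) k" "?P k" by blast
    then have "?P (extend (hom_dom h s) (trm K (n - 1)) k)"
      using natural_on_closed[OF complex_diff[OF complex] UNIV_I] by simp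
    then show "\<exists>k\<in>nat_trans R (hom_dom h s) (trm K (n - 1)) (hom_target h s A). ?P k"
      using natural_on_nat_trans[OF complex_pm[OF complex] k(1)] by blast
  qed (blast intro: nat_trans_natural_on)
  finally show ?thesis .
qed

lemma carrier_Hom_cohomology: "carrier (ob (Hom_cohomology h R K A n) s) = cls n s ` cocycles n s"
  by (simp add: Hom_cohomology_def carrier_cohomology)

lemma persistence_group_Hom_cohomology: "persistence_group (Hom_cohomology h R K A n)"
  unfolding Hom_cohomology_def by (rule persistence_group_cohomology)

end

text \<open>The pair \<open>(\<Psi>, \<Theta>)\<close> may shift degrees, so as to cover both chain maps and the map defining \<open>\<iota>\<close>.\<close>

lemma coset_map_cls:
  assumes F: "is_complex R F" and K: "is_complex R K" and A: "persistence_module R A" and A': "persistence_module R A'"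
    and \<alpha>: "natural_on R UNIV A A' \<alpha>"
    and \<Psi>: "natural_on R UNIV (trm K n) (trm F i) \<Psi>"
    and \<Theta>: "natural_on R UNIV (trm K (n - 1)) (trm F (i - 1)) \<Theta>"
    and comm: "\<And>a m. m \<in> carrier (ob (trm K n) a) \<Longrightarrow> diff F i a (\<Psi> a m) = \<Theta> a (diff K n a m)"
    and f: "f \<in> nat_trans R (hom_dom h s) (trm F i) (hom_target h s A)"
  shows "coset_map (ob (Hom_cochains h R K A' n) s) (cobound (Hom_cochains h R K A') (Hom_diff h K) n s)
      (Hom_map h (trm K n) \<Psi> \<alpha> s) (Hom_cls h R F A i s f) =
    Hom_cls h R K A' n s (Hom_map h (trm K n) \<Psi> \<alpha> s f)"
proof -
  interpret F: hom_cochains h R F A by unfold_locales fact+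
  interpret K: hom_cochains h R K A' by unfold_locales fact+
  have "pgroup_hom (Hom h R (trm F i) A) (Hom h R (trm K n) A') (Hom_map h (trm K n) \<Psi> \<alpha>)"
    by (rule pgroup_hom_Hom_map[OF complex_pm[OF K] A \<Psi> \<alpha>])
  then have hom: "Hom_map h (trm K n) \<Psi> \<alpha> s \<in>
      hom (ob (Hom_cochains h R F A i) s) (ob (Hom_cochains h R K A' n) s)"
    by (simp add: pgroup_hom_def Hom_cochains_def)
  show ?thesis
    unfolding F.cls_def K.cls_def
  proof (rule coset_map_r_coset)
    show "group (ob (Hom_cochains h R K A' n) s)"
      using K.comm_group_C by (simp add: comm_group_def)
    show "subgroup (cobound (Hom_cochains h R K A') (Hom_diff h K) n s) (ob (Hom_cochains h R K A' n) s)"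
      by (rule K.subgroup_cobound)
    show "cobound (Hom_cochains h R F A) (Hom_diff h F) i s \<noteq> {}"
      using subgroup.one_closed[OF F.subgroup_cobound] by blast
    show "Hom_map h (trm K n) \<Psi> \<alpha> s f \<in> carrier (ob (Hom_cochains h R K A' n) s)"
      using hom f by (auto simp: hom_def F.carrier_cochains)
    fix c assume c: "c \<in> cobound (Hom_cochains h R F A) (Hom_diff h F) i s"
    then show "Hom_map h (trm K n) \<Psi> \<alpha> s (c \<otimes>\<^bsub>ob (Hom_cochains h R F A i) s\<^esub> f) =
       Hom_map h (trm K n) \<Psi> \<alpha> s c \<otimes>\<^bsub>ob (Hom_cochains h R K A' n) s\<^esub> Hom_map h (trm K n) \<Psi> \<alpha> s f"
      using hom f subgroup.subset[OF F.subgroup_cobound, of i s] by (auto simp: hom_def F.carrier_cochains)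
    from c obtain k where k: "k \<in> nat_trans R (hom_dom h s) (trm F (i - 1)) (hom_target h s A)"
      "c = Hom_diff h F (i - 1) s k"
      by (auto simp: cobound_def F.carrier_cochains)
    \<comment> \<open>From d \<Psi> = \<Theta> d, the pullback along \<Psi> of the coboundary of k
      is the coboundary of the pullback of k along \<Theta>.\<close>
    let ?k = "Hom_map h (trm K (n - 1)) \<Theta> \<alpha> s k"
    have "?k \<in> carrier (ob (Hom_cochains h R K A' (n - 1)) s)"
      unfolding Hom_map_eq K.carrier_cochains
      using natural_on_Hom_map[OF nat_trans_natural_on[OF k(1)] \<Theta> \<alpha>]
      by (rule natural_on_nat_trans[OF complex_pm[OF K]])
    moreover have "Hom_map h (trm K n) \<Psi> \<alpha> s c = Hom_diff h K (n - 1) s ?k"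
      using natural_on_closed[OF \<Psi>] natural_on_closed[OF complex_diff[OF K]]
      by (auto simp: k(2) Hom_map_eq F.coboundary_eq K.coboundary_eq comm intro!: extend_cong)
    ultimately show "Hom_map h (trm K n) \<Psi> \<alpha> s c \<in> cobound (Hom_cochains h R K A') (Hom_diff h K) n s"
      by (auto simp: cobound_def)
  qed
qed

lemma Hom_cohomology_map_cls:
  assumes "is_complex R L" "is_complex R K" "persistence_module R A" "persistence_module R A'"
    and \<alpha>: "natural_on R UNIV A A' \<alpha>" and \<phi>: "chain_map R K L \<phi>"
    and f: "f \<in> nat_trans R (hom_dom h s) (trm L n) (hom_target h s A)"
  shows "Hom_cohomology_map h R K A' \<phi> \<alpha> n s (Hom_cls h R L A n s f) =
    Hom_cls h R K A' n s (Hom_map h (trm K n) (\<phi> n) \<alpha> s f)"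
  unfolding Hom_cohomology_map_def
  by (rule coset_map_cls[OF assms(1-5) _ _ _ f, of _ _ "\<phi> (n - 1)"])
    (use \<phi> in \<open>auto simp: chain_map_def intro: nat_trans_natural_on\<close>)

section \<open>Homology\<close>

text \<open>Meant for maps such as \<open>uct_proj\<close> that are defined by choosing
  representatives: once f o q = c is known, all the structure of \<open>c\<close> passes to
  \<open>f\<close> through the surjection \<open>q\<close>.\<close>

lemma natural_on_descend:
  assumes M: "persistence_module R M" and q: "natural_on R U M N q"
    and surj: "\<And>x. x \<in> U \<Longrightarrow> carrier (ob N x) \<subseteq> q x ` carrier (ob M x)"
    and c: "natural_on R U M L c"
    and f: "\<And>x m. x \<in> U \<Longrightarrow> m \<in> carrier (ob M x) \<Longrightarrow> f x (q x m) = c x m"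
  shows "natural_on R U N L f"
proof
  fix x u assume x: "x \<in> U" and u': "u \<in> carrier (ob N x)"
  obtain m where m: "m \<in> carrier (ob M x)" and u: "u = q x m"
    using subsetD[OF surj[OF x] u'] by (rule imageE)
  interpret A: left_module R "ob M x" using M by (rule pm_left_module)
  show "f x u \<in> carrier (ob L x)"
    unfolding u f[OF x m] using c x m by (rule natural_on_closed)
  show "f x (u \<oplus>\<^bsub>ob N x\<^esub> v) = f x u \<oplus>\<^bsub>ob L x\<^esub> f x v" if v': "v \<in> carrier (ob N x)" for v
  proof -
    obtain m' where m': "m' \<in> carrier (ob M x)" and v: "v = q x m'" using subsetD[OF surj[OF x] v'] by (rule imageE)
    show ?thesis
      unfolding u v natural_on_add[OF q x m m', symmetric] f[OF x m] f[OF x m'] f[OF x A.a_closed[OF m m']]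
      using c x m m' by (rule natural_on_add)
  qed
  show "f x (r \<odot>\<^bsub>ob N x\<^esub> u) = r \<odot>\<^bsub>ob L x\<^esub> f x u" if r: "r \<in> carrier R" for r
    unfolding u natural_on_smult[OF q x r m, symmetric] f[OF x m] f[OF x A.smult_closed[OF r m]]
    using c x r m by (rule natural_on_smult)
  show "f y (tr N x y u) = tr L x y (f x u)" if y: "y \<in> U" and xy: "x \<le> y" for y
    unfolding u natural_on_tr[OF q x y xy m, symmetric] f[OF x m] f[OF y pm_tr_closed[OF M xy m]]
    using c x y xy m by (rule natural_on_tr)
qed

text \<open>Unlike addition, subtraction is not a record field: the inverse is defined relative to
  the carrier, which the submodule changes. The inclusion is natural and hence preserves
  differences.\<close>

lemma minus_sub_pmod:
  assumes M: "persistence_module R M" and S: "subfunctor R M S" and "x \<in> S a" "y \<in> S a"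
  shows "x \<ominus>\<^bsub>ob (sub_pmod M S) a\<^esub> y = x \<ominus>\<^bsub>ob M a\<^esub> y"
  using natural_on_minus[OF persistence_module_sub[OF M S] M natural_on_sub_source[OF S natural_on_ident] UNIV_I]
    assms(3,4) by simp

abbreviation bd :: "('p, 'r, 'm) pcomplex \<Rightarrow> int \<Rightarrow> 'p \<Rightarrow> 'm set" where
  "bd K n \<equiv> im_set (trm K (n + 1)) (diff K (n + 1))"

definition hcl :: "('p, 'r, 'm) pcomplex \<Rightarrow> int \<Rightarrow> 'p \<Rightarrow> 'm \<Rightarrow> 'm set" where
  "hcl K n = quot_proj (cycles K n) (bd K n)"

lemma mem_cycles:
  "z \<in> carrier (ob (cycles K n) a) \<longleftrightarrow>
    z \<in> carrier (ob (trm K n) a) \<and> diff K n a z = \<zero>\<^bsub>ob (trm K (n - 1)) a\<^esub>"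
  by (simp add: cycles_def mem_ker_set)

lemma mem_bd: "b \<in> bd K n a \<longleftrightarrow> (\<exists>m\<in>carrier (ob (trm K (n + 1)) a). b = diff K (n + 1) a m)"
  by (auto simp: im_set_def)

lemma mem_bd_pred: "b \<in> bd K (n - 1) a \<longleftrightarrow> (\<exists>m\<in>carrier (ob (trm K n) a). b = diff K n a m)"
  by (auto simp: im_set_def)

locale pcomplex =
  fixes R :: "'r ring" and K :: "('p::preorder, 'r, 'm) pcomplex"
  assumes is_complex: "is_complex R K"
begin

lemmas pm = complex_pm[OF is_complex] and diff = complex_diff[OF is_complex]
  and diff_Suc = complex_diff_Suc[OF is_complex] and dd_Suc = complex_dd_Suc[OF is_complex]

lemma abelian_group_trm: "abelian_group (ob (trm K n) a)"
  using pm by (rule pm_abelian_group)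

lemma subfunctor_cycles: "subfunctor R (trm K n) (ker_set (trm K n) (trm K (n - 1)) (diff K n))"
  using pm pm diff by (rule subfunctor_ker)

lemma subfunctor_bd_trm: "subfunctor R (trm K n) (bd K n)"
  using pm pm diff_Suc by (rule subfunctor_im)

lemma pm_cycles: "persistence_module R (cycles K n)"
  unfolding cycles_def using pm subfunctor_cycles by (rule persistence_module_sub)

lemma pm_boundaries: "persistence_module R (boundaries K n)"
  unfolding boundaries_def using pm subfunctor_bd_trm by (rule persistence_module_sub)

lemma bd_cycles: "b \<in> bd K n a \<Longrightarrow> b \<in> carrier (ob (cycles K n) a)"
  using natural_on_closed[OF diff_Suc UNIV_I] by (auto simp: mem_bd mem_cycles dd_Suc)

lemma subfunctor_bd: "subfunctor R (cycles K n) (bd K n)"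
  using subfunctor_bd_trm[of n] bd_cycles[of _ n] unfolding subfunctor_def by (simp add: cycles_def subset_iff)

lemma natural_on_cycles_iff:
  "natural_on R U M (cycles K n) f \<longleftrightarrow> natural_on R U M (trm K n) f \<and>
    (\<forall>x\<in>U. \<forall>m\<in>carrier (ob M x). f x m \<in> carrier (ob (cycles K n) x))"
  unfolding cycles_def by (subst natural_on_sub_target[OF subfunctor_cycles]) simp

lemma natural_on_boundaries_iff:
  "natural_on R U M (boundaries K n) f \<longleftrightarrow> natural_on R U M (trm K n) f \<and>
    (\<forall>x\<in>U. \<forall>m\<in>carrier (ob M x). f x m \<in> bd K n x)"
  unfolding boundaries_def by (rule natural_on_sub_target[OF subfunctor_bd_trm])

lemma carrier_boundaries: "carrier (ob (boundaries K n) a) = bd K n a"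
  by (simp add: boundaries_def)

lemma natural_on_from_cycles: "natural_on R U (trm K n) N f \<Longrightarrow> natural_on R U (cycles K n) N f"
  unfolding cycles_def using subfunctor_cycles by (rule natural_on_sub_source)

lemma natural_on_from_boundaries: "natural_on R U (trm K n) N f \<Longrightarrow> natural_on R U (boundaries K n) N f"
  unfolding boundaries_def using subfunctor_bd_trm by (rule natural_on_sub_source)

lemma pm_homology: "persistence_module R (homology K n)"
  unfolding homology_def using pm_cycles subfunctor_bd by (rule persistence_module_quot)

lemma natural_on_hcl: "natural_on R U (cycles K n) (homology K n) (hcl K n)"
  unfolding homology_def hcl_def using pm_cycles subfunctor_bd by (rule natural_on_quot_proj)

lemma carrier_homology: "carrier (ob (homology K n) a) = hcl K n a ` carrier (ob (cycles K n) a)"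
  unfolding homology_def hcl_def using pm_cycles subfunctor_bd by (rule carrier_quot_pmod)

lemma hcl_eq_iff:
  assumes "z \<in> carrier (ob (cycles K n) a)" "z' \<in> carrier (ob (cycles K n) a)"
  shows "hcl K n a z = hcl K n a z' \<longleftrightarrow> z \<ominus>\<^bsub>ob (trm K n) a\<^esub> z' \<in> bd K n a"
  using quot_proj_eq_iff[OF pm_cycles subfunctor_bd assms] minus_sub_pmod[OF pm subfunctor_cycles, of z n a z'] assms
  by (simp add: hcl_def cycles_def)

lemma hcl_zero_iff:
  "z \<in> carrier (ob (cycles K n) a) \<Longrightarrow> hcl K n a z = \<zero>\<^bsub>ob (homology K n) a\<^esub> \<longleftrightarrow> z \<in> bd K n a"
  unfolding homology_def hcl_def by (rule quot_proj_zero_iff[OF pm_cycles subfunctor_bd])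

lemma mem_hclE:
  assumes "y \<in> hcl K n a z"
  obtains b where "b \<in> bd K n a" "y = b \<oplus>\<^bsub>ob (trm K n) a\<^esub> z"
  using assms by (auto simp: hcl_def quot_proj_def a_r_coset_def' cycles_def)

lemma mem_hcl_self:
  assumes "z \<in> carrier (ob (trm K n) a)"
  shows "z \<in> hcl K n a z"
proof -
  interpret abelian_group "ob (trm K n) a" by (rule abelian_group_trm)
  have "\<zero>\<^bsub>ob (trm K n) a\<^esub> \<in> bd K n a"
    using subfunctor_bd_trm[of n] by (simp add: subfunctor_def)
  then show ?thesis
    using assms by (auto simp: hcl_def quot_proj_def a_r_coset_def' cycles_def intro!: bexI[of _ "\<zero>\<^bsub>ob (trm K n) a\<^esub>"])
qed

lemma nat_trans_homology_eqI:
  assumes "f \<in> nat_trans R U (homology K n) N" "g \<in> nat_trans R U (homology K n) N'"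
    and "\<And>x z. x \<in> U \<Longrightarrow> z \<in> carrier (ob (cycles K n) x) \<Longrightarrow> f x (hcl K n x z) = g x (hcl K n x z)"
  shows "f = g"
  using assms(1,2) by (rule nat_trans_eqI) (use assms(3) in \<open>auto simp: carrier_homology\<close>)

end

section \<open>Induced maps on homology, and the splittings that projective boundaries
  provide\<close>

lemma admissible_complex_is_complex: "admissible_complex R K \<Longrightarrow> is_complex R K"
  by (simp add: admissible_complex_def)

lemma homology_map_hcl:
  assumes K: "is_complex R K" and L: "is_complex R L" and \<phi>: "chain_map R K L \<phi>"
    and z: "z \<in> carrier (ob (cycles K n) a)"
  shows "\<phi> n a z \<in> carrier (ob (cycles L n) a)"
    and "homology_map K L \<phi> n a (hcl K n a z) = hcl L n a (\<phi> n a z)"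
proof -
  interpret K: pcomplex R K by unfold_locales fact
  interpret L: pcomplex R L by unfold_locales fact
  have nat: "natural_on R UNIV (trm K i) (trm L i) (\<phi> i)" for i
    using \<phi> by (auto simp: chain_map_def intro: nat_trans_natural_on)
  have comm: "\<phi> (i - 1) a (diff K i a m) = diff L i a (\<phi> i a m)" if "m \<in> carrier (ob (trm K i) a)" for i m
    using \<phi> that by (simp add: chain_map_def)
  have cyc: "\<phi> n a y \<in> carrier (ob (cycles L n) a)" if "y \<in> carrier (ob (cycles K n) a)" for y
    using that comm[of y n] natural_on_zero[OF K.pm L.pm nat, of a "n - 1"] natural_on_closed[OF nat]
    by (simp add: mem_cycles)
  then show "\<phi> n a z \<in> carrier (ob (cycles L n) a)" using z .
  interpret A: abelian_group "ob (cycles L n) a" using L.pm_cycles by (rule pm_abelian_group)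
  have bd: "\<phi> n a b \<in> bd L n a" if "b \<in> bd K n a" for b
    using that comm[of _ "n + 1"] natural_on_closed[OF nat[of "n + 1"] UNIV_I] by (auto simp: mem_bd)
  have "coset_map (add_monoid (ob (cycles L n) a)) (bd L n a) (\<phi> n a) (bd K n a #>\<^bsub>add_monoid (ob (cycles K n) a)\<^esub> z) =
      bd L n a #>\<^bsub>add_monoid (ob (cycles L n) a)\<^esub> \<phi> n a z"
  proof (rule coset_map_r_coset)
    show "subgroup (bd L n a) (add_monoid (ob (cycles L n) a))"
      using L.pm_cycles L.subfunctor_bd by (rule subfunctor_subgroup)
    show "bd K n a \<noteq> {}"
      using K.subfunctor_bd[of n] by (auto simp: subfunctor_def)
    show "\<phi> n a (b \<otimes>\<^bsub>add_monoid (ob (cycles K n) a)\<^esub> z) = \<phi> n a b \<otimes>\<^bsub>add_monoid (ob (cycles L n) a)\<^esub> \<phi> n a z"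
      if "b \<in> bd K n a" for b
      using natural_on_add[OF nat UNIV_I, of b n a z] K.bd_cycles[OF that] z
      by (simp add: cycles_def mem_ker_set)
  qed (use cyc z bd A.a_group in auto)
  moreover have "hcl K n a z \<in> carrier (ob (homology K n) a)"
    using z by (simp add: K.carrier_homology)
  ultimately show "homology_map K L \<phi> n a (hcl K n a z) = hcl L n a (\<phi> n a z)"
    by (simp add: homology_map_def hcl_def quot_proj_def a_r_coset_def)
qed

text \<open>The inclusion of the boundaries into K_{n-1} is lifted against d : K_n -> K_{n-1}, whose
  image is exactly the boundaries.\<close>

lemma boundaries_section:
  assumes K: "admissible_complex R K"
  shows "\<exists>j. natural_on R UNIV (boundaries K (n - 1)) (trm K n) j \<and>
    (\<forall>a. \<forall>b\<in>bd K (n - 1) a. diff K n a (j a b) = b)"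
proof -
  interpret pcomplex R K using K by unfold_locales (rule admissible_complex_is_complex)
  have "projective R (boundaries K (n - 1))"
    using K by (simp add: admissible_complex_def)
  from projective_lift[OF this pm pm diff natural_on_from_boundaries[OF natural_on_ident]] 
  show ?thesis
    by (simp add: boundaries_def im_set_def)
qed

lemma cycles_retraction:
  assumes K: "admissible_complex R K"
  shows "\<exists>r. natural_on R UNIV (trm K n) (cycles K n) r \<and>
    (\<forall>a. \<forall>z\<in>carrier (ob (cycles K n) a). r a z = z)"
proof -
  interpret pcomplex R K using K by unfold_locales (rule admissible_complex_is_complex)
  obtain j where j: "natural_on R UNIV (boundaries K (n - 1)) (trm K n) j"
    and dj: "\<And>a b. b \<in> bd K (n - 1) a \<Longrightarrow> diff K n a (j a b) = b"
    using boundaries_section[OF K] by blast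
  let ?r = "\<lambda>a m. m \<ominus>\<^bsub>ob (trm K n) a\<^esub> j a (diff K n a m)"
  \<comment> \<open>\<open>j\<close> is natural on the boundaries only, so d has to be viewed as a
    map into them before composing.\<close>
  have d: "natural_on R UNIV (trm K n) (boundaries K (n - 1)) (diff K n)"
    unfolding natural_on_boundaries_iff mem_bd_pred using diff by blast
  have r: "natural_on R UNIV (trm K n) (trm K n) ?r"
    by (rule natural_on_diff[OF pm pm natural_on_ident natural_on_comp[OF d j]])
  have "?r a m \<in> carrier (ob (cycles K n) a)" if m: "m \<in> carrier (ob (trm K n) a)" for a m
  proof -
    interpret A: abelian_group "ob (trm K (n - 1)) a" by (rule abelian_group_trm)
    have b: "diff K n a m \<in> bd K (n - 1) a" unfolding mem_bd_pred using m by blast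
    have "j a (diff K n a m) \<in> carrier (ob (trm K n) a)"
      using natural_on_closed[OF natural_on_comp[OF d j] UNIV_I m] .
    then have "diff K n a (?r a m) = diff K n a m \<ominus>\<^bsub>ob (trm K (n - 1)) a\<^esub> diff K n a m"
      using natural_on_minus[OF pm pm diff UNIV_I m] dj[OF b] by simp
    then show ?thesis
      using natural_on_closed[OF r UNIV_I m] natural_on_closed[OF diff UNIV_I m]
      by (simp add: mem_cycles a_minus_def A.r_neg)
  qed
  then have "natural_on R UNIV (trm K n) (cycles K n) ?r"
    using r by (simp add: natural_on_cycles_iff)
  moreover have "?r a z = z" if z: "z \<in> carrier (ob (cycles K n) a)" for a z
  proof -
    interpret A: abelian_group "ob (trm K n) a" by (rule abelian_group_trm)
    have "j a \<zero>\<^bsub>ob (boundaries K (n - 1)) a\<^esub> = \<zero>\<^bsub>ob (trm K n) a\<^esub>"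
      using pm_boundaries pm j UNIV_I by (rule natural_on_zero)
    then show ?thesis
      using z A.minus_equality[of "\<zero>\<^bsub>ob (trm K n) a\<^esub>" "\<zero>\<^bsub>ob (trm K n) a\<^esub>"] 
      by (simp add: mem_cycles boundaries_def a_minus_def)
  qed
  ultimately show ?thesis by blast
qed

section \<open>The projection onto the homs out of homology\<close>

text \<open>The value at a homology class is that of an arbitrary representing cocycle at an
  arbitrary representing cycle. No retraction enters, so nothing has to be chosen compatibly for
  different complexes; independence of representatives is \<open>uct_proj_cls\<close>.\<close>

definition uct_proj ::
  "hom_kind \<Rightarrow> int \<Rightarrow> ('p::preordered_ab_group_add, 'r, 'm) pcomplex \<Rightarrow>
    'p \<Rightarrow> ('p \<Rightarrow> 'm \<Rightarrow> 'a) set \<Rightarrow> 'p \<Rightarrow> 'm set \<Rightarrow> 'a" where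
  "uct_proj h n K s X =
     extend (hom_dom h s) (homology K n) (\<lambda>x Y. (SOME c. c \<in> X) x (SOME z. z \<in> Y))"

context hom_cochains
begin

sublocale K: pcomplex R K
  by unfold_locales (rule complex)

lemma cocycle_natural:
  "c \<in> cocycles n s \<Longrightarrow> natural_on R (hom_dom h s) (trm K n) (hom_target h s A) c"
  by (auto simp: mem_cocycles_iff intro: nat_trans_natural_on)

lemma cocycle_bd:
  "c \<in> cocycles n s \<Longrightarrow> x \<in> hom_dom h s \<Longrightarrow> b \<in> bd K n x \<Longrightarrow> c x b = \<zero>\<^bsub>ob (hom_target h s A) x\<^esub>"
  by (auto simp: mem_cocycles_iff mem_bd)

text \<open>Two ambiguities cancel. Another representing cocycle differs by k o d, which vanishes on
  cycles; another representing cycle differs by a boundary, on which a cocycle vanishes.\<close>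

lemma uct_proj_cls:
  assumes c: "c \<in> cocycles n s" and x: "x \<in> hom_dom h s" and z: "z \<in> carrier (ob (cycles K n) x)"
  shows "uct_proj h n K s (cls n s c) x (hcl K n x z) = c x z"
proof -
  interpret T: abelian_group "ob (hom_target h s A) x" using target by (rule pm_abelian_group)
  interpret KA: abelian_group "ob (trm K n) x" by (rule K.abelian_group_trm)
  have z': "z \<in> carrier (ob (trm K n) x)" "diff K n x z = \<zero>\<^bsub>ob (trm K (n - 1)) x\<^esub>"
    using z by (auto simp: mem_cycles)
  note cn = cocycle_natural[OF c]
  let ?c = "SOME c'. c' \<in> cls n s c" and ?y = "SOME y. y \<in> hcl K n x z"
  have "c \<in> cls n s c"
    using c by (intro mem_cls_self) (simp add: cocycles_def)
  then have "?c \<in> cls n s c" by (rule someI[where P = "\<lambda>c'. c' \<in> cls n s c"])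
  then obtain k where k: "k \<in> nat_trans R (hom_dom h s) (trm K (n - 1)) (hom_target h s A)"
    and ck: "?c = extend (hom_dom h s) (trm K n) (\<lambda>x m. Hom_diff h K (n - 1) s k x m \<oplus>\<^bsub>ob (hom_target h s A) x\<^esub> c x m)"
    by (auto simp: mem_cls_iff carrier_cochains mult_cochains)
  have "?y \<in> hcl K n x z"
    using K.mem_hcl_self[OF z'(1)] by (rule someI[where P = "\<lambda>y. y \<in> hcl K n x z"])
  then obtain b where b: "b \<in> bd K n x" and yb: "?y = b \<oplus>\<^bsub>ob (trm K n) x\<^esub> z"
    by (rule K.mem_hclE)
  have b': "b \<in> carrier (ob (trm K n) x)" "diff K n x b = \<zero>\<^bsub>ob (trm K (n - 1)) x\<^esub>"
    using K.bd_cycles[OF b] by (auto simp: mem_cycles)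
  interpret K1: abelian_group "ob (trm K (n - 1)) x" by (rule K.abelian_group_trm)
  have dy: "?y \<in> carrier (ob (trm K n) x)" "diff K n x ?y = \<zero>\<^bsub>ob (trm K (n - 1)) x\<^esub>"
    unfolding yb using b' z' natural_on_add[OF K.diff UNIV_I b'(1) z'(1)] by auto
  have cy: "c x ?y = c x z"
    unfolding yb using natural_on_add[OF cn x b'(1) z'(1)] cocycle_bd[OF c x b] natural_on_closed[OF cn x z'(1)]
    by simp
  have "?c x ?y = k x \<zero>\<^bsub>ob (trm K (n - 1)) x\<^esub> \<oplus>\<^bsub>ob (hom_target h s A) x\<^esub> c x ?y"
    unfolding ck using x dy by (simp add: coboundary_eq)
  also have "\<dots> = c x z"
    using natural_on_zero[OF K.pm target nat_trans_natural_on[OF k] x] cy natural_on_closed[OF cn x z'(1)]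
    by simp
  finally have "?c x ?y = c x z" .
  moreover have "hcl K n x z \<in> carrier (ob (homology K n) x)"
    using z by (auto simp: K.carrier_homology)
  ultimately show ?thesis
    unfolding uct_proj_def using x by simp
qed

lemma uct_proj_nat_trans:
  assumes c: "c \<in> cocycles n s"
  shows "uct_proj h n K s (cls n s c) \<in> nat_trans R (hom_dom h s) (homology K n) (hom_target h s A)"
proof -
  have "natural_on R (hom_dom h s) (homology K n) (hom_target h s A) (uct_proj h n K s (cls n s c))"
    by (rule natural_on_descend[OF K.pm_cycles K.natural_on_hcl _ K.natural_on_from_cycles[OF cocycle_natural[OF c]]])
      (simp_all add: K.carrier_homology uct_proj_cls[OF c])
  from natural_on_nat_trans[OF K.pm_homology this]
  have "extend (hom_dom h s) (homology K n) (uct_proj h n K s (cls n s c)) \<in>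
      nat_trans R (hom_dom h s) (homology K n) (hom_target h s A)" .
  \<comment> \<open>\<open>uct_proj\<close> is itself an \<open>extend\<close>, so extending it
    again changes nothing.\<close>
  then show ?thesis
    unfolding uct_proj_def by (simp cong: extend_cong)
qed

text \<open>The common route to additivity, compatibility with transition maps, the section property
  and naturality: a map out of homology is tested on classes of cycles, where
  \<open>uct_proj\<close> is just the cocycle.\<close>

lemma uct_proj_eqI:
  assumes c: "c \<in> cocycles n s"
    and g: "g \<in> nat_trans R (hom_dom h s) (homology K n) N"
    and eq: "\<And>x z. x \<in> hom_dom h s \<Longrightarrow> z \<in> carrier (ob (cycles K n) x) \<Longrightarrow> c x z = g x (hcl K n x z)"
  shows "uct_proj h n K s (cls n s c) = g"
  using uct_proj_nat_trans[OF c] g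
  by (rule K.nat_trans_homology_eqI) (simp add: uct_proj_cls[OF c] eq)

lemma pgroup_hom_uct_proj: "pgroup_hom (Hom_cohomology h R K A n) (Hom h R (homology K n) A) (uct_proj h n K)"
  unfolding pgroup_hom_def
proof (intro conjI allI impI ballI)
  fix s t X
  have cyc: "z \<in> carrier (ob (trm K n) x)" if "z \<in> carrier (ob (cycles K n) x)" for x z
    using that by (simp add: mem_cycles)
  have hcl: "hcl K n x z \<in> carrier (ob (homology K n) x)" if "z \<in> carrier (ob (cycles K n) x)" for x z
    using that by (simp add: K.carrier_homology)
  show "uct_proj h n K s \<in> hom (ob (Hom_cohomology h R K A n) s) (ob (Hom h R (homology K n) A) s)"
  proof (rule homI)
    fix X Y assume "X \<in> carrier (ob (Hom_cohomology h R K A n) s)" "Y \<in> carrier (ob (Hom_cohomology h R K A n) s)"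
    then obtain c c' where c: "c \<in> cocycles n s" "X = cls n s c" and c': "c' \<in> cocycles n s" "Y = cls n s c'"
      by (auto simp: carrier_Hom_cohomology)
    show "uct_proj h n K s X \<in> carrier (ob (Hom h R (homology K n) A) s)"
      unfolding c(2) carrier_Hom using c(1) by (rule uct_proj_nat_trans)
    have sum: "uct_proj h n K s X \<otimes>\<^bsub>ob (Hom h R (homology K n) A) s\<^esub> uct_proj h n K s Y \<in>
        nat_trans R (hom_dom h s) (homology K n) (hom_target h s A)"
      unfolding ob_Hom mult_hom_group c(2) c'(2)
      by (intro natural_on_nat_trans natural_on_plus K.pm_homology target nat_trans_natural_on
          uct_proj_nat_trans c(1) c'(1))
    have "X \<otimes>\<^bsub>ob (Hom_cohomology h R K A n) s\<^esub> Y = cls n s (c \<otimes>\<^bsub>ob (Hom_cochains h R K A n) s\<^esub> c')"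
      unfolding c(2) c'(2) Hom_cohomology_def using c(1) c'(1) by (rule cls_mult)
    also have "uct_proj h n K s \<dots> = uct_proj h n K s X \<otimes>\<^bsub>ob (Hom h R (homology K n) A) s\<^esub> uct_proj h n K s Y"
      using subgroup.m_closed[OF subgroup_cocycles c(1) c'(1)] sum
      by (rule uct_proj_eqI) 
        (simp add: ob_Hom mult_hom_group mult_cochains c(2) c'(2) uct_proj_cls c(1) c'(1) cyc hcl)
    finally show "uct_proj h n K s (X \<otimes>\<^bsub>ob (Hom_cohomology h R K A n) s\<^esub> Y) =
      uct_proj h n K s X \<otimes>\<^bsub>ob (Hom h R (homology K n) A) s\<^esub> uct_proj h n K s Y" .
  qed
  assume st: "s \<le> t" and "X \<in> carrier (ob (Hom_cohomology h R K A n) s)"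
  then obtain c where c: "c \<in> cocycles n s" "X = cls n s c"
    by (auto simp: carrier_Hom_cohomology)
  have cn: "c \<in> nat_trans R (hom_dom h s) (trm K n) (hom_target h s A)"
    using c(1) by (simp add: mem_cocycles_iff)
  note pn = uct_proj_nat_trans[OF c(1)]
  have "tr (Hom_cohomology h R K A n) s t X = cls n t (tr (Hom_cochains h R K A n) s t c)"
    unfolding c(2) Hom_cohomology_def using st cn by (intro tr_cls) (simp_all add: carrier_cochains)
  also have "uct_proj h n K t \<dots> = tr (Hom h R (homology K n) A) s t (uct_proj h n K s X)"
    unfolding c(2) tr_Hom[OF st pn]
  proof (rule uct_proj_eqI)
    show "tr (Hom_cochains h R K A n) s t c \<in> cocycles n t"
      using st c(1) by (rule tr_cocycles)
    show "extend (hom_dom h t) (homology K n) (\<lambda>x m. target_tr h A s t x (uct_proj h n K s (cls n s c) x m)) \<in>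
       nat_trans R (hom_dom h t) (homology K n) (hom_target h t A)"
      using K.pm_homology natural_on_tr_Hom[OF A st pn] by (rule natural_on_nat_trans)
    fix x z assume "x \<in> hom_dom h t" "z \<in> carrier (ob (cycles K n) x)"
    then show "tr (Hom_cochains h R K A n) s t c x z =
        extend (hom_dom h t) (homology K n) (\<lambda>x m. target_tr h A s t x (uct_proj h n K s (cls n s c) x m)) x (hcl K n x z)"
      using hom_dom_mono[OF st, of h]
      by (simp add: Hom_cochains_def tr_Hom[OF st cn] cyc hcl subset_iff uct_proj_cls[OF c(1)])
  qed
  finally show "uct_proj h n K t (tr (Hom_cohomology h R K A n) s t X) =
    tr (Hom h R (homology K n) A) s t (uct_proj h n K s X)" .
qed

text \<open>A retraction \<open>r\<close> onto the cycles turns \<open>g : H\<^sub>n \<rightarrow> A\<close> into the cocycle \<open>g \<circ> hcl \<circ> r\<close>, naturally in \<open>s\<close>.\<close>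

lemma uct_proj_section:
  assumes r: "natural_on R UNIV (trm K n) (cycles K n) r"
    and rz: "\<And>a z. z \<in> carrier (ob (cycles K n) a) \<Longrightarrow> r a z = z"
  shows "\<exists>\<sigma>. pgroup_hom (Hom h R (homology K n) A) (Hom_cohomology h R K A n) \<sigma> \<and>
    (\<forall>s. \<forall>g\<in>carrier (ob (Hom h R (homology K n) A) s). uct_proj h n K s (\<sigma> s g) = g)"
proof -
  let ?q = "\<lambda>x m. hcl K n x (r x m)"
  let ?\<tau> = "Hom_map h (trm K n) ?q (\<lambda>x u. u)"
  let ?\<sigma> = "\<lambda>s g. cls n s (?\<tau> s g)"
  have q: "natural_on R UNIV (trm K n) (homology K n) ?q"
    using r K.natural_on_hcl by (rule natural_on_comp)
  have \<tau>: "pgroup_hom (Hom h R (homology K n) A) (Hom h R (trm K n) A) ?\<tau>"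
    by (rule pgroup_hom_Hom_map[OF K.pm A q natural_on_ident])
  have coc: "?\<tau> s g \<in> cocycles n s" if g: "g \<in> carrier (ob (Hom h R (homology K n) A) s)" for s g
    unfolding mem_cocycles_iff
  proof (intro conjI ballI)
    show "?\<tau> s g \<in> nat_trans R (hom_dom h s) (trm K n) (hom_target h s A)"
      using \<tau> g by (auto simp: pgroup_hom_def hom_def carrier_Hom[symmetric])
    fix x m assume x: "x \<in> hom_dom h s" and m: "m \<in> carrier (ob (trm K (n + 1)) x)"
    have b: "diff K (n + 1) x m \<in> bd K n x" using m by (auto simp: mem_bd)
    \<comment> \<open>A boundary is a cycle, so r fixes it, and its homology class is zero.\<close>
    have "?q x (diff K (n + 1) x m) = \<zero>\<^bsub>ob (homology K n) x\<^esub>"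
      using K.bd_cycles[OF b] b by (simp add: rz K.hcl_zero_iff)
    moreover have "g x \<zero>\<^bsub>ob (homology K n) x\<^esub> = \<zero>\<^bsub>ob (hom_target h s A) x\<^esub>"
      using g by (intro natural_on_zero[OF K.pm_homology target _ x]) (simp add: carrier_Hom nat_trans_natural_on)
    ultimately show "?\<tau> s g x (diff K (n + 1) x m) = \<zero>\<^bsub>ob (hom_target h s A) x\<^esub>"
      using x natural_on_closed[OF K.diff_Suc UNIV_I m] by (simp add: Hom_map_eq)
  qed
  show ?thesis
  proof (intro exI conjI allI ballI)
    show "pgroup_hom (Hom h R (homology K n) A) (Hom_cohomology h R K A n) ?\<sigma>"
      unfolding pgroup_hom_def
    proof (intro conjI allI impI ballI)
      fix s
      show "?\<sigma> s \<in> hom (ob (Hom h R (homology K n) A) s) (ob (Hom_cohomology h R K A n) s)"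
        using coc \<tau>
        by (auto simp: hom_def carrier_cohomology pgroup_hom_def Hom_cohomology_def cls_mult Hom_cochains_def)
    next
      fix s t g assume st: "s \<le> t" and g: "g \<in> carrier (ob (Hom h R (homology K n) A) s)"
      have "tr (Hom_cohomology h R K A n) s t (?\<sigma> s g) = cls n t (tr (Hom_cochains h R K A n) s t (?\<tau> s g))"
        unfolding Hom_cohomology_def using st coc[OF g] by (intro tr_cls) (simp_all add: cocycles_def)
      then show "?\<sigma> t (tr (Hom h R (homology K n) A) s t g) = tr (Hom_cohomology h R K A n) s t (?\<sigma> s g)"
        using \<tau> st g by (simp add: pgroup_hom_def Hom_cochains_def)
    qed
    fix s g assume g: "g \<in> carrier (ob (Hom h R (homology K n) A) s)"
    show "uct_proj h n K s (?\<sigma> s g) = g"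
      using coc[OF g] g[unfolded carrier_Hom]
      by (rule uct_proj_eqI) (simp add: Hom_map_eq mem_cycles rz)
  qed
qed

end

section \<open>The injection of Ext\<close>

text \<open>
  The pair \<open>(\<Theta>, \<Psi>)\<close> compares the resolution \<open>0 \<rightarrow> B\<^sub>n\<^sub>-\<^sub>1 \<rightarrow> Z\<^sub>n\<^sub>-\<^sub>1\<close> of \<open>H\<^sub>n\<^sub>-\<^sub>1\<close> with \<open>F\<close>, except that both
  maps are already extended from cycles and boundaries to the terms of \<open>K\<close>.
\<close>

definition comparison ::
  "'r ring \<Rightarrow> int \<Rightarrow> ('p::preordered_ab_group_add, 'r, 'm) pcomplex \<Rightarrow> ('p, 'r, 'f) pcomplex \<Rightarrow>
    ('p \<Rightarrow> 'f \<Rightarrow> 'm set) \<Rightarrow> ('p \<Rightarrow> 'm \<Rightarrow> 'f) \<Rightarrow> ('p \<Rightarrow> 'm \<Rightarrow> 'f) \<Rightarrow> bool" where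
  "comparison R n K F \<epsilon> \<Theta> \<Psi> \<longleftrightarrow>
     natural_on R UNIV (trm K (n - 1)) (trm F 0) \<Theta> \<and> natural_on R UNIV (trm K n) (trm F 1) \<Psi> \<and>
     (\<forall>a. \<forall>z\<in>carrier (ob (cycles K (n - 1)) a). \<epsilon> a (\<Theta> a z) = hcl K (n - 1) a z) \<and>
     (\<forall>a. \<forall>m\<in>carrier (ob (trm K n) a). diff F 1 a (\<Psi> a m) = \<Theta> a (diff K n a m))"

text \<open>Only \<Psi> enters the formula; \<Theta> merely certifies it. The choice bears no
  relation to the choices made for other complexes or resolutions, which is why
  \<open>uct_inj_natural\<close> requires a homotopy.\<close>

definition uct_inj ::
  "hom_kind \<Rightarrow> 'r ring \<Rightarrow> int \<Rightarrow> ('p::preordered_ab_group_add, 'r, 'm) pcomplex \<Rightarrow> ('p, 'r, 'f) pcomplex \<Rightarrow>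
    ('p \<Rightarrow> 'f \<Rightarrow> 'm set) \<Rightarrow> ('p, 'r, 'a) pmod \<Rightarrow> 'p \<Rightarrow> ('p \<Rightarrow> 'f \<Rightarrow> 'a) set \<Rightarrow> ('p \<Rightarrow> 'm \<Rightarrow> 'a) set" where
  "uct_inj h R n K F \<epsilon> A s =
     coset_map (ob (Hom_cochains h R K A n) s) (cobound (Hom_cochains h R K A) (Hom_diff h K) n s)
       (Hom_map h (trm K n) (SOME \<Psi>. \<exists>\<Theta>. comparison R n K F \<epsilon> \<Theta> \<Psi>) (\<lambda>x u. u) s)"

section \<open>Exactness of the resolution and existence of comparison maps\<close>

lemma (in abelian_group) minus_eq_zeroD:
  "x \<in> carrier G \<Longrightarrow> y \<in> carrier G \<Longrightarrow> x \<ominus> y = \<zero> \<Longrightarrow> x = y"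
  by (metis a_minus_def add.inv_closed minus_equality minus_minus)

lemma (in abelian_group) minus_self: "x \<in> carrier G \<Longrightarrow> x \<ominus> x = \<zero>"
  by (simp add: a_minus_def r_neg)

lemma (in abelian_group) minus_minus_self:
  "x \<in> carrier G \<Longrightarrow> y \<in> carrier G \<Longrightarrow> x \<ominus> (x \<ominus> y) = y"
  by (simp add: a_minus_def minus_add a_assoc[symmetric] r_neg)

locale resolved_complex =
  fixes R :: "'r ring" and n :: int and K :: "('p::preordered_ab_group_add, 'r, 'm) pcomplex"
    and F :: "('p, 'r, 'f) pcomplex" and \<epsilon> :: "'p \<Rightarrow> 'f \<Rightarrow> 'm set"
  assumes admissible: "admissible_complex R K"
    and resolution: "projective_resolution R F \<epsilon> (homology K (n - 1))"
begin

sublocale K: pcomplex R K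
  by unfold_locales (rule admissible_complex_is_complex[OF admissible])

sublocale F: pcomplex R F
  by unfold_locales (use resolution in \<open>simp add: projective_resolution_def\<close>)

lemma projective_K: "projective R (trm K i)"
  using admissible by (simp add: admissible_complex_def)

lemma projective_F: "projective R (trm F i)"
  using resolution by (simp add: projective_resolution_def)

lemma natural_on_\<epsilon>: "natural_on R UNIV (trm F 0) (homology K (n - 1)) \<epsilon>"
  using resolution by (simp add: projective_resolution_def nat_trans_natural_on)

lemma \<epsilon>_surj: "\<epsilon> a ` carrier (ob (trm F 0) a) = carrier (ob (homology K (n - 1)) a)"
  using resolution by (simp add: projective_resolution_def)

lemma diff_F1: "natural_on R UNIV (trm F 1) (trm F 0) (diff F 1)"
  using F.diff[of 1] by simp

lemma ker_\<epsilon>: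
  assumes "u \<in> carrier (ob (trm F 0) a)"
  shows "\<epsilon> a u = \<zero>\<^bsub>ob (homology K (n - 1)) a\<^esub> \<longleftrightarrow> u \<in> diff F 1 a ` carrier (ob (trm F 1) a)"
proof -
  have "ker_set (trm F 0) (homology K (n - 1)) \<epsilon> a = im_set (trm F 1) (diff F 1) a"
    using resolution by (simp add: projective_resolution_def)
  then show ?thesis
    using assms mem_ker_set[of u "trm F 0" "homology K (n - 1)" \<epsilon> a] by (simp add: im_set_def)
qed

lemma ker_d1:
  assumes "v \<in> carrier (ob (trm F 1) a)" "diff F 1 a v = \<zero>\<^bsub>ob (trm F 0) a\<^esub>"
  shows "v \<in> bd F 1 a"
proof -
  \<comment> \<open>The instance i = 1 of exactness, with the indices left unevaluated so that it
    matches both the definition and \<open>bd F 1\<close>.\<close>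
  have "ker_set (trm F 1) (trm F (1 - 1)) (diff F 1) = im_set (trm F (1 + 1)) (diff F (1 + 1))"
    using resolution by (simp only: projective_resolution_def order_refl)
  from fun_cong[OF this, of a] show ?thesis
    using assms mem_ker_set[of v "trm F 1" "trm F 0" "diff F 1" a] by simp
qed

text \<open>The kernel of \<epsilon> is the image of d_1. This step produces \<Psi>, \<eta> and the
  homotopy \<zeta> used for naturality.\<close>

lemma lift_ker_\<epsilon>:
  assumes P: "projective R P" and g: "natural_on R UNIV P (trm F 0) g"
    and ker: "\<And>a m. m \<in> carrier (ob P a) \<Longrightarrow> \<epsilon> a (g a m) = \<zero>\<^bsub>ob (homology K (n - 1)) a\<^esub>"
  shows "\<exists>g'. natural_on R UNIV P (trm F 1) g' \<and> (\<forall>a. \<forall>m\<in>carrier (ob P a). diff F 1 a (g' a m) = g a m)"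
  using P F.pm F.pm diff_F1 g
  by (rule projective_lift) (use ker ker_\<epsilon> natural_on_closed[OF g UNIV_I] in blast)

lemma hcl_d: "m \<in> carrier (ob (trm K n) a) \<Longrightarrow>
    diff K n a m \<in> carrier (ob (cycles K (n - 1)) a) \<and>
    hcl K (n - 1) a (diff K n a m) = \<zero>\<^bsub>ob (homology K (n - 1)) a\<^esub>"
  using K.bd_cycles[of "diff K n a m" "n - 1" a] K.hcl_zero_iff[of "diff K n a m" "n - 1" a]
    mem_bd_pred[of "diff K n a m" K n a] by blast

lemma comparison_exists: "\<exists>\<Psi> \<Theta>. comparison R n K F \<epsilon> \<Theta> \<Psi>"
proof -
  obtain r where r: "natural_on R UNIV (trm K (n - 1)) (cycles K (n - 1)) r"
    and rz: "\<And>a z. z \<in> carrier (ob (cycles K (n - 1)) a) \<Longrightarrow> r a z = z"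
    using cycles_retraction[OF admissible] by blast
  \<comment> \<open>The class map lives on cycles; composing with r extends it to the projective
    module K_{n-1}, from which \<Theta> can be lifted.\<close>
  have q: "natural_on R UNIV (trm K (n - 1)) (homology K (n - 1)) (\<lambda>x m. hcl K (n - 1) x (r x m))"
    using r K.natural_on_hcl by (rule natural_on_comp)
  have "\<exists>\<Theta>. natural_on R UNIV (trm K (n - 1)) (trm F 0) \<Theta> \<and>
      (\<forall>a. \<forall>m\<in>carrier (ob (trm K (n - 1)) a). \<epsilon> a (\<Theta> a m) = hcl K (n - 1) a (r a m))"
    using projective_K F.pm K.pm_homology natural_on_\<epsilon> q
    by (rule projective_lift) (use \<epsilon>_surj natural_on_closed[OF q UNIV_I] in blast)
  then obtain \<Theta> where \<Theta>: "natural_on R UNIV (trm K (n - 1)) (trm F 0) \<Theta>"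
    and "\<And>a m. m \<in> carrier (ob (trm K (n - 1)) a) \<Longrightarrow> \<epsilon> a (\<Theta> a m) = hcl K (n - 1) a (r a m)"
    by blast
  then have \<epsilon>\<Theta>: "\<epsilon> a (\<Theta> a z) = hcl K (n - 1) a z" if "z \<in> carrier (ob (cycles K (n - 1)) a)" for a z
    using that by (simp add: rz mem_cycles)
  have "natural_on R UNIV (trm K n) (trm F 0) (\<lambda>x m. \<Theta> x (diff K n x m))"
    using K.diff \<Theta> by (rule natural_on_comp)
  then have "\<exists>\<Psi>. natural_on R UNIV (trm K n) (trm F 1) \<Psi> \<and>
      (\<forall>a. \<forall>m\<in>carrier (ob (trm K n) a). diff F 1 a (\<Psi> a m) = \<Theta> a (diff K n a m))"
    by (rule lift_ker_\<epsilon>[OF projective_K]) (use hcl_d \<epsilon>\<Theta> in auto)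
  then show ?thesis
    using \<Theta> \<epsilon>\<Theta> unfolding comparison_def by blast
qed

lemma comparison_some:
  obtains \<Theta> where "comparison R n K F \<epsilon> \<Theta> (SOME \<Psi>. \<exists>\<Theta>. comparison R n K F \<epsilon> \<Theta> \<Psi>)"
  using someI_ex[OF comparison_exists] by blast

end

section \<open>Pulling back Ext cocycles along a comparison\<close>

locale uct = resolved_complex R n K F \<epsilon>
  for R :: "'r ring" and n and K :: "('p::preordered_ab_group_add, 'r, 'm) pcomplex"
    and F :: "('p, 'r, 'f) pcomplex" and \<epsilon> +
  fixes h :: hom_kind and A :: "('p, 'r, 'a) pmod"
  assumes A: "persistence_module R A"
begin

sublocale HK: hom_cochains h R K A
  by unfold_locales (rule K.is_complex, rule A)

sublocale HF: hom_cochains h R F A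
  by unfold_locales (rule F.is_complex, rule A)

text \<open>By exactness v is of the form d_2 w, and f o d_2 = 0. This turns identities that hold
  after d_1 into identities that hold after f.\<close>

lemma cocycle_ker_d1:
  assumes "f \<in> HF.cocycles 1 s" "x \<in> hom_dom h s" "v \<in> carrier (ob (trm F 1) x)"
    "diff F 1 x v = \<zero>\<^bsub>ob (trm F 0) x\<^esub>"
  shows "f x v = \<zero>\<^bsub>ob (hom_target h s A) x\<^esub>"
  using HF.cocycle_bd[OF assms(1,2) ker_d1[OF assms(3,4)]] .

lemma Ext_eq: "Ext h R 1 F A = Hom_cohomology h R F A 1"
  by (simp add: Ext_def)

context
  fixes \<Theta> \<Psi>
  assumes comparison: "comparison R n K F \<epsilon> \<Theta> \<Psi>"
begin

lemma \<Theta>: "natural_on R UNIV (trm K (n - 1)) (trm F 0) \<Theta>"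
  and \<Psi>: "natural_on R UNIV (trm K n) (trm F 1) \<Psi>"
  and \<epsilon>_\<Theta>: "z \<in> carrier (ob (cycles K (n - 1)) a) \<Longrightarrow> \<epsilon> a (\<Theta> a z) = hcl K (n - 1) a z"
  and d_\<Psi>: "m \<in> carrier (ob (trm K n) a) \<Longrightarrow> diff F 1 a (\<Psi> a m) = \<Theta> a (diff K n a m)"
  using comparison by (auto simp: comparison_def)

abbreviation pull where "pull \<equiv> Hom_map h (trm K n) \<Psi> (\<lambda>x u. u)"

lemma pull_apply: "x \<in> hom_dom h s \<Longrightarrow> m \<in> carrier (ob (trm K n) x) \<Longrightarrow> pull s f x m = f x (\<Psi> x m)"
  by (simp add: Hom_map_eq)

lemma pgroup_hom_pull: "pgroup_hom (Hom h R (trm F 1) A) (Hom h R (trm K n) A) pull"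
  using K.pm A \<Psi> natural_on_ident by (rule pgroup_hom_Hom_map)

text \<open>d_1 \<Psi> z = \<Theta> d z = 0. Thus f o \<Psi> vanishes on all cycles, not only on
  boundaries, which gives both the cocycle condition and the vanishing of \<pi> o \<iota>.\<close>

lemma cocycle_\<Psi>_zero:
  assumes f: "f \<in> HF.cocycles 1 s" and x: "x \<in> hom_dom h s" and z: "z \<in> carrier (ob (cycles K n) x)"
  shows "f x (\<Psi> x z) = \<zero>\<^bsub>ob (hom_target h s A) x\<^esub>"
proof (rule cocycle_ker_d1[OF f x])
  have z': "z \<in> carrier (ob (trm K n) x)" "diff K n x z = \<zero>\<^bsub>ob (trm K (n - 1)) x\<^esub>"
    using z by (auto simp: mem_cycles)
  show "\<Psi> x z \<in> carrier (ob (trm F 1) x)"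
    using natural_on_closed[OF \<Psi> UNIV_I z'(1)] .
  show "diff F 1 x (\<Psi> x z) = \<zero>\<^bsub>ob (trm F 0) x\<^esub>"
    using d_\<Psi>[OF z'(1)] z'(2) natural_on_zero[OF K.pm F.pm \<Theta> UNIV_I] by simp
qed

text \<open>A comparison has no component K_{n+1} -> F_2, so the cocycle condition does not come
  from a chain map; it follows because boundaries are cycles.\<close>

lemma pull_cocycle:
  assumes f: "f \<in> HF.cocycles 1 s"
  shows "pull s f \<in> HK.cocycles n s"
  unfolding HK.mem_cocycles_iff
proof (intro conjI ballI)
  show "pull s f \<in> nat_trans R (hom_dom h s) (trm K n) (hom_target h s A)"
    unfolding Hom_map_eq
    using natural_on_Hom_map[OF HF.cocycle_natural[OF f] \<Psi> natural_on_ident]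
    by (rule natural_on_nat_trans[OF K.pm])
  fix x m assume x: "x \<in> hom_dom h s" and m: "m \<in> carrier (ob (trm K (n + 1)) x)"
  have b: "diff K (n + 1) x m \<in> carrier (ob (cycles K n) x)"
    using m by (intro K.bd_cycles) (auto simp: mem_bd)
  then show "pull s f x (diff K (n + 1) x m) = \<zero>\<^bsub>ob (hom_target h s A) x\<^esub>"
    using cocycle_\<Psi>_zero[OF f x b] x by (simp add: pull_apply mem_cycles)
qed

lemma coset_map_pull:
  assumes f: "f \<in> HF.cocycles 1 s"
  shows "coset_map (ob (Hom_cochains h R K A n) s) (cobound (Hom_cochains h R K A) (Hom_diff h K) n s)
      (pull s) (HF.cls 1 s f) = HK.cls n s (pull s f)"
  by (rule coset_map_cls[OF F.is_complex K.is_complex A A natural_on_ident \<Psi>])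
    (use \<Theta> d_\<Psi> f in \<open>auto simp: HF.mem_cocycles_iff\<close>)

text \<open>\<Gamma> is \<epsilon> lifted through the projection of cycles onto homology. Then
  \<epsilon> (\<Theta> \<Gamma> u) = [\<Gamma> u] = \<epsilon> u, so \<Theta> \<Gamma> - 1 maps into
  the kernel of \<epsilon> and lifts to \<eta>.\<close>

lemma backward_comparison:
  "\<exists>\<Gamma>. natural_on R UNIV (trm F 0) (cycles K (n - 1)) \<Gamma> \<and>
    (\<forall>a. \<forall>u\<in>carrier (ob (trm F 0) a). hcl K (n - 1) a (\<Gamma> a u) = \<epsilon> a u) \<and>
    (\<exists>\<eta>. natural_on R UNIV (trm F 0) (trm F 1) \<eta> \<and>
      (\<forall>a. \<forall>u\<in>carrier (ob (trm F 0) a).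
         diff F 1 a (\<eta> a u) = \<Theta> a (\<Gamma> a u) \<ominus>\<^bsub>ob (trm F 0) a\<^esub> u))"
proof -
  have "\<exists>\<Gamma>. natural_on R UNIV (trm F 0) (cycles K (n - 1)) \<Gamma> \<and>
    (\<forall>a. \<forall>u\<in>carrier (ob (trm F 0) a). hcl K (n - 1) a (\<Gamma> a u) = \<epsilon> a u)"
    using projective_F K.pm_cycles K.pm_homology K.natural_on_hcl natural_on_\<epsilon>
    by (rule projective_lift) (use \<epsilon>_surj in \<open>auto simp: K.carrier_homology\<close>)
  then obtain \<Gamma> where \<Gamma>: "natural_on R UNIV (trm F 0) (cycles K (n - 1)) \<Gamma>"
    and \<Gamma>\<epsilon>: "\<And>a u. u \<in> carrier (ob (trm F 0) a) \<Longrightarrow> hcl K (n - 1) a (\<Gamma> a u) = \<epsilon> a u"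
    by blast
  have \<Theta>\<Gamma>: "natural_on R UNIV (trm F 0) (trm F 0) (\<lambda>a u. \<Theta> a (\<Gamma> a u))"
    using \<Gamma> K.natural_on_from_cycles[OF \<Theta>] by (rule natural_on_comp)
  have "natural_on R UNIV (trm F 0) (trm F 0) (\<lambda>a u. \<Theta> a (\<Gamma> a u) \<ominus>\<^bsub>ob (trm F 0) a\<^esub> u)"
    by (intro natural_on_diff F.pm \<Theta>\<Gamma> natural_on_ident)
  then have "\<exists>\<eta>. natural_on R UNIV (trm F 0) (trm F 1) \<eta> \<and> (\<forall>a. \<forall>u\<in>carrier (ob (trm F 0) a).
      diff F 1 a (\<eta> a u) = \<Theta> a (\<Gamma> a u) \<ominus>\<^bsub>ob (trm F 0) a\<^esub> u)"
  proof (rule lift_ker_\<epsilon>[OF projective_F])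
    fix a u assume u: "u \<in> carrier (ob (trm F 0) a)"
    interpret H: abelian_group "ob (homology K (n - 1)) a" using K.pm_homology by (rule pm_abelian_group)
    have "\<epsilon> a (\<Theta> a (\<Gamma> a u)) = \<epsilon> a u"
      using \<epsilon>_\<Theta>[OF natural_on_closed[OF \<Gamma> UNIV_I u]] \<Gamma>\<epsilon>[OF u] by simp
    then show "\<epsilon> a (\<Theta> a (\<Gamma> a u) \<ominus>\<^bsub>ob (trm F 0) a\<^esub> u) = \<zero>\<^bsub>ob (homology K (n - 1)) a\<^esub>"
      using natural_on_minus[OF F.pm K.pm_homology natural_on_\<epsilon> UNIV_I natural_on_closed[OF \<Theta>\<Gamma> UNIV_I u] u]
        natural_on_closed[OF natural_on_\<epsilon> UNIV_I u] by (simp add: H.minus_self)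
  qed
  then show ?thesis using \<Gamma> \<Gamma>\<epsilon> by blast
qed

text \<open>If \<open>f \<circ> \<Psi> = k \<circ> d\<close>, then \<open>f = (k \<circ> \<Gamma> - f \<circ> \<eta>) \<circ> d\<^sub>1\<close>.\<close>

lemma pull_injective:
  assumes f: "f \<in> HF.cocycles 1 s" and one: "HK.cls n s (pull s f) = \<one>\<^bsub>ob (Hom_cohomology h R K A n) s\<^esub>"
  shows "HF.cls 1 s f = \<one>\<^bsub>ob (Hom_cohomology h R F A 1) s\<^esub>"
proof -
  obtain \<Gamma> \<eta> where \<Gamma>: "natural_on R UNIV (trm F 0) (cycles K (n - 1)) \<Gamma>"
    and \<Gamma>\<epsilon>: "\<And>a u. u \<in> carrier (ob (trm F 0) a) \<Longrightarrow> hcl K (n - 1) a (\<Gamma> a u) = \<epsilon> a u"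
    and \<eta>: "natural_on R UNIV (trm F 0) (trm F 1) \<eta>"
    and d\<eta>: "\<And>a u. u \<in> carrier (ob (trm F 0) a) \<Longrightarrow> diff F 1 a (\<eta> a u) = \<Theta> a (\<Gamma> a u) \<ominus>\<^bsub>ob (trm F 0) a\<^esub> u"
    using backward_comparison by blast
  note fn = HF.cocycle_natural[OF f]
  obtain k where k: "natural_on R (hom_dom h s) (trm K (n - 1)) (hom_target h s A) k"
    and fk: "\<And>x m. x \<in> hom_dom h s \<Longrightarrow> m \<in> carrier (ob (trm K n) x) \<Longrightarrow> f x (\<Psi> x m) = k x (diff K n x m)"
    using pull_cocycle[OF f] one by (auto simp: HK.mem_cocycles_iff HK.cls_one_iff_natural pull_apply)
  let ?k = "\<lambda>x u. k x (\<Gamma> x u) \<ominus>\<^bsub>ob (hom_target h s A) x\<^esub> f x (\<eta> x u)"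
  have k\<Gamma>: "natural_on R (hom_dom h s) (trm F 0) (hom_target h s A) (\<lambda>x u. k x (\<Gamma> x u))"
    using natural_on_mono[OF \<Gamma> subset_UNIV] K.natural_on_from_cycles[OF k] by (rule natural_on_comp)
  have f\<eta>: "natural_on R (hom_dom h s) (trm F 0) (hom_target h s A) (\<lambda>x u. f x (\<eta> x u))"
    using natural_on_mono[OF \<eta> subset_UNIV] fn by (rule natural_on_comp)
  have nat: "natural_on R (hom_dom h s) (trm F 0) (hom_target h s A) ?k"
    using F.pm HK.target k\<Gamma> f\<eta> by (rule natural_on_diff)
  have "f x v = ?k x (diff F 1 x v)" if x: "x \<in> hom_dom h s" and v: "v \<in> carrier (ob (trm F 1) x)" for x v
  proof -
    interpret T: abelian_group "ob (hom_target h s A) x" using HK.target by (rule pm_abelian_group)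
    interpret F0: abelian_group "ob (trm F 0) x" by (rule F.abelian_group_trm)
    interpret F1: abelian_group "ob (trm F 1) x" by (rule F.abelian_group_trm)
    let ?u = "diff F 1 x v"
    have u: "?u \<in> carrier (ob (trm F 0) x)" using natural_on_closed[OF diff_F1 UNIV_I v] .
    \<comment> \<open>So \<Gamma> d_1 v represents the zero class and can be written as d m, where
      the relation between f o \<Psi> and k applies.\<close>
    have "\<epsilon> x ?u = \<zero>\<^bsub>ob (homology K (n - 1)) x\<^esub>"
      using ker_\<epsilon>[OF u] v by blast
    then have "\<Gamma> x ?u \<in> bd K (n - 1) x"
      using K.hcl_zero_iff[OF natural_on_closed[OF \<Gamma> UNIV_I u]] \<Gamma>\<epsilon>[OF u] by simp
    then obtain m where m: "m \<in> carrier (ob (trm K n) x)" and \<Gamma>u: "\<Gamma> x ?u = diff K n x m"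
      unfolding mem_bd_pred by blast
    \<comment> \<open>With u = d_1 v and \<Gamma> u = d m, d_1 sends this to \<Theta> \<Gamma> u -
      (\<Theta> \<Gamma> u - u) - u = 0, so f annihilates it. Solving for f v, and using f \<Psi> m
      = k \<Gamma> u, gives the claim.\<close>
    let ?w = "\<Psi> x m \<ominus>\<^bsub>ob (trm F 1) x\<^esub> \<eta> x ?u \<ominus>\<^bsub>ob (trm F 1) x\<^esub> v"
    note \<Psi>m = natural_on_closed[OF \<Psi> UNIV_I m] and \<eta>u = natural_on_closed[OF \<eta> UNIV_I u]
    have \<Theta>u: "\<Theta> x (\<Gamma> x ?u) \<in> carrier (ob (trm F 0) x)"
      using natural_on_closed[OF K.natural_on_from_cycles[OF \<Theta>] UNIV_I natural_on_closed[OF \<Gamma> UNIV_I u]] .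
    note minus = F1.minus_closed[OF \<Psi>m \<eta>u]
    have "diff F 1 x ?w = \<Theta> x (\<Gamma> x ?u) \<ominus>\<^bsub>ob (trm F 0) x\<^esub> (\<Theta> x (\<Gamma> x ?u) \<ominus>\<^bsub>ob (trm F 0) x\<^esub> ?u) \<ominus>\<^bsub>ob (trm F 0) x\<^esub> ?u"
      unfolding natural_on_minus[OF F.pm F.pm diff_F1 UNIV_I minus v]
        natural_on_minus[OF F.pm F.pm diff_F1 UNIV_I \<Psi>m \<eta>u] d_\<Psi>[OF m] d\<eta>[OF u] \<Gamma>u[symmetric] ..
    also have "\<dots> = \<zero>\<^bsub>ob (trm F 0) x\<^esub>"
      using \<Theta>u u by (simp add: F0.minus_minus_self F0.minus_self)
    finally have "f x ?w = \<zero>\<^bsub>ob (hom_target h s A) x\<^esub>"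
      by (rule cocycle_ker_d1[OF f x F1.minus_closed[OF minus v]])
    then have "f x (\<Psi> x m) \<ominus>\<^bsub>ob (hom_target h s A) x\<^esub> f x (\<eta> x ?u) \<ominus>\<^bsub>ob (hom_target h s A) x\<^esub> f x v = \<zero>\<^bsub>ob (hom_target h s A) x\<^esub>"
      unfolding natural_on_minus[OF F.pm HK.target fn x minus v] natural_on_minus[OF F.pm HK.target fn x \<Psi>m \<eta>u] .
    then have "f x (\<Psi> x m) \<ominus>\<^bsub>ob (hom_target h s A) x\<^esub> f x (\<eta> x ?u) = f x v"
      by (rule T.minus_eq_zeroD[OF T.minus_closed[OF natural_on_closed[OF fn x \<Psi>m]
              natural_on_closed[OF fn x \<eta>u]] natural_on_closed[OF fn x v]])
    then show ?thesis
      using fk[OF x m] \<Gamma>u by simp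
  qed
  \<comment> \<open>The index 1 - 1 is kept in the form that \<open>cls_one_iff_natural\<close> has
    at degree 1.\<close>
  then have "\<exists>k. natural_on R (hom_dom h s) (trm F (1 - 1)) (hom_target h s A) k \<and>
     (\<forall>x\<in>hom_dom h s. \<forall>v\<in>carrier (ob (trm F 1) x). f x v = k x (diff F 1 x v))"
    using nat by (intro exI[of _ ?k]) simp
  then show ?thesis
    using f by (subst HF.cls_one_iff_natural) (auto simp: HF.mem_cocycles_iff)
qed

text \<open>
  If \<open>c\<close> vanishes on cycles, then \<open>c = c \<circ> j \<circ> d\<close>, and \<open>f = c \<circ> j \<circ> \<Gamma> \<circ> d\<^sub>1\<close> is the desired preimage, as
  \<open>c - f \<circ> \<Psi> = (c \<circ> j \<circ> (1 - \<Gamma> \<circ> \<Theta>) \<circ> r) \<circ> d\<close>.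
\<close>

lemma pull_onto_kernel:
  assumes c: "c \<in> HK.cocycles n s"
    and c0: "\<And>x z. x \<in> hom_dom h s \<Longrightarrow> z \<in> carrier (ob (cycles K n) x) \<Longrightarrow> c x z = \<zero>\<^bsub>ob (hom_target h s A) x\<^esub>"
  shows "\<exists>f\<in>HF.cocycles 1 s. HK.cls n s (pull s f) = HK.cls n s c"
proof -
  obtain \<Gamma> where \<Gamma>: "natural_on R UNIV (trm F 0) (cycles K (n - 1)) \<Gamma>"
    and \<Gamma>\<epsilon>: "\<And>a u. u \<in> carrier (ob (trm F 0) a) \<Longrightarrow> hcl K (n - 1) a (\<Gamma> a u) = \<epsilon> a u"
    using backward_comparison by blast
  obtain j where j: "natural_on R UNIV (boundaries K (n - 1)) (trm K n) j"
    and dj: "\<And>a b. b \<in> bd K (n - 1) a \<Longrightarrow> diff K n a (j a b) = b"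
    using boundaries_section[OF admissible] by blast
  obtain r where r: "natural_on R UNIV (trm K (n - 1)) (cycles K (n - 1)) r"
    and rz: "\<And>a z. z \<in> carrier (ob (cycles K (n - 1)) a) \<Longrightarrow> r a z = z"
    using cycles_retraction[OF admissible] by blast
  note cn = HK.cocycle_natural[OF c]
  have cj: "natural_on R (hom_dom h s) (boundaries K (n - 1)) (hom_target h s A) (\<lambda>x b. c x (j x b))"
    using natural_on_mono[OF j subset_UNIV] cn by (rule natural_on_comp)
  \<comment> \<open>Since d j = 1 on boundaries, j d m - m is a cycle, and c vanishes on cycles by
    assumption.\<close>
  have cjd: "c x (j x (diff K n x m)) = c x m" if x: "x \<in> hom_dom h s" and m: "m \<in> carrier (ob (trm K n) x)" for x m
  proof -
    interpret T: abelian_group "ob (hom_target h s A) x" using HK.target by (rule pm_abelian_group)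
    interpret K0: abelian_group "ob (trm K (n - 1)) x" by (rule K.abelian_group_trm)
    interpret Kn: abelian_group "ob (trm K n) x" by (rule K.abelian_group_trm)
    have b: "diff K n x m \<in> bd K (n - 1) x" unfolding mem_bd_pred using m by blast
    then have jd: "j x (diff K n x m) \<in> carrier (ob (trm K n) x)"
      using natural_on_closed[OF j UNIV_I] by (simp add: K.carrier_boundaries)
    have "diff K n x (j x (diff K n x m) \<ominus>\<^bsub>ob (trm K n) x\<^esub> m) = \<zero>\<^bsub>ob (trm K (n - 1)) x\<^esub>"
      using natural_on_minus[OF K.pm K.pm K.diff UNIV_I jd m] dj[OF b]
        natural_on_closed[OF K.diff UNIV_I m] by (simp add: K0.minus_self)
    then have "c x (j x (diff K n x m) \<ominus>\<^bsub>ob (trm K n) x\<^esub> m) = \<zero>\<^bsub>ob (hom_target h s A) x\<^esub>"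
      using jd m by (intro c0 x) (simp add: mem_cycles)
    then show ?thesis
      using natural_on_minus[OF K.pm HK.target cn x jd m] natural_on_closed[OF cn x] jd m
      by (metis T.minus_eq_zeroD)
  qed
  \<comment> \<open>Needed for \<open>j\<close> to apply: the class of \<Gamma> d_1 v is \<epsilon>
    d_1 v = 0, so it is a boundary.\<close>
  have \<Gamma>d: "natural_on R UNIV (trm F 1) (boundaries K (n - 1)) (\<lambda>x v. \<Gamma> x (diff F 1 x v))"
    unfolding K.natural_on_boundaries_iff
  proof (intro conjI ballI)
    show "natural_on R UNIV (trm F 1) (trm K (n - 1)) (\<lambda>x v. \<Gamma> x (diff F 1 x v))"
      using natural_on_comp[OF diff_F1 \<Gamma>] by (simp add: K.natural_on_cycles_iff)
    fix x v assume v: "v \<in> carrier (ob (trm F 1) x)"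
    have u: "diff F 1 x v \<in> carrier (ob (trm F 0) x)" using natural_on_closed[OF diff_F1 UNIV_I v] .
    have "\<epsilon> x (diff F 1 x v) = \<zero>\<^bsub>ob (homology K (n - 1)) x\<^esub>"
      using ker_\<epsilon>[OF u] v by blast
    then show "\<Gamma> x (diff F 1 x v) \<in> bd K (n - 1) x"
      using K.hcl_zero_iff[OF natural_on_closed[OF \<Gamma> UNIV_I u]] \<Gamma>\<epsilon>[OF u] by simp
  qed
  let ?f = "\<lambda>x v. c x (j x (\<Gamma> x (diff F 1 x v)))"
  let ?F = "extend (hom_dom h s) (trm F 1) ?f"
  have f: "natural_on R (hom_dom h s) (trm F 1) (hom_target h s A) ?f"
    using natural_on_mono[OF \<Gamma>d subset_UNIV] cj by (rule natural_on_comp)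
  have Fc: "?F \<in> HF.cocycles 1 s"
    unfolding HF.mem_cocycles_iff
  proof (intro conjI ballI)
    show "?F \<in> nat_trans R (hom_dom h s) (trm F 1) (hom_target h s A)"
      using F.pm f by (rule natural_on_nat_trans)
    fix x m assume x: "x \<in> hom_dom h s" and m: "m \<in> carrier (ob (trm F (1 + 1)) x)"
    have "?F x (diff F (1 + 1) x m) = c x (j x (\<Gamma> x \<zero>\<^bsub>ob (trm F 0) x\<^esub>))"
      using x natural_on_closed[OF F.diff_Suc UNIV_I m] F.dd_Suc[OF m] by simp
    also have "\<Gamma> x \<zero>\<^bsub>ob (trm F 0) x\<^esub> = \<zero>\<^bsub>ob (boundaries K (n - 1)) x\<^esub>"
      using natural_on_zero[OF F.pm K.pm_cycles \<Gamma> UNIV_I] by (simp add: cycles_def boundaries_def)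
    finally show "?F x (diff F (1 + 1) x m) = \<zero>\<^bsub>ob (hom_target h s A) x\<^esub>"
      using natural_on_zero[OF K.pm_boundaries HK.target cj x] by simp
  qed
  \<comment> \<open>(1 - \<Gamma> \<Theta>) r takes values in boundaries, because
    [\<Gamma> \<Theta> r y] = \<epsilon> \<Theta> r y = [r y]. The last equality holds only on
    cycles; this is what r is for.\<close>
  let ?\<beta> = "\<lambda>x y. r x y \<ominus>\<^bsub>ob (trm K (n - 1)) x\<^esub> \<Gamma> x (\<Theta> x (r x y))"
  have r': "natural_on R UNIV (trm K (n - 1)) (trm K (n - 1)) r"
    using r by (simp add: K.natural_on_cycles_iff)
  have \<Gamma>\<Theta>r: "natural_on R UNIV (trm K (n - 1)) (cycles K (n - 1)) (\<lambda>x y. \<Gamma> x (\<Theta> x (r x y)))"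
    using natural_on_comp[OF natural_on_comp[OF r' \<Theta>] \<Gamma>] .
  have \<beta>: "natural_on R UNIV (trm K (n - 1)) (boundaries K (n - 1)) ?\<beta>"
    unfolding K.natural_on_boundaries_iff
  proof (intro conjI ballI)
    show "natural_on R UNIV (trm K (n - 1)) (trm K (n - 1)) ?\<beta>"
      using \<Gamma>\<Theta>r by (intro natural_on_diff K.pm r') (simp add: K.natural_on_cycles_iff)
    fix x y assume y: "y \<in> carrier (ob (trm K (n - 1)) x)"
    note ry = natural_on_closed[OF r UNIV_I y] and ry' = natural_on_closed[OF r' UNIV_I y]
    have "hcl K (n - 1) x (r x y) = hcl K (n - 1) x (\<Gamma> x (\<Theta> x (r x y)))"
      using \<Gamma>\<epsilon>[OF natural_on_closed[OF \<Theta> UNIV_I ry']] \<epsilon>_\<Theta>[OF ry] by simp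
    then show "?\<beta> x y \<in> bd K (n - 1) x"
      using K.hcl_eq_iff[OF ry natural_on_closed[OF \<Gamma>\<Theta>r UNIV_I y]] by simp
  qed
  let ?k = "\<lambda>x y. c x (j x (?\<beta> x y))"
  have k: "natural_on R (hom_dom h s) (trm K (n - 1)) (hom_target h s A) ?k"
    using natural_on_mono[OF \<beta> subset_UNIV] cj by (rule natural_on_comp)
  have ck: "c x m = ?k x (diff K n x m) \<oplus>\<^bsub>ob (hom_target h s A) x\<^esub> pull s ?F x m"
    if x: "x \<in> hom_dom h s" and m: "m \<in> carrier (ob (trm K n) x)" for x m
  proof -
    interpret T: abelian_group "ob (hom_target h s A) x" using HK.target by (rule pm_abelian_group)
    interpret K0: abelian_group "ob (trm K (n - 1)) x" by (rule K.abelian_group_trm)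
    let ?b = "diff K n x m"
    have b: "?b \<in> carrier (ob (trm K (n - 1)) x)" using natural_on_closed[OF K.diff UNIV_I m] .
    have rb: "r x ?b = ?b" using hcl_d[OF m] by (simp add: rz)
    have bb: "?b \<in> carrier (ob (boundaries K (n - 1)) x)"
      unfolding K.carrier_boundaries mem_bd_pred using m by blast
    note \<Psi>m = natural_on_closed[OF \<Psi> UNIV_I m]
    \<comment> \<open>\<Theta> d m = d_1 \<Psi> m puts this element in the range of \<Gamma> d_1;
      the same identity later recognizes its image under c o j as f \<Psi> m.\<close>
    have g: "\<Gamma> x (\<Theta> x ?b) \<in> carrier (ob (boundaries K (n - 1)) x)"
      using natural_on_closed[OF \<Gamma>d UNIV_I \<Psi>m] d_\<Psi>[OF m] by simp
    have g': "\<Gamma> x (\<Theta> x ?b) \<in> carrier (ob (trm K (n - 1)) x)"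
      using natural_on_closed[OF \<Gamma>\<Theta>r UNIV_I b] by (simp add: rb mem_cycles)
    have \<beta>b: "?\<beta> x ?b \<in> carrier (ob (boundaries K (n - 1)) x)"
      using natural_on_closed[OF \<beta> UNIV_I b] .
    \<comment> \<open>The decomposition is made inside the boundaries, where c o j is
      additive.\<close>
    have "?\<beta> x ?b \<oplus>\<^bsub>ob (boundaries K (n - 1)) x\<^esub> \<Gamma> x (\<Theta> x ?b) = ?b"
      using b g' by (simp add: rb boundaries_def a_minus_def K0.a_assoc K0.l_neg)
    then have "?k x ?b \<oplus>\<^bsub>ob (hom_target h s A) x\<^esub> c x (j x (\<Gamma> x (\<Theta> x ?b))) = c x (j x ?b)"
      using natural_on_add[OF cj x \<beta>b g] by simp
    moreover have "pull s ?F x m = c x (j x (\<Gamma> x (\<Theta> x ?b)))"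
      using x m \<Psi>m by (simp add: pull_apply d_\<Psi>)
    ultimately show ?thesis
      using cjd[OF x m] by simp
  qed
  have "HK.cls n s c = HK.cls n s (pull s ?F)"
  proof (rule HK.cls_eq_iff_natural[THEN iffD2])
    show "c \<in> nat_trans R (hom_dom h s) (trm K n) (hom_target h s A)"
      "pull s ?F \<in> nat_trans R (hom_dom h s) (trm K n) (hom_target h s A)"
      using c pull_cocycle[OF Fc] by (auto simp: HK.mem_cocycles_iff)
  qed (intro exI[of _ ?k] conjI ballI k ck)
  from this[symmetric] Fc show ?thesis by (rule bexI)
qed

end

end

section \<open>\<iota> as a morphism of persistence groups, and exactness\<close>

context uct
begin

lemma uct_inj_cls:
  assumes "f \<in> HF.cocycles 1 s"
  shows "uct_inj h R n K F \<epsilon> A s (HF.cls 1 s f) =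
    HK.cls n s (Hom_map h (trm K n) (SOME \<Psi>. \<exists>\<Theta>. comparison R n K F \<epsilon> \<Theta> \<Psi>) (\<lambda>x u. u) s f)"
proof -
  obtain \<Theta> where C: "comparison R n K F \<epsilon> \<Theta> (SOME \<Psi>. \<exists>\<Theta>. comparison R n K F \<epsilon> \<Theta> \<Psi>)"
    by (rule comparison_some)
  show ?thesis
    unfolding uct_inj_def using C assms by (rule coset_map_pull)
qed

lemma pgroup_hom_uct_inj: "pgroup_hom (Ext h R 1 F A) (Hom_cohomology h R K A n) (uct_inj h R n K F \<epsilon> A)"
proof -
  define \<Psi> where "\<Psi> = (SOME \<Psi>. \<exists>\<Theta>. comparison R n K F \<epsilon> \<Theta> \<Psi>)"
  obtain \<Theta> where C: "comparison R n K F \<epsilon> \<Theta> \<Psi>"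
    unfolding \<Psi>_def by (rule comparison_some)
  let ?pull = "Hom_map h (trm K n) \<Psi> (\<lambda>x u. u)"
  note pull = pgroup_hom_pull[OF C]
  note inj_cls = uct_inj_cls[folded \<Psi>_def]
  note coc = pull_cocycle[OF C]
  show ?thesis
    unfolding pgroup_hom_def
  proof (intro conjI allI impI ballI)
    fix s t X
    show "uct_inj h R n K F \<epsilon> A s \<in> hom (ob (Ext h R 1 F A) s) (ob (Hom_cohomology h R K A n) s)"
    proof (rule homI)
      fix X Y assume "X \<in> carrier (ob (Ext h R 1 F A) s)" "Y \<in> carrier (ob (Ext h R 1 F A) s)"
      then obtain f g where f: "f \<in> HF.cocycles 1 s" "X = HF.cls 1 s f" and g: "g \<in> HF.cocycles 1 s" "Y = HF.cls 1 s g"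
        by (auto simp: Ext_eq HF.carrier_Hom_cohomology)
      show "uct_inj h R n K F \<epsilon> A s X \<in> carrier (ob (Hom_cohomology h R K A n) s)"
        unfolding f(2) inj_cls[OF f(1)] HK.carrier_Hom_cohomology using coc[OF f(1)] by (rule imageI)
      have "X \<otimes>\<^bsub>ob (Ext h R 1 F A) s\<^esub> Y = HF.cls 1 s (f \<otimes>\<^bsub>ob (Hom_cochains h R F A 1) s\<^esub> g)"
        unfolding f(2) g(2) Ext_eq Hom_cohomology_def using f(1) g(1) by (rule HF.cls_mult)
      then have "uct_inj h R n K F \<epsilon> A s (X \<otimes>\<^bsub>ob (Ext h R 1 F A) s\<^esub> Y) =
          HK.cls n s (?pull s (f \<otimes>\<^bsub>ob (Hom_cochains h R F A 1) s\<^esub> g))"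
        using inj_cls[OF subgroup.m_closed[OF HF.subgroup_cocycles f(1) g(1)]] by simp
      also have "?pull s (f \<otimes>\<^bsub>ob (Hom_cochains h R F A 1) s\<^esub> g) =
          ?pull s f \<otimes>\<^bsub>ob (Hom_cochains h R K A n) s\<^esub> ?pull s g"
        using pull f(1) g(1) by (simp add: pgroup_hom_def hom_def Hom_cochains_def HF.cocycles_def)
      also have "HK.cls n s \<dots> = HK.cls n s (?pull s f) \<otimes>\<^bsub>ob (Hom_cohomology h R K A n) s\<^esub> HK.cls n s (?pull s g)"
        unfolding Hom_cohomology_def using coc[OF f(1)] coc[OF g(1)] by (rule HK.cls_mult[symmetric])
      finally show "uct_inj h R n K F \<epsilon> A s (X \<otimes>\<^bsub>ob (Ext h R 1 F A) s\<^esub> Y) =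
          uct_inj h R n K F \<epsilon> A s X \<otimes>\<^bsub>ob (Hom_cohomology h R K A n) s\<^esub> uct_inj h R n K F \<epsilon> A s Y"
        unfolding f(2) g(2) inj_cls[OF f(1)] inj_cls[OF g(1)] .
    qed
    assume st: "s \<le> t" and "X \<in> carrier (ob (Ext h R 1 F A) s)"
    then obtain f where f: "f \<in> HF.cocycles 1 s" "X = HF.cls 1 s f"
      by (auto simp: Ext_eq HF.carrier_Hom_cohomology)
    have fc: "f \<in> carrier (ob (Hom_cochains h R F A 1) s)"
      using f(1) by (simp add: HF.cocycles_def)
    have "uct_inj h R n K F \<epsilon> A t (tr (Ext h R 1 F A) s t X) = HK.cls n t (?pull t (tr (Hom_cochains h R F A 1) s t f))"
      unfolding f(2) Ext_eq Hom_cohomology_def HF.tr_cls[OF st fc] by (rule inj_cls[OF HF.tr_cocycles[OF st f(1)]])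
    also have "?pull t (tr (Hom_cochains h R F A 1) s t f) = tr (Hom_cochains h R K A n) s t (?pull s f)"
      using pull st fc by (simp add: pgroup_hom_def Hom_cochains_def)
    also have "HK.cls n t \<dots> = tr (Hom_cohomology h R K A n) s t (HK.cls n s (?pull s f))"
      unfolding Hom_cohomology_def
      using coc[OF f(1)] by (intro HK.tr_cls[symmetric] st) (simp add: HK.cocycles_def)
    finally show "uct_inj h R n K F \<epsilon> A t (tr (Ext h R 1 F A) s t X) =
        tr (Hom_cohomology h R K A n) s t (uct_inj h R n K F \<epsilon> A s X)"
      unfolding f(2) inj_cls[OF f(1)] .
  qed
qed

lemma uct_inj_kernel:
  assumes "X \<in> carrier (ob (Ext h R 1 F A) s)"
    and "uct_inj h R n K F \<epsilon> A s X = \<one>\<^bsub>ob (Hom_cohomology h R K A n) s\<^esub>"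
  shows "X = \<one>\<^bsub>ob (Ext h R 1 F A) s\<^esub>"
proof -
  obtain f where f: "f \<in> HF.cocycles 1 s" "X = HF.cls 1 s f"
    using assms(1) by (auto simp: Ext_eq HF.carrier_Hom_cohomology)
  obtain \<Theta> where C: "comparison R n K F \<epsilon> \<Theta> (SOME \<Psi>. \<exists>\<Theta>. comparison R n K F \<epsilon> \<Theta> \<Psi>)"
    by (rule comparison_some)
  show ?thesis
    using pull_injective[OF C f(1)] assms(2) unfolding f(2) uct_inj_cls[OF f(1)] Ext_eq by blast
qed

lemma uct_exact:
  "uct_inj h R n K F \<epsilon> A s ` carrier (ob (Ext h R 1 F A) s) =
    kernel (ob (Hom_cohomology h R K A n) s) (ob (Hom h R (homology K n) A) s) (uct_proj h n K s)"
proof -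
  define \<Psi> where "\<Psi> = (SOME \<Psi>. \<exists>\<Theta>. comparison R n K F \<epsilon> \<Theta> \<Psi>)"
  obtain \<Theta> where C: "comparison R n K F \<epsilon> \<Theta> \<Psi>"
    unfolding \<Psi>_def by (rule comparison_some)
  let ?pull = "Hom_map h (trm K n) \<Psi> (\<lambda>x u. u)"
  let ?zero = "extend (hom_dom h s) (homology K n) (\<lambda>x m. \<zero>\<^bsub>ob (hom_target h s A) x\<^esub>)"
  have one: "\<one>\<^bsub>ob (Hom h R (homology K n) A) s\<^esub> = ?zero"
    by (simp add: ob_Hom one_hom_group)
  have zero: "?zero \<in> nat_trans R (hom_dom h s) (homology K n) (hom_target h s A)"
    using K.pm_homology natural_on_null[OF HK.target] by (rule natural_on_nat_trans)
  have hcl: "hcl K n x z \<in> carrier (ob (homology K n) x)" if "z \<in> carrier (ob (cycles K n) x)" for x z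
    using that by (simp add: K.carrier_homology)
  show ?thesis
  proof (intro equalityI subsetI)
    fix Y assume "Y \<in> uct_inj h R n K F \<epsilon> A s ` carrier (ob (Ext h R 1 F A) s)"
    then obtain f where f: "f \<in> HF.cocycles 1 s" and Y: "Y = uct_inj h R n K F \<epsilon> A s (HF.cls 1 s f)"
      by (auto simp: Ext_eq HF.carrier_Hom_cohomology)
    have Y': "Y = HK.cls n s (?pull s f)"
      unfolding Y uct_inj_cls[OF f] \<Psi>_def ..
    have "uct_proj h n K s Y = \<one>\<^bsub>ob (Hom h R (homology K n) A) s\<^esub>"
      unfolding Y' one using pull_cocycle[OF C f] zero
    proof (rule HK.uct_proj_eqI)
      fix x z assume x: "x \<in> hom_dom h s" and z: "z \<in> carrier (ob (cycles K n) x)"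
      then show "?pull s f x z = ?zero x (hcl K n x z)"
        using cocycle_\<Psi>_zero[OF C f x z] hcl[OF z] by (simp add: Hom_map_eq mem_cycles)
    qed
    then show "Y \<in> kernel (ob (Hom_cohomology h R K A n) s) (ob (Hom h R (homology K n) A) s) (uct_proj h n K s)"
      using pull_cocycle[OF C f] by (simp add: kernel_def Y' HK.carrier_Hom_cohomology)
  next
    fix Y assume "Y \<in> kernel (ob (Hom_cohomology h R K A n) s) (ob (Hom h R (homology K n) A) s) (uct_proj h n K s)"
    then obtain c where c: "c \<in> HK.cocycles n s" and Y: "Y = HK.cls n s c" and pY: "uct_proj h n K s (HK.cls n s c) = ?zero"
      by (auto simp: kernel_def HK.carrier_Hom_cohomology one)
    \<comment> \<open>The kernel of \<pi> consists of the classes of cocycles vanishing on all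
      cycles, which is the hypothesis of \<open>pull_onto_kernel\<close>.\<close>
    have "c x z = \<zero>\<^bsub>ob (hom_target h s A) x\<^esub>" if x: "x \<in> hom_dom h s" and z: "z \<in> carrier (ob (cycles K n) x)" for x z
      using HK.uct_proj_cls[OF c x z] x hcl[OF z] unfolding pY by simp
    then obtain f where f: "f \<in> HF.cocycles 1 s" "HK.cls n s (?pull s f) = HK.cls n s c"
      using pull_onto_kernel[OF C c] by blast
    then have "Y = uct_inj h R n K F \<epsilon> A s (HF.cls 1 s f)"
      unfolding uct_inj_cls[OF f(1)] Y \<Psi>_def by simp
    moreover have "HF.cls 1 s f \<in> carrier (ob (Ext h R 1 F A) s)"
      using f(1) by (simp add: Ext_eq HF.carrier_Hom_cohomology)
    ultimately show "Y \<in> uct_inj h R n K F \<epsilon> A s ` carrier (ob (Ext h R 1 F A) s)"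
      by (rule image_eqI)
  qed
qed

text \<open>The section obtained from the retraction onto cycles is used twice: for surjectivity of
  \<pi> and for the splitting. Injectivity of \<iota> is reduced to a trivial kernel.\<close>

lemma uct_split_short_exact:
  "split_short_exact (Ext h R 1 F A) (Hom_cohomology h R K A n) (Hom h R (homology K n) A)
     (uct_inj h R n K F \<epsilon> A) (uct_proj h n K)"
proof -
  obtain \<sigma> where \<sigma>: "pgroup_hom (Hom h R (homology K n) A) (Hom_cohomology h R K A n) \<sigma>"
    and \<pi>\<sigma>: "\<And>s g. g \<in> carrier (ob (Hom h R (homology K n) A) s) \<Longrightarrow> uct_proj h n K s (\<sigma> s g) = g"
    using cycles_retraction[OF admissible, of n] HK.uct_proj_section[of n] by metis
  have pg: "persistence_group (Ext h R 1 F A)" "persistence_group (Hom_cohomology h R K A n)"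
    "persistence_group (Hom h R (homology K n) A)"
    unfolding Ext_eq
    by (rule HF.persistence_group_Hom_cohomology HK.persistence_group_Hom_cohomology
        persistence_group_Hom[OF K.pm_homology A])+
  have "inj_on (uct_inj h R n K F \<epsilon> A s) (carrier (ob (Ext h R 1 F A) s))" for s
  proof -
    interpret group_hom "ob (Ext h R 1 F A) s" "ob (Hom_cohomology h R K A n) s" "uct_inj h R n K F \<epsilon> A s"
      using pg pgroup_hom_uct_inj
      by (simp add: group_hom_def group_hom_axioms_def persistence_group_def comm_group_def pgroup_hom_def)
    show ?thesis
      unfolding inj_on_one_iff using uct_inj_kernel by blast
  qed
  moreover have "uct_proj h n K s ` carrier (ob (Hom_cohomology h R K A n) s) =
      carrier (ob (Hom h R (homology K n) A) s)" for s
  proof (intro equalityI subsetI)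
    fix g assume g: "g \<in> carrier (ob (Hom h R (homology K n) A) s)"
    then have "\<sigma> s g \<in> carrier (ob (Hom_cohomology h R K A n) s)"
      using \<sigma> by (auto simp: pgroup_hom_def hom_def)
    then show "g \<in> uct_proj h n K s ` carrier (ob (Hom_cohomology h R K A n) s)"
      using \<pi>\<sigma>[OF g] by (metis imageI)
  qed (use HK.pgroup_hom_uct_proj in \<open>auto simp: pgroup_hom_def hom_def\<close>)
  ultimately show ?thesis
    unfolding split_short_exact_def short_exact_def
    using pg pgroup_hom_uct_inj HK.pgroup_hom_uct_proj uct_exact \<sigma> \<pi>\<sigma> by blast
qed

end

section \<open>Naturality\<close>

lemma chain_map_natural: "chain_map R K L \<phi> \<Longrightarrow> natural_on R UNIV (trm K i) (trm L i) (\<phi> i)"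
  by (auto simp: chain_map_def intro: nat_trans_natural_on)

lemma chain_map_diff:
  "chain_map R K L \<phi> \<Longrightarrow> m \<in> carrier (ob (trm K i) a) \<Longrightarrow> \<phi> (i - 1) a (diff K i a m) = diff L i a (\<phi> i a m)"
  by (simp add: chain_map_def)

lemma Hom_map_cocycle:
  assumes L: "is_complex R L" and K: "is_complex R K" and A: "persistence_module R A" and A': "persistence_module R A'"
    and \<alpha>: "natural_on R UNIV A A' \<alpha>" and \<phi>: "chain_map R K L \<phi>"
    and c: "c \<in> cochain_complex.cocycles (Hom_cochains h R L A) (Hom_diff h L) n s"
  shows "Hom_map h (trm K n) (\<phi> n) \<alpha> s c \<in> cochain_complex.cocycles (Hom_cochains h R K A') (Hom_diff h K) n s"
proof -
  interpret L: hom_cochains h R L A by unfold_locales fact+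
  interpret K: hom_cochains h R K A' by unfold_locales fact+
  show ?thesis
    unfolding K.mem_cocycles_iff
  proof (intro conjI ballI)
    show "Hom_map h (trm K n) (\<phi> n) \<alpha> s c \<in> nat_trans R (hom_dom h s) (trm K n) (hom_target h s A')"
      unfolding Hom_map_eq
      using natural_on_Hom_map[OF L.cocycle_natural[OF c] chain_map_natural[OF \<phi>] \<alpha>]
      by (rule natural_on_nat_trans[OF complex_pm[OF K]])
    fix x m assume x: "x \<in> hom_dom h s" and m: "m \<in> carrier (ob (trm K (n + 1)) x)"
    have "\<phi> n x (diff K (n + 1) x m) = diff L (n + 1) x (\<phi> (n + 1) x m)"
      using chain_map_diff[OF \<phi> m] by simp
    then have "c x (\<phi> n x (diff K (n + 1) x m)) = \<zero>\<^bsub>ob (hom_target h s A) x\<^esub>"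
      using c x natural_on_closed[OF chain_map_natural[OF \<phi>] UNIV_I m] by (simp add: L.mem_cocycles_iff)
    then show "Hom_map h (trm K n) (\<phi> n) \<alpha> s c x (diff K (n + 1) x m) = \<zero>\<^bsub>ob (hom_target h s A') x\<^esub>"
      using x natural_on_closed[OF complex_diff_Suc[OF K] UNIV_I m]
        natural_on_zero[OF L.target K.target natural_on_target_map[OF \<alpha>] UNIV_I]
      by (simp add: Hom_map_eq)
  qed
qed

text \<open>Evaluated at the class of a cycle z, both sides apply \<alpha> to c (\<phi> z).\<close>

lemma uct_proj_natural:
  assumes K: "is_complex R K" and K': "is_complex R K'"
    and A: "persistence_module R A" and A': "persistence_module R A'"
    and \<alpha>: "natural_on R UNIV A A' \<alpha>" and \<phi>: "chain_map R K K' \<phi>"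
    and y: "y \<in> carrier (ob (Hom_cohomology h R K' A n) s)"
  shows "uct_proj h n K s (Hom_cohomology_map h R K A' \<phi> \<alpha> n s y) =
    Hom_map h (homology K n) (homology_map K K' \<phi> n) \<alpha> s (uct_proj h n K' s y)"
proof -
  interpret K: hom_cochains h R K A' by unfold_locales fact+
  interpret K': hom_cochains h R K' A by unfold_locales fact+
  obtain c where c: "c \<in> K'.cocycles n s" and y: "y = K'.cls n s c"
    using y by (auto simp: K'.carrier_Hom_cohomology)
  have cn: "c \<in> nat_trans R (hom_dom h s) (trm K' n) (hom_target h s A)"
    using c by (simp add: K'.mem_cocycles_iff)
  \<comment> \<open>\<open>homology_map\<close> is given on cosets; its naturality descends from
    that of \<phi> between the cycles.\<close>
  have H: "natural_on R UNIV (homology K n) (homology K' n) (homology_map K K' \<phi> n)"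
  proof (rule natural_on_descend[OF K.K.pm_cycles K.K.natural_on_hcl])
    have "natural_on R UNIV (cycles K n) (cycles K' n) (\<phi> n)"
      unfolding K'.K.natural_on_cycles_iff
      using K.K.natural_on_from_cycles[OF chain_map_natural[OF \<phi>]] homology_map_hcl(1)[OF K K' \<phi>] by blast
    from natural_on_comp[OF this K'.K.natural_on_hcl]
    show "natural_on R UNIV (cycles K n) (homology K' n) (\<lambda>x z. hcl K' n x (\<phi> n x z))" .
  qed (simp_all add: K.K.carrier_homology homology_map_hcl(2)[OF K K' \<phi>])
  have "uct_proj h n K s (K.cls n s (Hom_map h (trm K n) (\<phi> n) \<alpha> s c)) =
    Hom_map h (homology K n) (homology_map K K' \<phi> n) \<alpha> s (uct_proj h n K' s y)"
  proof (rule K.uct_proj_eqI)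
    show "Hom_map h (trm K n) (\<phi> n) \<alpha> s c \<in> K.cocycles n s"
      using K' K A A' \<alpha> \<phi> c by (rule Hom_map_cocycle)
    show "Hom_map h (homology K n) (homology_map K K' \<phi> n) \<alpha> s (uct_proj h n K' s y) \<in>
        nat_trans R (hom_dom h s) (homology K n) (hom_target h s A')"
      unfolding y Hom_map_eq
      using natural_on_Hom_map[OF nat_trans_natural_on[OF K'.uct_proj_nat_trans[OF c]] H \<alpha>]
      by (rule natural_on_nat_trans[OF K.K.pm_homology])
    fix x z assume x: "x \<in> hom_dom h s" and z: "z \<in> carrier (ob (cycles K n) x)"
    then show "Hom_map h (trm K n) (\<phi> n) \<alpha> s c x z =
        Hom_map h (homology K n) (homology_map K K' \<phi> n) \<alpha> s (uct_proj h n K' s y) x (hcl K n x z)"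
      using K'.uct_proj_cls[OF c x homology_map_hcl(1)[OF K K' \<phi> z]]
      by (simp add: Hom_map_eq y mem_cycles[of z K] homology_map_hcl(2)[OF K K' \<phi> z] K.K.carrier_homology)
  qed
  then show ?thesis
    unfolding y Hom_cohomology_map_cls[OF K' K A A' \<alpha> \<phi> cn] .
qed

section \<open>Naturality of \<iota>\<close>

lemma (in abelian_group) minus_minus_eq_zeroD:
  assumes "x \<in> carrier G" "y \<in> carrier G" "z \<in> carrier G" "x \<ominus> y \<ominus> z = \<zero>"
  shows "x = y \<oplus> z"
proof -
  have "x \<ominus> y = z"
    using minus_closed[OF assms(1,2)] assms(3,4) by (rule minus_eq_zeroD)
  then have "y \<oplus> z = y \<oplus> (\<ominus> y \<oplus> x)"
    using assms(1,2) by (simp add: a_minus_def a_comm[of x])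
  also have "\<dots> = x"
    using assms(1,2) by (simp add: a_assoc[symmetric] r_neg)
  finally show ?thesis ..
qed

text \<open>The maps \<Phi>_0 \<Theta> and \<Theta>' \<phi> agree on cycles after applying
  \<epsilon>', so after composing with r they differ by d_1 \<zeta> for some \<zeta> : K_{n-1} ->
  F'_1. Up to the kernel of d_1, which f annihilates, \<Phi>_1 \<Psi> and \<Psi>' \<phi> then differ
  by \<zeta> d, so the two cocycles differ by a coboundary.\<close>

lemma uct_inj_natural:
  fixes K K' :: "('p::preordered_ab_group_add, 'r, 'm) pcomplex" and F F' :: "('p, 'r, 'f) pcomplex"
  assumes K: "admissible_complex R K" and K': "admissible_complex R K'" and \<phi>: "chain_map R K K' \<phi>"
    and F: "projective_resolution R F \<epsilon> (homology K (n - 1))"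
    and F': "projective_resolution R F' \<epsilon>' (homology K' (n - 1))"
    and \<Phi>: "resolution_lift R F \<epsilon> F' \<epsilon>' (homology_map K K' \<phi> (n - 1)) \<Phi>"
    and A: "persistence_module R A" and A': "persistence_module R A'" and \<alpha>: "natural_on R UNIV A A' \<alpha>"
    and X: "X \<in> carrier (ob (Ext h R 1 F' A) s)"
  shows "uct_inj h R n K F \<epsilon> A' s (Ext_map h R 1 F A' \<Phi> \<alpha> s X) =
    Hom_cohomology_map h R K A' \<phi> \<alpha> n s (uct_inj h R n K' F' \<epsilon>' A s X)"
proof -
  interpret U: uct R n K F \<epsilon> h A' by unfold_locales fact+
  interpret U': uct R n K' F' \<epsilon>' h A by unfold_locales fact+
  define \<Psi> where "\<Psi> = (SOME \<Psi>. \<exists>\<Theta>. comparison R n K F \<epsilon> \<Theta> \<Psi>)"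
  obtain \<Theta> where C: "comparison R n K F \<epsilon> \<Theta> \<Psi>"
    unfolding \<Psi>_def by (rule U.comparison_some)
  define \<Psi>' where "\<Psi>' = (SOME \<Psi>. \<exists>\<Theta>. comparison R n K' F' \<epsilon>' \<Theta> \<Psi>)"
  obtain \<Theta>' where C': "comparison R n K' F' \<epsilon>' \<Theta>' \<Psi>'"
    unfolding \<Psi>'_def by (rule U'.comparison_some)
  have chain\<Phi>: "chain_map R F F' \<Phi>"
    and \<epsilon>\<Phi>: "\<And>a m. m \<in> carrier (ob (trm F 0) a) \<Longrightarrow> \<epsilon>' a (\<Phi> 0 a m) = homology_map K K' \<phi> (n - 1) a (\<epsilon> a m)"
    using \<Phi> by (auto simp: resolution_lift_def)
  note nat\<phi> = chain_map_natural[OF \<phi>] and nat\<Phi> = chain_map_natural[OF chain\<Phi>]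
  note nat\<Theta> = U.\<Theta>[OF C] and nat\<Psi> = U.\<Psi>[OF C] and nat\<Theta>' = U'.\<Theta>[OF C'] and nat\<Psi>' = U'.\<Psi>[OF C']
  obtain f where f: "f \<in> U'.HF.cocycles 1 s" and X: "X = U'.HF.cls 1 s f"
    using X by (auto simp: U'.Ext_eq U'.HF.carrier_Hom_cohomology)
  note fn = U'.HF.cocycle_natural[OF f]
  let ?f\<Phi> = "Hom_map h (trm F 1) (\<Phi> 1) \<alpha> s f" and ?f\<Psi>' = "Hom_map h (trm K' n) \<Psi>' (\<lambda>x u. u) s f"
  have f\<Phi>: "?f\<Phi> \<in> U.HF.cocycles 1 s"
    using U'.F.is_complex U.F.is_complex A A' \<alpha> chain\<Phi> f by (rule Hom_map_cocycle)
  have f\<Psi>': "?f\<Psi>' \<in> U'.HK.cocycles n s"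
    using C' f by (rule U'.pull_cocycle)
  obtain r where r: "natural_on R UNIV (trm K (n - 1)) (cycles K (n - 1)) r"
    and rz: "\<And>a z. z \<in> carrier (ob (cycles K (n - 1)) a) \<Longrightarrow> r a z = z"
    using cycles_retraction[OF K] by blast
  have r': "natural_on R UNIV (trm K (n - 1)) (trm K (n - 1)) r"
    using r by (simp add: U.K.natural_on_cycles_iff)
  \<comment> \<open>The composites with \<epsilon> and \<epsilon>' are controlled on cycles only.
    Inserting r makes the comparison valid on all of K_{n-1} and changes nothing on boundaries,
    where it is eventually evaluated.\<close>
  let ?p = "\<lambda>a y. \<Phi> 0 a (\<Theta> a (r a y))" and ?p' = "\<lambda>a y. \<Theta>' a (\<phi> (n - 1) a (r a y))"
  have p: "natural_on R UNIV (trm K (n - 1)) (trm F' 0) ?p"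
    using natural_on_comp[OF natural_on_comp[OF r' nat\<Theta>] nat\<Phi>] .
  have p': "natural_on R UNIV (trm K (n - 1)) (trm F' 0) ?p'"
    using natural_on_comp[OF natural_on_comp[OF r' nat\<phi>] nat\<Theta>'] .
  have "\<exists>\<zeta>. natural_on R UNIV (trm K (n - 1)) (trm F' 1) \<zeta> \<and>
    (\<forall>a. \<forall>y\<in>carrier (ob (trm K (n - 1)) a). diff F' 1 a (\<zeta> a y) = ?p a y \<ominus>\<^bsub>ob (trm F' 0) a\<^esub> ?p' a y)"
    using U.projective_K
  proof (rule U'.lift_ker_\<epsilon>)
    show "natural_on R UNIV (trm K (n - 1)) (trm F' 0) (\<lambda>a y. ?p a y \<ominus>\<^bsub>ob (trm F' 0) a\<^esub> ?p' a y)"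
      using U.K.pm U'.F.pm p p' by (rule natural_on_diff)
    fix a y assume y: "y \<in> carrier (ob (trm K (n - 1)) a)"
    interpret H: abelian_group "ob (homology K' (n - 1)) a" using U'.K.pm_homology by (rule pm_abelian_group)
    note ry = natural_on_closed[OF r UNIV_I y]
    have \<Theta>r: "\<Theta> a (r a y) \<in> carrier (ob (trm F 0) a)"
      using natural_on_closed[OF natural_on_comp[OF r' nat\<Theta>] UNIV_I y] .
    note hom = homology_map_hcl[OF U.K.is_complex U'.K.is_complex \<phi> ry]
    have "\<epsilon>' a (?p a y) = hcl K' (n - 1) a (\<phi> (n - 1) a (r a y))"
      using \<epsilon>\<Phi>[OF \<Theta>r] U.\<epsilon>_\<Theta>[OF C ry] hom(2) by simp
    also have "\<dots> = \<epsilon>' a (?p' a y)"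
      using U'.\<epsilon>_\<Theta>[OF C' hom(1)] by simp
    finally show "\<epsilon>' a (?p a y \<ominus>\<^bsub>ob (trm F' 0) a\<^esub> ?p' a y) = \<zero>\<^bsub>ob (homology K' (n - 1)) a\<^esub>"
      using natural_on_minus[OF U'.F.pm U'.K.pm_homology U'.natural_on_\<epsilon> UNIV_I
          natural_on_closed[OF p UNIV_I y] natural_on_closed[OF p' UNIV_I y]]
        natural_on_closed[OF natural_on_comp[OF p' U'.natural_on_\<epsilon>] UNIV_I y]
      by (simp add: H.minus_self)
  qed
  then obtain \<zeta> where \<zeta>: "natural_on R UNIV (trm K (n - 1)) (trm F' 1) \<zeta>"
    and d\<zeta>: "\<And>a y. y \<in> carrier (ob (trm K (n - 1)) a) \<Longrightarrow>
      diff F' 1 a (\<zeta> a y) = ?p a y \<ominus>\<^bsub>ob (trm F' 0) a\<^esub> ?p' a y"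
    by blast
  \<comment> \<open>The cochain \<alpha> o f o \<zeta>, whose coboundary is the difference of the
    two cocycles.\<close>
  let ?k = "\<lambda>x y. target_map h s \<alpha> x (f x (\<zeta> x y))"
  have k: "natural_on R (hom_dom h s) (trm K (n - 1)) (hom_target h s A') ?k"
    using fn \<zeta> \<alpha> by (rule natural_on_Hom_map)
  let ?c = "Hom_map h (trm K n) \<Psi> (\<lambda>x u. u) s ?f\<Phi>" and ?c' = "Hom_map h (trm K n) (\<phi> n) \<alpha> s ?f\<Psi>'"
  have ck: "?c x m = ?k x (diff K n x m) \<oplus>\<^bsub>ob (hom_target h s A') x\<^esub> ?c' x m"
    if x: "x \<in> hom_dom h s" and m: "m \<in> carrier (ob (trm K n) x)" for x m
  proof -
    interpret T: abelian_group "ob (hom_target h s A) x" using U'.HK.target by (rule pm_abelian_group)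
    interpret F0: abelian_group "ob (trm F' 0) x" by (rule U'.F.abelian_group_trm)
    interpret F1: abelian_group "ob (trm F' 1) x" by (rule U'.F.abelian_group_trm)
    let ?b = "diff K n x m"
    have b: "?b \<in> carrier (ob (trm K (n - 1)) x)" using natural_on_closed[OF U.K.diff UNIV_I m] .
    have rb: "r x ?b = ?b" using U.hcl_d[OF m] by (simp add: rz)
    have \<Psi>m: "\<Psi> x m \<in> carrier (ob (trm F 1) x)" using natural_on_closed[OF nat\<Psi> UNIV_I m] .
    have u: "\<Phi> 1 x (\<Psi> x m) \<in> carrier (ob (trm F' 1) x)" using natural_on_closed[OF nat\<Phi> UNIV_I \<Psi>m] .
    have \<phi>m: "\<phi> n x m \<in> carrier (ob (trm K' n) x)" using natural_on_closed[OF nat\<phi> UNIV_I m] .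
    have v: "\<Psi>' x (\<phi> n x m) \<in> carrier (ob (trm F' 1) x)" using natural_on_closed[OF nat\<Psi>' UNIV_I \<phi>m] .
    have w: "\<zeta> x ?b \<in> carrier (ob (trm F' 1) x)" using natural_on_closed[OF \<zeta> UNIV_I b] .
    have du: "diff F' 1 x (\<Phi> 1 x (\<Psi> x m)) = ?p x ?b"
      using chain_map_diff[OF chain\<Phi> \<Psi>m] U.d_\<Psi>[OF C m] by (simp add: rb)
    have dv: "diff F' 1 x (\<Psi>' x (\<phi> n x m)) = ?p' x ?b"
      using chain_map_diff[OF \<phi> m] U'.d_\<Psi>[OF C' \<phi>m] by (simp add: rb)
    note pb = natural_on_closed[OF p UNIV_I b] and pb' = natural_on_closed[OF p' UNIV_I b]
    note fz = natural_on_minus[OF U'.F.pm U'.HK.target fn x]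
    note dz = natural_on_minus[OF U'.F.pm U'.F.pm U'.diff_F1 UNIV_I]
    \<comment> \<open>With p and p' standing for \<open>?p\<close> and \<open>?p'\<close> at b = d
      m, d_1 sends this to p - (p - p') - p' = 0.\<close>
    let ?w = "\<Phi> 1 x (\<Psi> x m) \<ominus>\<^bsub>ob (trm F' 1) x\<^esub> \<zeta> x ?b \<ominus>\<^bsub>ob (trm F' 1) x\<^esub> \<Psi>' x (\<phi> n x m)"
    have "diff F' 1 x ?w = \<zero>\<^bsub>ob (trm F' 0) x\<^esub>"
      unfolding dz[OF F1.minus_closed[OF u w] v] dz[OF u w] du dv d\<zeta>[OF b]
      using pb pb' by (simp add: F0.minus_minus_self F0.minus_self)
    then have "f x ?w = \<zero>\<^bsub>ob (hom_target h s A) x\<^esub>"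
      by (rule U'.cocycle_ker_d1[OF f x F1.minus_closed[OF F1.minus_closed[OF u w] v]])
    then have "f x (\<Phi> 1 x (\<Psi> x m)) = f x (\<zeta> x ?b) \<oplus>\<^bsub>ob (hom_target h s A) x\<^esub> f x (\<Psi>' x (\<phi> n x m))"
      unfolding fz[OF F1.minus_closed[OF u w] v] fz[OF u w]
      by (rule T.minus_minus_eq_zeroD[OF natural_on_closed[OF fn x u] natural_on_closed[OF fn x w]
            natural_on_closed[OF fn x v]])
    then show ?thesis
      using x m \<Psi>m \<phi>m natural_on_add[OF natural_on_target_map[OF \<alpha>] UNIV_I
          natural_on_closed[OF fn x w] natural_on_closed[OF fn x v]]
      by (simp add: Hom_map_eq)
  qed
  have "U.HK.cls n s ?c = U.HK.cls n s ?c'"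
  proof (rule U.HK.cls_eq_iff_natural[THEN iffD2])
    show "?c \<in> nat_trans R (hom_dom h s) (trm K n) (hom_target h s A')"
      using U.pull_cocycle[OF C f\<Phi>] by (simp add: U.HK.mem_cocycles_iff)
    have "?c' \<in> U.HK.cocycles n s"
      using U'.K.is_complex U.K.is_complex A A' \<alpha> \<phi> f\<Psi>' by (rule Hom_map_cocycle)
    then show "?c' \<in> nat_trans R (hom_dom h s) (trm K n) (hom_target h s A')"
      by (simp add: U.HK.mem_cocycles_iff)
  qed (intro exI[of _ ?k] conjI ballI k ck)
  moreover have "Ext_map h R 1 F A' \<Phi> \<alpha> s X = U.HF.cls 1 s ?f\<Phi>"
    unfolding Ext_map_def X
    using f by (intro Hom_cohomology_map_cls[OF U'.F.is_complex U.F.is_complex A A' \<alpha> chain\<Phi>])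
      (simp add: U'.HF.mem_cocycles_iff)
  moreover have "Hom_cohomology_map h R K A' \<phi> \<alpha> n s (U'.HK.cls n s ?f\<Psi>') = U.HK.cls n s ?c'"
    using f\<Psi>' by (intro Hom_cohomology_map_cls[OF U'.K.is_complex U.K.is_complex A A' \<alpha> \<phi>])
      (simp add: U'.HK.mem_cocycles_iff)
  ultimately show ?thesis
    unfolding X U'.uct_inj_cls[OF f, folded \<Psi>'_def] by (simp add: U.uct_inj_cls[OF f\<Phi>, folded \<Psi>_def])
qed

theorem theorem8p7:
  fixes R :: "'r ring" and h :: hom_kind
  assumes "ring R"
  shows "\<forall>n::nat.
    \<exists>(\<iota> :: ('p::preordered_ab_group_add, 'r, 'm) pcomplex \<Rightarrow> ('p, 'r, 'f) pcomplex \<Rightarrow>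
            ('p \<Rightarrow> 'f \<Rightarrow> 'm set) \<Rightarrow> ('p, 'r, 'a) pmod \<Rightarrow>
            'p \<Rightarrow> ('p \<Rightarrow> 'f \<Rightarrow> 'a) set \<Rightarrow> ('p \<Rightarrow> 'm \<Rightarrow> 'a) set)
      (\<pi> :: ('p, 'r, 'm) pcomplex \<Rightarrow> ('p, 'r, 'a) pmod \<Rightarrow>
            'p \<Rightarrow> ('p \<Rightarrow> 'm \<Rightarrow> 'a) set \<Rightarrow> 'p \<Rightarrow> 'm set \<Rightarrow> 'a).
      (\<forall>K F \<epsilon> A.
        admissible_complex R K \<and> persistence_module R A \<and>
        projective_resolution R F \<epsilon> (homology K (int n - 1)) \<longrightarrow>
        short_exact (Ext h R 1 F A) (Hom_cohomology h R K A (int n)) (Hom h R (homology K (int n)) A)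
          (\<iota> K F \<epsilon> A) (\<pi> K A)) \<and>
      (\<forall>K K' \<phi> F \<epsilon> F' \<epsilon>' \<Phi> A A' \<alpha>.
        admissible_complex R K \<and> admissible_complex R K' \<and> chain_map R K K' \<phi> \<and>
        projective_resolution R F \<epsilon> (homology K (int n - 1)) \<and>
        projective_resolution R F' \<epsilon>' (homology K' (int n - 1)) \<and>
        resolution_lift R F \<epsilon> F' \<epsilon>' (homology_map K K' \<phi> (int n - 1)) \<Phi> \<and>
        persistence_module R A \<and> persistence_module R A' \<and> \<alpha> \<in> pmod_hom R A A' \<longrightarrow>
        (\<forall>s.
          (\<forall>x\<in>carrier (ob (Ext h R 1 F' A) s).
            \<iota> K F \<epsilon> A' s (Ext_map h R 1 F A' \<Phi> \<alpha> s x) =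
            Hom_cohomology_map h R K A' \<phi> \<alpha> (int n) s (\<iota> K' F' \<epsilon>' A s x)) \<and>
          (\<forall>y\<in>carrier (ob (Hom_cohomology h R K' A (int n)) s).
            \<pi> K A' s (Hom_cohomology_map h R K A' \<phi> \<alpha> (int n) s y) =
            Hom_map h (homology K (int n)) (homology_map K K' \<phi> (int n)) \<alpha> s (\<pi> K' A s y)))) \<and>
      (left_hereditary TYPE('p \<times> 'm) R \<longrightarrow>
        (\<forall>K (F :: ('p, 'r, 'f) pcomplex) \<epsilon> A.
          admissible_complex R K \<and> persistence_module R A \<and>
          projective_resolution R F \<epsilon> (homology K (int n - 1)) \<longrightarrow>
          split_short_exact (Ext h R 1 F A) (Hom_cohomology h R K A (int n))
            (Hom h R (homology K (int n)) A) (\<iota> K F \<epsilon> A) (\<pi> K A)))"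
\<comment> \<open>The witnesses stay schematic here and are instantiated with \<open>uct_inj\<close>
  and \<open>uct_proj\<close> when the first block shows its claims; the naturality block must then
  be about these same maps.\<close>
proof (rule allI, rule exI, rule exI, intro conjI impI allI ballI)
  fix n :: nat
  have split: "split_short_exact (Ext h R 1 F A) (Hom_cohomology h R K A (int n))
      (Hom h R (homology K (int n)) A) (uct_inj h R (int n) K F \<epsilon> A) (uct_proj h (int n) K)"
    if "admissible_complex R K \<and> persistence_module R A \<and>
      projective_resolution R F \<epsilon> (homology K (int n - 1))"
    for K :: "('p, 'r, 'm) pcomplex" and F :: "('p, 'r, 'f) pcomplex" and \<epsilon> and A :: "('p, 'r, 'a) pmod"
  proof -
    interpret uct R "int n" K F \<epsilon> h A by unfold_locales (use that in blast)+
    show ?thesis by (rule uct_split_short_exact)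
  qed
  fix K :: "('p, 'r, 'm) pcomplex" and F :: "('p, 'r, 'f) pcomplex" and \<epsilon> and A :: "('p, 'r, 'a) pmod"
  assume hyp: "admissible_complex R K \<and> persistence_module R A \<and>
    projective_resolution R F \<epsilon> (homology K (int n - 1))"
  show "split_short_exact (Ext h R 1 F A) (Hom_cohomology h R K A (int n))
      (Hom h R (homology K (int n)) A) (uct_inj h R (int n) K F \<epsilon> A) (uct_proj h (int n) K)"
    using hyp by (rule split)
  then show "short_exact (Ext h R 1 F A) (Hom_cohomology h R K A (int n))
      (Hom h R (homology K (int n)) A) (uct_inj h R (int n) K F \<epsilon> A) (uct_proj h (int n) K)"
    by (simp add: split_short_exact_def)
next
  fix n :: nat and K K' :: "('p, 'r, 'm) pcomplex" and F F' :: "('p, 'r, 'f) pcomplex" and \<phi> \<epsilon> \<epsilon>' \<Phi>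
    and A A' :: "('p, 'r, 'a) pmod" and \<alpha> s
  assume hyp: "admissible_complex R K \<and> admissible_complex R K' \<and> chain_map R K K' \<phi> \<and>
    projective_resolution R F \<epsilon> (homology K (int n - 1)) \<and>
    projective_resolution R F' \<epsilon>' (homology K' (int n - 1)) \<and>
    resolution_lift R F \<epsilon> F' \<epsilon>' (homology_map K K' \<phi> (int n - 1)) \<Phi> \<and>
    persistence_module R A \<and> persistence_module R A' \<and> \<alpha> \<in> pmod_hom R A A'"
  then have \<alpha>: "natural_on R UNIV A A' \<alpha>"
    by (blast intro: nat_trans_natural_on)
  show "uct_inj h R (int n) K F \<epsilon> A' s (Ext_map h R 1 F A' \<Phi> \<alpha> s x) =
      Hom_cohomology_map h R K A' \<phi> \<alpha> (int n) s (uct_inj h R (int n) K' F' \<epsilon>' A s x)"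
    if "x \<in> carrier (ob (Ext h R 1 F' A) s)" for x
    using hyp \<alpha> that by (intro uct_inj_natural) auto
  show "uct_proj h (int n) K s (Hom_cohomology_map h R K A' \<phi> \<alpha> (int n) s y) =
      Hom_map h (homology K (int n)) (homology_map K K' \<phi> (int n)) \<alpha> s (uct_proj h (int n) K' s y)"
    if "y \<in> carrier (ob (Hom_cohomology h R K' A (int n)) s)" for y
    using hyp \<alpha> that by (intro uct_proj_natural) (auto intro: admissible_complex_is_complex)
qed

end
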